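(* Let $d\ge 1$, let $V:\mathbb{R}^d\to\mathbb{R}$ be a $C^2$ function, let $M\in\mathbb{R}^{d\times d}$ be a symmetric positive definite matrix, let $\gamma>0$ be a scalar, and let $\Sigma\in\mathbb{R}^{d\times d}$ be a constant matrix. Consider the stochastic Langevin dynamics for $(q,p)\in\mathbb{R}^d\times\mathbb{R}^d$ $$ \begin{cases} dq = M^{-1}p\,dt,\\ dp = \left(-\gamma M^{-1}p-\nabla V(q)\right)dt+\sqrt{2}\,\Sigma\, dW_t, \end{cases} $$ where $W_t$ is a standard $d$-dimensional Wiener process. Let $\pi$ be an invariant probability distribution of $(q,p)$ under these dynamics. Then $$ \mathrm{Tr}\left((\Sigma\Sigma^T)M^{-1}\right)=\gamma\,\mathbb{E}\left[p^T M^{-2}p\right], $$ where the expectation is taken with respect to $(q,p)\sim\pi$.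
   Context: A probability distribution $\pi$ on $\mathbb{R}^d\times\mathbb{R}^d$ is an invariant distribution of the dynamics if the solution $(q_t,p_t)$ of the stochastic differential equation (understood in the Itô sense) with initial condition $(q_0,p_0)\sim\pi$, independent of the Wiener process, exists for all $t\ge 0$ and satisfies $(q_t,p_t)\sim\pi$ for all $t\ge 0$. The matrix $M$ is called the mass matrix, $\gamma$ the friction constant, $\Sigma$ the diffusion coefficient matrix and $V$ the potential. *)

theory Defs
  imports "HOL-Probability.Probability"
begin

definition gradient :: "(real^'d \<Rightarrow> real) \<Rightarrow> real^'d \<Rightarrow> real^'d" where
  "gradient f x = (THE D. GDERIV f x :> D)"

lemma gradient_eq: "GDERIV f x :> D \<Longrightarrow> gradient f x = D"
proof -
  assume D: "GDERIV f x :> D"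
  have "E = D" if "GDERIV f x :> E" for E
  proof -
    have "(\<lambda>h. h \<bullet> E) = (\<lambda>h. h \<bullet> D)"
      using has_derivative_unique that D unfolding gderiv_def by blast
    then have "\<forall>h. h \<bullet> E = h \<bullet> D"
      by (rule fun_cong[THEN allI])
    then show ?thesis
      by (simp only: vector_eq_ldot)
  qed
  with D show ?thesis
    unfolding gradient_def by (rule the_equality)
qed

text \<open>
  The Jacobian of the gradient is the Hessian matrix.
\<close>

definition twice_continuously_differentiable :: "(real^'d \<Rightarrow> real) \<Rightarrow> bool" where
  "twice_continuously_differentiable f \<longleftrightarrow>
     (\<forall>x. f differentiable at x) \<and>
     (\<forall>x. gradient f differentiable at x) \<and>
     continuous_on UNIV (\<lambda>x. jacobian (gradient f) (at x))"

definition symmetric_positive_definite :: "real^'d^'d \<Rightarrow> bool" where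
  "symmetric_positive_definite A \<longleftrightarrow>
     transpose A = A \<and> (\<forall>x. x \<noteq> 0 \<longrightarrow> x \<bullet> (A *v x) > 0)"

text \<open>
  Standard Wiener process relative to a filtration.  Time runs through the nonnegative
  reals; the values of \<open>F\<close>, \<open>W\<close>, \<open>q\<close>, \<open>p\<close> at negative times play no role (a filtration
  on \<open>{0..}\<close> may be extended by the trivial sigma-algebra).  The density below is the one
  of the centred Gaussian with covariance matrix \<open>(t - s) I\<close>.
\<close>

definition wiener_process ::
    "'w measure \<Rightarrow> (real \<Rightarrow> 'w measure) \<Rightarrow> (real \<Rightarrow> 'w \<Rightarrow> real^'d) \<Rightarrow> bool" where
  "wiener_process P F W \<longleftrightarrow>
     (\<forall>t\<ge>0. W t \<in> borel_measurable (F t)) \<and>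
     (AE \<omega> in P. W 0 \<omega> = 0) \<and>
     (AE \<omega> in P. continuous_on {0..} (\<lambda>t. W t \<omega>)) \<and>
     (\<forall>s t. 0 \<le> s \<and> s < t \<longrightarrow>
        distributed P lborel (\<lambda>\<omega>. W t \<omega> - W s \<omega>)
          (\<lambda>x. ennreal (\<Prod>i\<in>UNIV. normal_density 0 (sqrt (t - s)) (x $ i))) \<and>
        prob_space.indep_set P (sets (F s))
          (sets (vimage_algebra (space P) (\<lambda>\<omega>. W t \<omega> - W s \<omega>) borel)))"

text \<open>
  Solutions of the Langevin equation that exist for all nonnegative times.  The diffusion
  coefficient is constant, so the Ito integral of \<open>sqrt 2 \<Sigma>\<close> against \<open>dW\<close> over \<open>[0, t]\<close>
  is \<open>sqrt 2 \<Sigma> (W\<^sub>t - W\<^sub>0)\<close>.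
\<close>

definition langevin_solution ::
    "(real^'d \<Rightarrow> real) \<Rightarrow> real^'d^'d \<Rightarrow> real \<Rightarrow> real^'d^'d \<Rightarrow>
     'w measure \<Rightarrow> (real \<Rightarrow> 'w measure) \<Rightarrow> (real \<Rightarrow> 'w \<Rightarrow> real^'d) \<Rightarrow>
     (real \<Rightarrow> 'w \<Rightarrow> real^'d) \<Rightarrow> (real \<Rightarrow> 'w \<Rightarrow> real^'d) \<Rightarrow> bool" where
  "langevin_solution V M \<gamma> \<Sigma> P F W q p \<longleftrightarrow>
     (\<forall>t\<ge>0. q t \<in> borel_measurable (F t) \<and> p t \<in> borel_measurable (F t)) \<and>
     (AE \<omega> in P. continuous_on {0..} (\<lambda>t. q t \<omega>) \<and> continuous_on {0..} (\<lambda>t. p t \<omega>)) \<and>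
     (AE \<omega> in P. \<forall>t\<ge>0.
        ((\<lambda>s. matrix_inv M *v p s \<omega>) has_integral (q t \<omega> - q 0 \<omega>)) {0..t} \<and>
        ((\<lambda>s. - \<gamma> *\<^sub>R (matrix_inv M *v p s \<omega>) - gradient V (q s \<omega>)) has_integral
           (p t \<omega> - p 0 \<omega> - sqrt 2 *\<^sub>R (\<Sigma> *v (W t \<omega> - W 0 \<omega>)))) {0..t})"

text \<open>
  The drift is locally Lipschitz when \<open>V\<close> is twice continuously differentiable, so
  solutions are pathwise unique and the law of the solution started from \<open>\<pi>\<close> does not depend
  on the stochastic basis.  It is therefore enough that one basis carries a stationary
  solution; its sample space is taken in the type \<open>'w\<close>.
\<close>

definition langevin_invariant_distribution ::
    "'w itself \<Rightarrow> (real^'d \<Rightarrow> real) \<Rightarrow> real^'d^'d \<Rightarrow> real \<Rightarrow> real^'d^'d \<Rightarrow>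
     ((real^'d) \<times> (real^'d)) measure \<Rightarrow> bool" where
  "langevin_invariant_distribution (_ :: 'w itself) V M \<gamma> \<Sigma> \<pi> \<longleftrightarrow>
     prob_space \<pi> \<and> sets \<pi> = sets borel \<and>
     (\<exists>(P :: 'w measure) F W q p.
        prob_space P \<and>
        filtration (space P) F \<and> (\<forall>t. subalgebra P (F t)) \<and>
        wiener_process P F W \<and>
        langevin_solution V M \<gamma> \<Sigma> P F W q p \<and>
        prob_space.indep_set P
          (sets (vimage_algebra (space P) (\<lambda>\<omega>. (q 0 \<omega>, p 0 \<omega>)) borel))
          (sets (vimage_algebra (space P) (\<lambda>\<omega>. \<lambda>t\<in>{0..}. W t \<omega>) (Pi\<^sub>M {0..} (\<lambda>_. borel)))) \<and>
        (\<forall>t\<ge>0. distr P borel (\<lambda>\<omega>. (q t \<omega>, p t \<omega>)) = \<pi>))"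

end

theory Submission
  imports Defs
begin

text \<open>
  Formally, the energy \<open>H = p \<bullet> N p / 2 + V q\<close> with \<open>N = M\<^sup>-\<^sup>1\<close> has drift
  \<open>tr (\<Sigma>\<Sigma>\<^sup>T N) - \<gamma> |N p|\<^sup>2\<close>, whose mean vanishes under a stationary law.  Since \<open>V\<close> satisfies no growth
  condition, \<open>H\<close> need not be integrable, so we work with \<open>f H\<close> for \<open>f x = arctan (\<epsilon> x) / \<epsilon>\<close>.
  Its drift is \<open>f' H (tr (\<Sigma>\<Sigma>\<^sup>T N) - \<gamma> |N p|\<^sup>2) + f'' H |\<Sigma>\<^sup>T N p|\<^sup>2\<close>, and \<open>|f''| \<le> \<epsilon> f'\<close> makes it
  bounded above for small \<open>\<epsilon>\<close>; monotone convergence as \<open>\<epsilon>\<close> tends to 0 yields integrability, dominated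
  convergence the identity.

  The mean drift of \<open>f H\<close> is obtained without stochastic integrals.  On the grid \<open>k / n\<close> of \<open>[0, 1]\<close>,
  stopped when the path leaves a ball, the increment of \<open>f H\<close> splits into the effect of the Gaussian
  increment alone (the ``kick'', expanded by Taylor's formula and averaged using independence) and the
  effect of the remaining absolutely continuous motion, which is treated path by path.  The sums of
  the latter converge almost surely and are bounded in \<open>L\<^sup>2\<close>, because the total increment is bounded and the
  kicks are a martingale plus a small remainder; so their means converge, too.  Stationarity turns the
  limit into an integral against the invariant law, and since paths are bounded on \<open>[0, 1]\<close> the
  stopping becomes irrelevant as the radius grows.
\<close>

section \<open>Increments of the energy along a path\<close>

text \<open>The noise is additive, so with \<open>B = S W\<close> the path of \<open>p - B\<close>
  is continuously differentiable, and ordinary calculus applies to each path. The force enters the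
  energy twice with opposite signs, through \<open>V q\<close> and through \<open>p\<close>; so
  neither the dissipation nor the noise term contains the gradient of \<open>V\<close>, and the lack
  of growth bounds on it does no harm. The obstacle is that stopping at grid times does not confine
  the path between them. The pathwise errors are small compared with \<open>1 / n\<close> only at a
  rate that depends on the path, and nothing dominates them. The passage to means therefore uses a
  second moment bound, obtained indirectly: of the three sums in the balance only the kicks are
  unbounded, and Gaussian moments control them. The arctangent serves three purposes. It is bounded,
  so telescoped increments are bounded. Its derivative \<open>f'\<close> is positive and tends to 1
  with \<epsilon>. Finally 2 |z| \<le> 1 + z^2 gives |f''| \<le> \<epsilon> f', so for small
  \<epsilon> half of the friction term absorbs the term with f'' without any prior moment of
  \<open>p\<close>.\<close>

lemma has_integral_uniform_linearization:
  fixes c G :: "real \<Rightarrow> 'a::banach"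
  assumes cont: "continuous_on {a..b} c"
    and int: "\<And>s t. a \<le> s \<Longrightarrow> s \<le> t \<Longrightarrow> t \<le> b \<Longrightarrow> (c has_integral (G t - G s)) {s..t}"
    and e: "e > 0"
  obtains d where "d > 0"
    "\<And>s t. a \<le> s \<Longrightarrow> s \<le> t \<Longrightarrow> t \<le> b \<Longrightarrow> t - s < d \<Longrightarrow>
       norm (G t - G s - (t - s) *\<^sub>R c s) \<le> e * (t - s)"
proof -
  have "uniformly_continuous_on {a..b} c"
    using cont by (intro compact_uniformly_continuous) auto
  then obtain d where d: "d > 0"
    and dc: "\<And>x y. x \<in> {a..b} \<Longrightarrow> y \<in> {a..b} \<Longrightarrow> dist y x < d \<Longrightarrow> dist (c y) (c x) < e"
    unfolding uniformly_continuous_on_def using e by metis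
  have "norm (G t - G s - (t - s) *\<^sub>R c s) \<le> e * (t - s)"
    if st: "a \<le> s" "s \<le> t" "t \<le> b" "t - s < d" for s t
  proof -
    have int2: "((\<lambda>u. c u - c s) has_integral (G t - G s - measure lborel {s..t} *\<^sub>R c s)) {s..t}"
      using int[OF st(1-3)] by (intro has_integral_diff has_integral_const_real) auto
    have "norm (G t - G s - measure lborel {s..t} *\<^sub>R c s) \<le> e * measure lborel {s..t}"
    proof (rule has_integral_bound_real[OF _ finite.emptyI int2])
      fix x assume "x \<in> {s..t} - {}"
      then show "norm (c x - c s) \<le> e"
        using dc[of s x] st by (auto simp: dist_norm less_imp_le)
    qed (use e in auto)
    then show ?thesis using st by simp
  qed
  with d that show thesis by blast
qed

lemma has_integral_increment:
  fixes c G :: "real \<Rightarrow> 'a::banach"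
  assumes "\<And>t. 0 \<le> t \<Longrightarrow> (c has_integral (G t - G 0)) {0..t}" and "0 \<le> s" "s \<le> t"
  shows "(c has_integral (G t - G s)) {s..t}"
proof -
  have "c integrable_on {s..t}"
    by (rule integrable_on_subinterval[OF has_integral_integrable[OF assms(1)[of t]]]) (use assms(2,3) in auto)
  then obtain j where j: "(c has_integral j) {s..t}" by blast
  have "(c has_integral (G s - G 0 + j)) {0..t}"
    using assms j by (intro has_integral_combine[of 0 s t]) auto
  with assms(1)[of t] assms(2,3) have "G s - G 0 + j = G t - G 0"
    by (intro has_integral_unique) auto
  then have "j = G t - G s" by (simp add: algebra_simps)
  with j show ?thesis by simp
qed

lemma has_vector_derivative_of_integral:
  fixes c G :: "real \<Rightarrow> 'a::banach"
  assumes cont: "continuous_on {a..b} c"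
    and int: "\<And>t. a \<le> t \<Longrightarrow> t \<le> b \<Longrightarrow> (c has_integral (G t - G a)) {a..t}"
    and s: "s \<in> {a..b}"
  shows "(G has_vector_derivative c s) (at s within {a..b})"
proof -
  have "((\<lambda>u. G a + integral {a..u} c) has_vector_derivative (0 + c s)) (at s within {a..b})"
    by (intro has_vector_derivative_add has_vector_derivative_const
        integral_has_vector_derivative[OF cont s])
  then have "((\<lambda>u. G a + integral {a..u} c) has_vector_derivative c s) (at s within {a..b})" by simp
  then show ?thesis
  proof (rule has_vector_derivative_transform[OF s, rotated])
    fix x assume "x \<in> {a..b}"
    then show "G x = G a + integral {a..x} c" using int[of x] by (auto dest!: integral_unique)
  qed
qed

lemma continuous_on_norm_bound:
  fixes c :: "real \<Rightarrow> 'a::real_normed_vector"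
  assumes "continuous_on {a..b} c"
  obtains K where "K \<ge> 1" "\<And>s. s \<in> {a..b} \<Longrightarrow> norm (c s) \<le> K"
proof -
  have "bounded (c ` {a..b})"
    using assms by (intro compact_imp_bounded compact_continuous_image) auto
  then obtain K where "\<forall>x\<in>c ` {a..b}. norm x \<le> K" by (auto simp: bounded_iff)
  then show thesis by (intro that[of "max 1 K"]) force+
qed

text \<open>A deterministic statement about one path. With \<open>p t = p s + b + \<beta>\<close>,
  where \<open>b\<close> is the increment of \<open>B\<close>, the change of \<open>V\<close> along
  \<open>q\<close> and the force contained in \<open>N (p s) \<bullet> \<beta>\<close> cancel to
  first order, which leaves the friction. The term quadratic in \<open>b\<close> is kept exactly:
  for a Wiener path it has the order of the step.\<close>

lemma langevin_energy_increment:
  fixes q p B :: "real \<Rightarrow> 'a::euclidean_space" and N :: "'a \<Rightarrow> 'a" and V :: "'a \<Rightarrow> real"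
  assumes N: "bounded_linear N" and sym: "\<And>x y. x \<bullet> N y = N x \<bullet> y"
    and V: "\<And>x. GDERIV V x :> V' x" and V': "continuous_on UNIV V'"
    and q: "continuous_on {0..} q" and p: "continuous_on {0..} p"
    and Iq: "\<And>t. 0 \<le> t \<Longrightarrow> ((\<lambda>s. N (p s)) has_integral (q t - q 0)) {0..t}"
    and Ip: "\<And>t. 0 \<le> t \<Longrightarrow>
      ((\<lambda>s. - \<gamma> *\<^sub>R N (p s) - V' (q s)) has_integral (p t - p 0 - (B t - B 0))) {0..t}"
    and e: "e > 0"
  shows "\<exists>d>0. \<forall>s t. 0 \<le> s \<and> s \<le> t \<and> t \<le> 1 \<and> t - s < d \<longrightarrow>
      \<bar>(p t \<bullet> N (p t) / 2 + V (q t)) - (p s \<bullet> N (p s) / 2 + V (q s))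
        - (N (p s) \<bullet> (B t - B s) + (B t - B s) \<bullet> N (B t - B s) / 2)
        + (t - s) * (\<gamma> * (norm (N (p s)))\<^sup>2)\<bar> \<le> e * (t - s)"
proof -
  interpret N: bounded_linear N by fact
  let ?b = "\<lambda>s. - \<gamma> *\<^sub>R N (p s) - V' (q s)"
  have q1: "continuous_on {0..1} q" and p1: "continuous_on {0..1} p"
    using q p by (auto elim: continuous_on_subset)
  have V'q: "continuous_on {0..1} (\<lambda>s. V' (q s))"
    by (rule continuous_on_compose2[OF V' q1]) auto
  have Np: "continuous_on {0..1} (\<lambda>s. N (p s))"
    using p1 by (rule N.continuous_on)
  have b: "continuous_on {0..1} ?b"
    by (intro continuous_intros V'q Np)
  have qder: "(q has_vector_derivative N (p s)) (at s within {0..1})" if "s \<in> {0..1}" for s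
    by (rule has_vector_derivative_of_integral[OF Np _ that]) (use Iq in auto)
  have Vq: "((\<lambda>s. V (q s)) has_vector_derivative (V' (q s) \<bullet> N (p s))) (at s within {0..1})"
    if "s \<in> {0..1}" for s
  proof -
    have "((\<lambda>s. V (q s)) has_derivative (\<lambda>h. (h *\<^sub>R N (p s)) \<bullet> V' (q s))) (at s within {0..1})"
      using has_derivative_compose[OF qder[OF that, unfolded has_vector_derivative_def]
          V[of "q s", unfolded gderiv_def]] .
    then show ?thesis by (simp add: has_vector_derivative_def inner_commute)
  qed
  obtain K1 where K1: "K1 \<ge> 1" "\<And>s. s \<in> {0..1} \<Longrightarrow> norm (N (p s)) \<le> K1"
    using continuous_on_norm_bound[OF Np] by metis
  obtain K2 where K2: "K2 \<ge> 1" "\<And>s. s \<in> {0..1} \<Longrightarrow> norm (?b s) \<le> K2"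
    using continuous_on_norm_bound[OF b] by metis
  obtain C where C: "C > 0" "\<And>x. norm (N x) \<le> norm x * C" using N.pos_bounded by blast
  define K where "K = max K1 K2"
  \<comment> \<open>Three of the four error terms cost \<open>\<eta>\<close>,
    \<open>2 * K * \<eta>\<close> and \<open>K * \<eta>\<close> per unit of time; together they get
    half of \<open>e\<close>. The other half is reserved for
    \<open>\<beta> \<bullet> N \<beta> / 2\<close>.\<close>
  define \<eta> where "\<eta> = min 1 (e / (2 * (1 + 3 * K)))"
  have K: "K \<ge> 1" "\<And>s. s \<in> {0..1} \<Longrightarrow> norm (N (p s)) \<le> K" "\<And>s. s \<in> {0..1} \<Longrightarrow> norm (?b s) \<le> K"
    using K1 K2 by (auto simp: K_def intro: le_max_iff_disj[THEN iffD2])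
  have \<eta>: "\<eta> > 0" "\<eta> \<le> 1" "\<eta> * (1 + 3 * K) \<le> e / 2"
  proof -
    show "\<eta> > 0" "\<eta> \<le> 1" using e K(1) by (auto simp: \<eta>_def)
    have "\<eta> \<le> e / (2 * (1 + 3 * K))" by (simp add: \<eta>_def)
    then show "\<eta> * (1 + 3 * K) \<le> e / 2" using K(1) by (simp add: pos_le_divide_eq algebra_simps)
  qed
  have cVq: "continuous_on {0..1} (\<lambda>s. V' (q s) \<bullet> N (p s))"
    by (intro continuous_on_inner V'q Np)
  have iVq: "((\<lambda>s. V' (q s) \<bullet> N (p s)) has_integral V (q t) - V (q s)) {s..t}"
    if "0 \<le> s" "s \<le> t" "t \<le> 1" for s t
  proof (rule fundamental_theorem_of_calculus)
    fix x assume "x \<in> {s..t}"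
    with that show "((\<lambda>s. V (q s)) has_vector_derivative V' (q x) \<bullet> N (p x)) (at x within {s..t})"
      by (intro has_vector_derivative_within_subset[OF Vq]) auto
  qed (use that in simp)
  have ip: "(?b has_integral (p t - B t) - (p s - B s)) {s..t}"
    if "0 \<le> s" "s \<le> t" "t \<le> 1" for s t
    by (rule has_integral_increment[OF _ that(1,2)]) (use Ip in \<open>simp add: algebra_simps\<close>)
  from has_integral_uniform_linearization[OF cVq iVq \<eta>(1)]
  obtain d1 where d1: "d1 > 0" "\<And>s t. 0 \<le> s \<Longrightarrow> s \<le> t \<Longrightarrow> t \<le> 1 \<Longrightarrow> t - s < d1 \<Longrightarrow>
       norm (V (q t) - V (q s) - (t - s) *\<^sub>R (V' (q s) \<bullet> N (p s))) \<le> \<eta> * (t - s)"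
    by metis
  from has_integral_uniform_linearization[OF b ip \<eta>(1)]
  obtain d2 where d2: "d2 > 0" "\<And>s t. 0 \<le> s \<Longrightarrow> s \<le> t \<Longrightarrow> t \<le> 1 \<Longrightarrow> t - s < d2 \<Longrightarrow>
       norm ((p t - B t) - (p s - B s) - (t - s) *\<^sub>R ?b s) \<le> \<eta> * (t - s)"
    by metis
  have "uniformly_continuous_on {0..1} (\<lambda>s. N (p s))"
    using Np by (intro compact_uniformly_continuous) auto
  then obtain d3 where d3: "d3 > 0"
    "\<And>s t. s \<in> {0..1} \<Longrightarrow> t \<in> {0..1} \<Longrightarrow> dist t s < d3 \<Longrightarrow> dist (N (p t)) (N (p s)) < \<eta>"
    unfolding uniformly_continuous_on_def using \<eta>(1) by metis
  \<comment> \<open>The last entry turns the bound on \<open>\<beta> \<bullet> N \<beta>\<close>,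
    which is quadratic in the step, into one by \<open>e\<close> times the step.\<close>
  define d where "d = Min {d1, d2, d3, e / (4 * C * K\<^sup>2)}"
  have d: "d > 0" "d \<le> d1" "d \<le> d2" "d \<le> d3" "d \<le> e / (4 * C * K\<^sup>2)"
    using d1(1) d2(1) d3(1) e C(1) K(1) by (auto simp: d_def)
  show ?thesis
  proof (intro exI[of _ d] conjI allI impI d(1))
    fix s t assume st: "0 \<le> s \<and> s \<le> t \<and> t \<le> 1 \<and> t - s < d"
    define h where "h = t - s"
    define b where "b = B t - B s"
    define \<beta> where "\<beta> = p t - p s - b"
    define e1 where "e1 = \<beta> - h *\<^sub>R ?b s"
    define e2 where "e2 = V (q t) - V (q s) - h * (V' (q s) \<bullet> N (p s))"
    have h: "0 \<le> h" "h < d" using st by (auto simp: h_def)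
    have e1: "norm e1 \<le> \<eta> * h"
      using d2(2)[of s t] st d by (simp add: e1_def \<beta>_def b_def h_def algebra_simps)
    have e2: "\<bar>e2\<bar> \<le> \<eta> * h"
      using d1(2)[of s t] st d by (simp add: e2_def h_def)
    have e3: "norm (N (p t) - N (p s)) \<le> \<eta>"
      using d3(2)[of s t] st d by (auto simp: dist_norm)
    have Ks: "norm (N (p s)) \<le> K" "norm (?b s) \<le> K" using K st by auto
    have \<beta>_eq: "\<beta> = h *\<^sub>R ?b s + e1" by (simp add: e1_def)
    have \<beta>: "norm \<beta> \<le> 2 * K * h"
    proof -
      have "norm \<beta> \<le> h * norm (?b s) + norm e1"
        using norm_triangle_ineq[of "h *\<^sub>R ?b s" e1] h by (simp add: \<beta>_eq)
      also have "\<dots> \<le> h * K + 1 * h"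
        using Ks h e1 \<eta>(2) mult_right_mono[OF \<eta>(2) h(1)] by (intro add_mono mult_left_mono) auto
      also have "\<dots> \<le> 2 * K * h" using mult_right_mono[OF K(1) h(1)] by (simp add: algebra_simps)
      finally show ?thesis .
    qed
    have pt: "p t = p s + b + \<beta>" by (simp add: \<beta>_def)
    have Nb: "N (p s) \<bullet> \<beta> = - h * (\<gamma> * (norm (N (p s)))\<^sup>2) - h * (V' (q s) \<bullet> N (p s)) + N (p s) \<bullet> e1"
      by (simp add: \<beta>_eq inner_add_right inner_diff_right power2_norm_eq_inner inner_commute algebra_simps)
    \<comment> \<open>The cross term \<open>b \<bullet> N \<beta>\<close> is delicate, since
      \<open>b\<close> is small only by continuity of the path. Symmetry of \<open>N\<close> hides
      it in \<open>(N (p t) - N (p s)) \<bullet> \<beta>\<close>, where uniform continuity of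
      \<open>N p\<close> is enough because \<open>\<beta>\<close> has the order of the step. This
      counts \<open>\<beta> \<bullet> N \<beta> / 2\<close> once too often, hence the
      subtraction.\<close>
    have "(p t \<bullet> N (p t) / 2 + V (q t)) - (p s \<bullet> N (p s) / 2 + V (q s))
        - (N (p s) \<bullet> b + b \<bullet> N b / 2) + h * (\<gamma> * (norm (N (p s)))\<^sup>2)
      = (V (q t) - V (q s)) + (N (p t) - N (p s)) \<bullet> \<beta> + N (p s) \<bullet> \<beta> - \<beta> \<bullet> N \<beta> / 2
        + h * (\<gamma> * (norm (N (p s)))\<^sup>2)"
    proof -
      have flip: "N x \<bullet> y = x \<bullet> N y" for x y by (simp add: sym)
      have swap: "b \<bullet> N (p s) = p s \<bullet> N b" "\<beta> \<bullet> N (p s) = p s \<bullet> N \<beta>" "\<beta> \<bullet> N b = b \<bullet> N \<beta>"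
        using sym inner_commute by metis+
      show ?thesis
        unfolding pt by (simp add: N.add N.diff inner_add_left inner_add_right flip swap field_simps)
    qed
    also have "\<dots> = e2 + (N (p t) - N (p s)) \<bullet> \<beta> + N (p s) \<bullet> e1 - \<beta> \<bullet> N \<beta> / 2"
      unfolding Nb by (simp add: e2_def)
    finally have eq: "(p t \<bullet> N (p t) / 2 + V (q t)) - (p s \<bullet> N (p s) / 2 + V (q s))
        - (N (p s) \<bullet> b + b \<bullet> N b / 2) + h * (\<gamma> * (norm (N (p s)))\<^sup>2)
      = e2 + (N (p t) - N (p s)) \<bullet> \<beta> + N (p s) \<bullet> e1 - \<beta> \<bullet> N \<beta> / 2" .
    have x1: "\<bar>(N (p t) - N (p s)) \<bullet> \<beta>\<bar> \<le> \<eta> * (2 * K * h)"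
      by (rule order_trans[OF Cauchy_Schwarz_ineq2]) (use e3 \<beta> \<eta> in \<open>intro mult_mono, auto\<close>)
    have x2: "\<bar>N (p s) \<bullet> e1\<bar> \<le> K * (\<eta> * h)"
      by (rule order_trans[OF Cauchy_Schwarz_ineq2]) (use e1 Ks K in \<open>intro mult_mono, auto\<close>)
    have x3: "\<bar>\<beta> \<bullet> N \<beta> / 2\<bar> \<le> h * (e / 2)"
    proof -
      have "\<bar>\<beta> \<bullet> N \<beta>\<bar> \<le> norm \<beta> * (norm \<beta> * C)"
        using Cauchy_Schwarz_ineq2[of \<beta> "N \<beta>"] mult_left_mono[OF C(2)[of \<beta>] norm_ge_zero[of \<beta>]] by simp
      also have "\<dots> \<le> (2 * K * h) * ((2 * K * h) * C)"
        using \<beta> C(1) K(1) h by (intro mult_mono) auto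
      also have "\<dots> = h * (4 * C * K\<^sup>2) * h" by (simp add: power2_eq_square)
      also have "\<dots> \<le> h * (4 * C * K\<^sup>2) * (e / (4 * C * K\<^sup>2))"
        using h d(5) C(1) by (intro mult_left_mono) auto
      also have "\<dots> = h * e" using C(1) K(1) by simp
      finally show ?thesis by simp
    qed
    have "\<bar>e2 + (N (p t) - N (p s)) \<bullet> \<beta> + N (p s) \<bullet> e1 - \<beta> \<bullet> N \<beta> / 2\<bar>
        \<le> \<eta> * h + \<eta> * (2 * K * h) + K * (\<eta> * h) + h * (e / 2)"
      using e2 x1 x2 x3 by linarith
    also have "\<dots> = h * (\<eta> * (1 + 3 * K)) + h * (e / 2)" by (simp add: algebra_simps)
    also have "\<dots> \<le> h * (e / 2) + h * (e / 2)"
      using \<eta>(3) h(1) by (intro add_right_mono mult_left_mono) auto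
    also have "\<dots> = e * h" by simp
    finally show "\<bar>(p t \<bullet> N (p t) / 2 + V (q t)) - (p s \<bullet> N (p s) / 2 + V (q s))
        - (N (p s) \<bullet> (B t - B s) + (B t - B s) \<bullet> N (B t - B s) / 2)
        + (t - s) * (\<gamma> * (norm (N (p s)))\<^sup>2)\<bar> \<le> e * (t - s)"
      using eq by (simp add: h_def b_def)
  qed
qed

lemma derivative_bound_Lipschitz:
  fixes g g' :: "real \<Rightarrow> real"
  assumes "\<And>x. DERIV g x :> g' x" "\<And>x. \<bar>g' x\<bar> \<le> K"
  shows "\<bar>g y - g x\<bar> \<le> K * \<bar>y - x\<bar>"
  using field_differentiable_bound[of UNIV g g' K y x] assms
  by (auto intro: has_field_derivative_at_within)

text \<open>The comparison point is the kicked energy \<open>H s + w s t\<close>, not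
  \<open>H s\<close>. Its distance \<open>r\<close> to \<open>H t\<close> has the order of the step,
  so the mean value theorem suffices here; \<open>w\<close>, which is larger, stays inside
  \<open>f\<close> and is expanded only under the expectation.\<close>

lemma langevin_observable_increment:
  fixes q p B :: "real \<Rightarrow> 'a::euclidean_space" and N :: "'a \<Rightarrow> 'a" and V :: "'a \<Rightarrow> real"
    and f f1 f2 :: "real \<Rightarrow> real" and \<gamma> :: real
  defines "H t \<equiv> p t \<bullet> N (p t) / 2 + V (q t)"
  defines "w s t \<equiv> N (p s) \<bullet> (B t - B s) + (B t - B s) \<bullet> N (B t - B s) / 2"
  assumes N: "bounded_linear N" and sym: "\<And>x y. x \<bullet> N y = N x \<bullet> y"
    and V: "\<And>x. GDERIV V x :> V' x" and V': "continuous_on UNIV V'"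
    and q: "continuous_on {0..} q" and p: "continuous_on {0..} p"
    and Iq: "\<And>t. 0 \<le> t \<Longrightarrow> ((\<lambda>s. N (p s)) has_integral (q t - q 0)) {0..t}"
    and Ip: "\<And>t. 0 \<le> t \<Longrightarrow>
      ((\<lambda>s. - \<gamma> *\<^sub>R N (p s) - V' (q s)) has_integral (p t - p 0 - (B t - B 0))) {0..t}"
    and f1: "\<And>x. DERIV f x :> f1 x" and f2: "\<And>x. DERIV f1 x :> f2 x"
    and K1: "\<And>x. \<bar>f1 x\<bar> \<le> K1" and K2: "\<And>x. \<bar>f2 x\<bar> \<le> K2"
    and e: "e > 0"
  shows "\<exists>d>0. \<forall>s t. 0 \<le> s \<and> s \<le> t \<and> t \<le> 1 \<and> t - s < d \<longrightarrow>
      \<bar>f (H t) - f (H s + w s t) + (t - s) * (f1 (H s) * (\<gamma> * (norm (N (p s)))\<^sup>2))\<bar> \<le> e * (t - s)"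
proof -
  interpret N: bounded_linear N by fact
  have q1: "continuous_on {0..1} q" and p1: "continuous_on {0..1} p"
    using q p by (auto elim: continuous_on_subset)
  have V_cont: "continuous_on UNIV V"
    using V unfolding gderiv_def by (meson continuous_at_imp_continuous_on has_derivative_continuous)
  have Np: "continuous_on {0..1} (\<lambda>s. N (p s))"
    using p1 by (rule N.continuous_on)
  have H: "continuous_on {0..1} H"
    unfolding H_def by (intro continuous_intros p1 Np continuous_on_compose2[OF V_cont q1]) auto
  obtain K where K: "K \<ge> 1" "\<And>s. s \<in> {0..1} \<Longrightarrow> norm (N (p s)) \<le> K"
    using continuous_on_norm_bound[OF Np] by metis
  have K0: "0 \<le> K1" "0 \<le> K2"
    using K1[of 0] K2[of 0] by linarith+
  \<comment> \<open>\<open>L\<close> bounds \<open>r\<close> per unit of time: 1 for the error (this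
    is why \<open>e' \<le> 1\<close>), the rest for the friction. \<open>\<eta>\<close> is chosen so
    that replacing \<open>\<xi>\<close> by \<open>H s\<close>, at distance at most
    \<open>2 * \<eta>\<close>, costs at most half of \<open>e\<close>. The summands 1 next to
    \<open>K1\<close> and \<open>K2\<close> avoid division by zero.\<close>
  define L where "L = 1 + \<bar>\<gamma>\<bar> * K\<^sup>2"
  define e' where "e' = min 1 (e / (2 * (K1 + 1)))"
  define \<eta> where "\<eta> = e / (4 * (K2 + 1) * L)"
  have L: "L \<ge> 1" by (simp add: L_def)
  have e': "e' > 0" "e' \<le> 1" "K1 * e' \<le> e / 2"
  proof -
    show "e' > 0" "e' \<le> 1" using e K0 by (auto simp: e'_def)
    have "e' \<le> e / (2 * (K1 + 1))" by (simp add: e'_def)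
    then have "(K1 + 1) * e' \<le> e / 2" using K0 by (simp add: pos_le_divide_eq algebra_simps)
    with \<open>e' > 0\<close> show "K1 * e' \<le> e / 2" by (simp add: algebra_simps)
  qed
  have \<eta>: "\<eta> > 0" using e K0 L by (simp add: \<eta>_def)
  have "uniformly_continuous_on {0..1} H"
    using H by (intro compact_uniformly_continuous) auto
  then obtain d1 where d1: "d1 > 0"
    "\<And>s t. s \<in> {0..1} \<Longrightarrow> t \<in> {0..1} \<Longrightarrow> dist t s < d1 \<Longrightarrow> dist (H t) (H s) < \<eta>"
    unfolding uniformly_continuous_on_def using \<eta> by metis
  obtain d2 where d2: "d2 > 0"
    "\<And>s t. 0 \<le> s \<and> s \<le> t \<and> t \<le> 1 \<and> t - s < d2 \<Longrightarrow>
      \<bar>H t - H s - w s t + (t - s) * (\<gamma> * (norm (N (p s)))\<^sup>2)\<bar> \<le> e' * (t - s)"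
    using langevin_energy_increment[OF N sym V V' q p Iq Ip e'(1)] unfolding H_def w_def by blast
  define d where "d = Min {d1, d2, \<eta> / L}"
  have d: "d > 0" "d \<le> d1" "d \<le> d2" "d \<le> \<eta> / L"
    using d1(1) d2(1) \<eta> L by (auto simp: d_def)
  show ?thesis
  proof (intro exI[of _ d] conjI allI impI d(1))
    fix s t assume st: "0 \<le> s \<and> s \<le> t \<and> t \<le> 1 \<and> t - s < d"
    define h where "h = t - s"
    define r where "r = H t - (H s + w s t)"
    define a where "a = \<gamma> * (norm (N (p s)))\<^sup>2"
    have h: "0 \<le> h" "h < d" using st by (auto simp: h_def)
    have r1: "\<bar>r + h * a\<bar> \<le> e' * h"
      using d2(2)[of s t] st d by (simp add: r_def h_def a_def algebra_simps)
    have a: "\<bar>a\<bar> \<le> \<bar>\<gamma>\<bar> * K\<^sup>2"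
      unfolding a_def abs_mult using K(2)[of s] st by (intro mult_left_mono) (auto intro: power_mono)
    have r2: "\<bar>r\<bar> \<le> L * h"
    proof -
      have "\<bar>r\<bar> \<le> e' * h + \<bar>h * a\<bar>" using r1 by linarith
      also have "\<dots> \<le> 1 * h + h * (\<bar>\<gamma>\<bar> * K\<^sup>2)"
        using h e' a by (intro add_mono mult_right_mono) (auto simp: abs_mult intro: mult_left_mono)
      finally show ?thesis by (simp add: L_def algebra_simps)
    qed
    have "\<exists>\<xi>. \<bar>\<xi> - H t\<bar> \<le> \<bar>r\<bar> \<and> f (H t) - f (H t - r) = f1 \<xi> * r"
    proof (cases "r = 0")
      case False
      then consider "H t - r < H t" | "H t < H t - r" by linarith
      then show ?thesis
      proof cases
        case 1
        from MVT2[OF 1 f1] obtain z where "H t - r < z" "z < H t" "f (H t) - f (H t - r) = r * f1 z"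
          by auto
        then show ?thesis by (intro exI[of _ z]) (auto simp: mult.commute)
      next
        case 2
        from MVT2[OF 2 f1] obtain z where "H t < z" "z < H t - r" "f (H t - r) - f (H t) = - r * f1 z"
          by auto
        then show ?thesis by (intro exI[of _ z]) (auto simp: mult.commute)
      qed
    qed auto
    then obtain \<xi> where \<xi>: "\<bar>\<xi> - H t\<bar> \<le> \<bar>r\<bar>" "f (H t) - f (H t - r) = f1 \<xi> * r" by blast
    have "\<bar>H t - H s\<bar> < \<eta>"
      using d1(2)[of s t] st d by (auto simp: dist_real_def)
    moreover have "\<bar>r\<bar> \<le> \<eta>"
    proof -
      have "\<bar>r\<bar> \<le> L * (\<eta> / L)"
        using h d L by (intro order_trans[OF r2] mult_left_mono) auto
      then show ?thesis using L by simp
    qed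
    ultimately have "\<bar>\<xi> - H s\<bar> \<le> 2 * \<eta>" using \<xi>(1) by linarith
    then have f1_diff: "\<bar>f1 \<xi> - f1 (H s)\<bar> \<le> K2 * (2 * \<eta>)"
      by (intro order_trans[OF derivative_bound_Lipschitz[OF f2 K2]] mult_left_mono K0)
    have "f (H t) - f (H s + w s t) + h * (f1 (H s) * a) = (f1 \<xi> - f1 (H s)) * r + f1 (H s) * (r + h * a)"
      using \<xi>(2) by (simp add: r_def algebra_simps)
    also have "\<bar>\<dots>\<bar> \<le> (K2 * (2 * \<eta>)) * (L * h) + K1 * (e' * h)"
      using f1_diff r1 r2 K1[of "H s"] K0 \<eta>
      by (intro order_trans[OF abs_triangle_ineq] add_mono) (auto simp: abs_mult intro!: mult_mono)
    also have "\<dots> = (2 * (K2 * \<eta> * L) + K1 * e') * h" by (simp add: algebra_simps)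
    also have "\<dots> \<le> e * h"
    proof (rule mult_right_mono[OF _ h(1)])
      have "K2 * \<eta> * L = e / 4 * (K2 / (K2 + 1))" using L K0 by (simp add: \<eta>_def divide_simps)
      also have "\<dots> \<le> e / 4 * 1" using K0 e by (intro mult_left_mono) auto
      finally show "2 * (K2 * \<eta> * L) + K1 * e' \<le> e" using e'(3) by linarith
    qed
    finally show "\<bar>f (H t) - f (H s + w s t) + (t - s) * (f1 (H s) * (\<gamma> * (norm (N (p s)))\<^sup>2))\<bar>
        \<le> e * (t - s)"
      by (simp add: h_def a_def)
  qed
qed

section \<open>Gaussian increments\<close>

text \<open>Reflecting coordinates is a diagonal linear map with factors of modulus one, so it
  preserves Lebesgue measure.\<close>

lemma lborel_vec_sign_change:
  fixes c :: "'d::finite \<Rightarrow> real" and F :: "real^'d \<Rightarrow> real"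
  assumes c: "\<And>j. \<bar>c j\<bar> = 1" and F[measurable]: "F \<in> borel_measurable borel"
  shows "(\<integral>x. F (\<chi> j. c j * x $ j) \<partial>lborel) = (\<integral>x. F x \<partial>lborel)"
proof -
  \<comment> \<open>The change of variables formula takes factors indexed by basis vectors; this sum
    returns \<open>c i\<close> at \<open>axis i 1\<close>.\<close>
  define c' where "c' b = (\<Sum>j\<in>UNIV. c j * (b $ j))" for b :: "real^'d"
  have c': "c' (axis i 1) = c i" for i
    by (simp add: c'_def axis_def if_distrib cong: if_cong)
  define T :: "real^'d \<Rightarrow> real^'d" where "T x = 0 + (\<Sum>b\<in>Basis. (c' b * (x \<bullet> b)) *\<^sub>R b)" for x
  have T: "T x = (\<chi> j. c j * x $ j)" for x
  proof -
    have "T x = (\<Sum>i\<in>UNIV. (c i * x $ i) *\<^sub>R axis i 1)"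
      unfolding T_def Basis_vec_def
      by (simp add: c' inner_axis sum.UNION_disjoint UNION_singleton_eq_range sum.reindex inj_on_def axis_eq_axis)
    also have "\<dots> = (\<chi> j. c j * x $ j)"
      by (simp add: vec_eq_iff axis_def if_distrib cong: if_cong)
    finally show ?thesis .
  qed
  have c'1: "\<bar>c' b\<bar> = 1" if "b \<in> Basis" for b
    using that c c' by (auto simp: Basis_vec_def)
  then have ne: "c' b \<noteq> 0" if "b \<in> Basis" for b
    using that by force
  have "lborel = density (distr lborel borel T) (\<lambda>_. (\<Prod>j\<in>Basis. \<bar>c' j\<bar>))"
    unfolding T_def[abs_def] by (rule lborel_affine_euclidean) (rule ne)
  also have "(\<Prod>j\<in>Basis. \<bar>c' j\<bar>) = 1" using c'1 by simp
  finally have eq: "lborel = distr lborel borel T" by (simp add: density_1)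
  have [measurable]: "T \<in> borel_measurable borel" unfolding T_def by measurable
  have "(\<integral>x. F x \<partial>lborel) = (\<integral>x. F (T x) \<partial>lborel)"
    by (subst eq) (rule integral_distr, auto)
  then show ?thesis by (simp add: T)
qed

lemma nn_integral_lborel_vec_prod:
  fixes f :: "'d::finite \<Rightarrow> real \<Rightarrow> ennreal"
  assumes [measurable]: "\<And>i. f i \<in> borel_measurable borel"
  shows "(\<integral>\<^sup>+x. (\<Prod>i\<in>UNIV. f i (x $ i)) \<partial>(lborel :: (real^'d) measure)) = (\<Prod>i\<in>UNIV. (\<integral>\<^sup>+x. f i x \<partial>lborel))"
proof -
  define f' where "f' b = f (THE i. b = axis i (1::real))" for b :: "real^'d"
  have f': "f' (axis i 1) = f i" for i
    by (simp add: f'_def axis_eq_axis)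
  have [measurable]: "f' b \<in> borel_measurable borel" for b by (simp add: f'_def)
  have Basis: "(\<Prod>b\<in>Basis. g b) = (\<Prod>i\<in>UNIV. g (axis i 1))" for g :: "real^'d \<Rightarrow> ennreal"
    by (simp add: Basis_vec_def UNION_singleton_eq_range prod.reindex inj_on_def axis_eq_axis)
  show ?thesis
    using nn_integral_lborel_prod[of f'] by (simp add: Basis f' inner_axis)
qed

text \<open>Each summand is at most the largest one. The crude constant is sufficient: the lemma
  only compares powers of a norm with coordinate moments.\<close>

lemma sum_power_le_card_power:
  fixes a :: "'i \<Rightarrow> real"
  assumes "finite I" "I \<noteq> {}" "\<And>i. i \<in> I \<Longrightarrow> 0 \<le> a i"
  shows "(\<Sum>i\<in>I. a i) ^ k \<le> real (card I) ^ k * (\<Sum>i\<in>I. a i ^ k)"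
proof -
  define m where "m = Max (a ` I)"
  obtain j where j: "j \<in> I" "m = a j"
    using Max_in[of "a ` I"] assms unfolding m_def by blast
  have "(\<Sum>i\<in>I. a i) ^ k \<le> (real (card I) * m) ^ k"
  proof (rule power_mono)
    show "(\<Sum>i\<in>I. a i) \<le> real (card I) * m"
      using assms(1) by (intro sum_bounded_above) (simp add: m_def)
    show "0 \<le> (\<Sum>i\<in>I. a i)" using assms by (intro sum_nonneg) auto
  qed
  also have "\<dots> = real (card I) ^ k * a j ^ k" by (simp add: power_mult_distrib j)
  also have "\<dots> \<le> real (card I) ^ k * (\<Sum>i\<in>I. a i ^ k)"
    using assms j by (intro mult_left_mono member_le_sum) auto
  finally show ?thesis .
qed

text \<open>The quotient of factorials is the double factorial (2k - 1)!!, the moment of order 2k of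
  a standard normal variable. The factor \<open>real d ^ k\<close> comes from
  \<open>sum_power_le_card_power\<close>, the single \<open>real d\<close> from summing over the
  coordinates.\<close>

definition gauss_moment :: "nat \<Rightarrow> nat \<Rightarrow> real" where
  "gauss_moment d k = real d ^ k * (real d * (fact (2 * k) / (2 ^ k * fact k)))"

text \<open>One time step in isolation: \<open>G\<close> is the information available before the
  step, \<open>X\<close> the Wiener increment, \<open>h\<close> the step size.\<close>

locale gaussian_increment = prob_space P
  for P :: "'w measure" +
  fixes G :: "'w measure" and X :: "'w \<Rightarrow> real^'d" and h :: real
  assumes G: "subalgebra P G"
    and h: "0 < h"
    and X_distr: "distributed P lborel X
          (\<lambda>x. ennreal (\<Prod>i\<in>UNIV. normal_density 0 (sqrt h) (x $ i)))"
    and X_indep: "indep_set (sets G) (sets (vimage_algebra (space P) X borel))"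
begin

lemma X_measurable[measurable]: "X \<in> borel_measurable P"
  using distributed_measurable[OF X_distr] by simp

lemma component_measurable[measurable]: "(\<lambda>\<omega>. X \<omega> $ i) \<in> borel_measurable P"
  using borel_measurable_continuous_on[OF _ X_measurable, of "\<lambda>x. x $ i"]
  by (simp add: continuous_on_component)

lemma measurable_G: "Z \<in> borel_measurable G \<Longrightarrow> Z \<in> borel_measurable P"
  using G by (rule measurable_from_subalg)

text \<open>The density is a product, so the monomial can be moved into its i-th factor and the
  integral splits into one-dimensional ones, all equal to 1 except one. Nonnegative integrals give
  integrability together with the value.\<close>

lemma component_even_moment:
  "has_bochner_integral P (\<lambda>\<omega>. (X \<omega> $ i) ^ (2 * k)) (h ^ k * (fact (2 * k) / (2 ^ k * fact k)))"
proof -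
  define \<sigma> where "\<sigma> = sqrt h"
  have \<sigma>: "\<sigma> > 0" "\<sigma>\<^sup>2 = h" using h by (auto simp: \<sigma>_def)
  define m where "m = h ^ k * (fact (2 * k) / (2 ^ k * fact k) :: real)"
  have m: "fact (2 * k) / ((2 / \<sigma>\<^sup>2) ^ k * fact k) = m"
    using h by (simp add: \<sigma> m_def power_divide field_simps)
  have mom: "has_bochner_integral lborel (\<lambda>x. normal_density 0 \<sigma> x * x ^ (2 * k)) m"
    using normal_moment_even[OF \<sigma>(1), of 0 k] by (simp add: m)
  have n1: "(\<integral>\<^sup>+x. ennreal (normal_density 0 \<sigma> x * x ^ (2 * k)) \<partial>lborel) = ennreal m"
    using mom by (subst nn_integral_eq_integral) (auto simp: has_bochner_integral_iff power_mult)
  have n0: "(\<integral>\<^sup>+x. ennreal (normal_density 0 \<sigma> x) \<partial>lborel) = 1"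
    using \<sigma>(1) by (subst nn_integral_eq_integral) auto
  have "(\<integral>\<^sup>+\<omega>. ennreal ((X \<omega> $ i) ^ (2 * k)) \<partial>P) =
      (\<integral>\<^sup>+x. ennreal (\<Prod>j\<in>UNIV. normal_density 0 \<sigma> (x $ j)) * ennreal ((x $ i) ^ (2 * k)) \<partial>lborel)"
    using distributed_nn_integral[OF X_distr, of "\<lambda>x. ennreal ((x $ i) ^ (2 * k))"] by (simp add: \<sigma>_def)
  also have "\<dots> = (\<integral>\<^sup>+x. (\<Prod>j\<in>UNIV. ennreal (normal_density 0 \<sigma> (x $ j) *
      (if j = i then (x $ j) ^ (2 * k) else 1))) \<partial>lborel)"
  proof (rule nn_integral_cong)
    fix x :: "real^'d"
    have "(\<Prod>j\<in>UNIV. ennreal (normal_density 0 \<sigma> (x $ j) * (if j = i then (x $ j) ^ (2 * k) else 1)))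
        = ennreal (\<Prod>j\<in>UNIV. normal_density 0 \<sigma> (x $ j) * (if j = i then (x $ j) ^ (2 * k) else 1))"
      by (rule prod_ennreal) (simp add: power_mult)
    also have "\<dots> = ennreal ((\<Prod>j\<in>UNIV. normal_density 0 \<sigma> (x $ j)) * (x $ i) ^ (2 * k))"
      by (simp add: prod.distrib)
    also have "\<dots> = ennreal (\<Prod>j\<in>UNIV. normal_density 0 \<sigma> (x $ j)) * ennreal ((x $ i) ^ (2 * k))"
      by (rule ennreal_mult) (simp_all add: prod_nonneg power_mult)
    finally show "ennreal (\<Prod>j\<in>UNIV. normal_density 0 \<sigma> (x $ j)) * ennreal ((x $ i) ^ (2 * k)) =
      (\<Prod>j\<in>UNIV. ennreal (normal_density 0 \<sigma> (x $ j) * (if j = i then (x $ j) ^ (2 * k) else 1)))"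
      by simp
  qed
  also have "\<dots> = (\<Prod>j\<in>UNIV. \<integral>\<^sup>+x. ennreal (normal_density 0 \<sigma> x * (if j = i then x ^ (2 * k) else 1)) \<partial>lborel)"
    by (rule nn_integral_lborel_vec_prod) measurable
  also have "\<dots> = (\<Prod>j\<in>UNIV. if j = i then ennreal m else 1)"
    by (intro prod.cong) (auto simp: n0 n1)
  also have "\<dots> = ennreal m" by simp
  finally have "(\<integral>\<^sup>+\<omega>. ennreal ((X \<omega> $ i) ^ (2 * k)) \<partial>P) = ennreal m" .
  then show ?thesis
    unfolding m_def[symmetric]
    by (intro has_bochner_integral_nn_integral) (use h in \<open>auto simp: m_def\<close>)
qed

text \<open>The density is even in each coordinate. Flipping one sign then shows that a coordinate,
  or a product of two different ones, has the same mean as its negative, so independence of the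
  coordinates never has to be established.\<close>

lemma sign_change:
  assumes c: "\<And>j. \<bar>c j\<bar> = 1" and F[measurable]: "F \<in> borel_measurable borel"
  shows "expectation (\<lambda>\<omega>. F (\<chi> j. c j * X \<omega> $ j)) = expectation (\<lambda>\<omega>. F (X \<omega>) :: real)"
proof -
  let ?g = "\<lambda>x::real^'d. \<Prod>i\<in>UNIV. normal_density 0 (sqrt h) (x $ i)"
  have nd: "normal_density 0 (sqrt h) (c j * y) = normal_density 0 (sqrt h) y" for j y
    using c[of j] by (simp add: normal_density_def power_mult_distrib abs_square_eq_1 power2_eq_1_iff abs_if split: if_splits)
  have [measurable]: "(\<lambda>x::real^'d. \<chi> j. c j * x $ j) \<in> borel_measurable borel"
    by (intro borel_measurable_continuous_onI continuous_intros)
  have g0: "0 \<le> ?g x" for x by (simp add: prod_nonneg)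
  have "expectation (\<lambda>\<omega>. F (\<chi> j. c j * X \<omega> $ j)) = (\<integral>x. ?g x * F (\<chi> j. c j * x $ j) \<partial>lborel)"
    by (rule distributed_integral[OF X_distr, symmetric]) (use g0 in auto)
  also have "\<dots> = (\<integral>x. ?g (\<chi> j. c j * x $ j) * F (\<chi> j. c j * x $ j) \<partial>lborel)"
    by (simp add: nd)
  also have "\<dots> = (\<integral>x. ?g x * F x \<partial>lborel)"
    by (rule lborel_vec_sign_change[OF c]) measurable
  also have "\<dots> = expectation (\<lambda>\<omega>. F (X \<omega>))"
    by (rule distributed_integral[OF X_distr]) (use g0 in auto)
  finally show ?thesis .
qed

lemma component_mean: "expectation (\<lambda>\<omega>. X \<omega> $ i) = 0"
  using sign_change[of "\<lambda>j. if j = i then -1 else 1" "\<lambda>x. x $ i"] by simp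

lemma component_cov: "expectation (\<lambda>\<omega>. X \<omega> $ i * X \<omega> $ j) = (if i = j then h else 0)"
proof (cases "i = j")
  case True
  then show ?thesis
    using has_bochner_integral_integral_eq[OF component_even_moment[of i 1]]
    by (simp add: power2_eq_square)
next
  case False
  then show ?thesis
    using sign_change[of "\<lambda>k. if k = i then -1 else 1" "\<lambda>x. x $ i * x $ j"] by simp
qed

lemma norm_even_moment:
  "integrable P (\<lambda>\<omega>. norm (X \<omega>) ^ (2 * k))"
  "expectation (\<lambda>\<omega>. norm (X \<omega>) ^ (2 * k)) \<le> gauss_moment CARD('d) k * h ^ k"
proof -
  have le: "norm x ^ (2 * k) \<le> real CARD('d) ^ k * (\<Sum>i\<in>UNIV. (x $ i) ^ (2 * k))" for x :: "real^'d"
    using sum_power_le_card_power[of UNIV "\<lambda>i. (x $ i)\<^sup>2" k]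
    by (simp add: power_mult power2_norm_eq_inner inner_vec_def flip: power2_eq_square)
  have int: "integrable P (\<lambda>\<omega>. real CARD('d) ^ k * (\<Sum>i\<in>UNIV. (X \<omega> $ i) ^ (2 * k)))"
    using component_even_moment by (intro integrable_mult_right integrable_sum) (auto simp: has_bochner_integral_iff)
  show 1: "integrable P (\<lambda>\<omega>. norm (X \<omega>) ^ (2 * k))"
    by (rule Bochner_Integration.integrable_bound[OF int])
      (use le in \<open>auto intro: order_trans[OF _ abs_ge_self]\<close>)
  have "expectation (\<lambda>\<omega>. norm (X \<omega>) ^ (2 * k)) \<le>
      expectation (\<lambda>\<omega>. real CARD('d) ^ k * (\<Sum>i\<in>UNIV. (X \<omega> $ i) ^ (2 * k)))"
    by (rule integral_mono[OF 1 int le])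
  also have "\<dots> = real CARD('d) ^ k * (\<Sum>i\<in>(UNIV::'d set). h ^ k * (fact (2 * k) / (2 ^ k * fact k)))"
    using component_even_moment by (simp add: has_bochner_integral_iff Bochner_Integration.integral_sum)
  finally show "expectation (\<lambda>\<omega>. norm (X \<omega>) ^ (2 * k)) \<le> gauss_moment CARD('d) k * h ^ k"
    by (simp add: gauss_moment_def mult_ac)
qed

lemma integrable_norm_power: "integrable P (\<lambda>\<omega>. norm (X \<omega>) ^ k)"
proof (rule Bochner_Integration.integrable_bound)
  show "integrable P (\<lambda>\<omega>. 1 + norm (X \<omega>) ^ (2 * k))"
    using norm_even_moment(1) by (intro Bochner_Integration.integrable_add) auto
  have "y ^ k \<le> 1 + y ^ (2 * k)" for y :: real
  proof -
    have "0 \<le> (y ^ k - 1/2)\<^sup>2" by simp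
    then show ?thesis by (simp add: power2_diff power_even_eq power_divide)
  qed
  then show "AE \<omega> in P. norm (norm (X \<omega>) ^ k) \<le> norm (1 + norm (X \<omega>) ^ (2 * k))"
    by (auto intro!: AE_I2 order_trans[OF _ abs_ge_self])
qed measurable

text \<open>The third power is interpolated between the second and the fourth by the
  arithmetic-geometric mean inequality. The weights \<open>sqrt h\<close> and
  \<open>1 / sqrt h\<close> give both terms the natural scale h^(3/2).\<close>

lemma norm_cubic_moment:
  "expectation (\<lambda>\<omega>. norm (X \<omega>) ^ 3) \<le> (gauss_moment CARD('d) 1 + gauss_moment CARD('d) 2) * (h * sqrt h)"
proof -
  have am_gm: "y ^ 3 \<le> (sqrt h * y ^ (2 * 1) + y ^ (2 * 2) / sqrt h)" if "0 \<le> y" for y :: real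
  proof -
    have "y ^ 3 * sqrt h * 2 \<le> h * y ^ 2 + y ^ 4"
      using sum_squares_bound[of "sqrt h * y" "y\<^sup>2"] h
      by (simp add: power_mult_distrib power2_eq_square power3_eq_cube power4_eq_xxxx mult_ac)
    moreover have "0 \<le> h * y ^ 2 + y ^ 4" using h by simp
    ultimately have "y ^ 3 * sqrt h \<le> h * y ^ 2 + y ^ 4" by linarith
    then have "y ^ 3 \<le> (h * y ^ 2 + y ^ 4) / sqrt h" using h by (simp add: pos_le_divide_eq)
    also have "\<dots> = sqrt h * y ^ (2 * 1) + y ^ (2 * 2) / sqrt h"
      using h by (simp add: add_divide_distrib real_div_sqrt mult.commute[of h] flip: times_divide_eq_right)
    finally show ?thesis .
  qed
  have "expectation (\<lambda>\<omega>. norm (X \<omega>) ^ 3) \<le>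
      expectation (\<lambda>\<omega>. sqrt h * norm (X \<omega>) ^ (2 * 1) + norm (X \<omega>) ^ (2 * 2) / sqrt h)"
    using norm_even_moment(1)[of 1] norm_even_moment(1)[of 2]
    by (intro integral_mono integrable_norm_power am_gm norm_ge_zero) auto
  also have "\<dots> = sqrt h * expectation (\<lambda>\<omega>. norm (X \<omega>) ^ (2 * 1)) + expectation (\<lambda>\<omega>. norm (X \<omega>) ^ (2 * 2)) / sqrt h"
    using norm_even_moment(1)[of 1] norm_even_moment(1)[of 2]
    by (subst Bochner_Integration.integral_add) auto
  also have "\<dots> \<le> sqrt h * (gauss_moment CARD('d) 1 * h ^ 1) + gauss_moment CARD('d) 2 * h ^ 2 / sqrt h"
    using h by (intro add_mono mult_left_mono divide_right_mono norm_even_moment) auto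
  also have "gauss_moment CARD('d) 2 * h ^ 2 / sqrt h = gauss_moment CARD('d) 2 * (h * sqrt h)"
    using h by (simp add: power2_eq_square real_div_sqrt flip: times_divide_eq_right)
  finally show ?thesis by (simp add: algebra_simps)
qed

text \<open>\<open>Z\<close> generates a sub-sigma-algebra of \<open>G\<close>, and \<open>g\<close>
  of \<open>X\<close> one of the sigma-algebra of \<open>X\<close>; independence is inherited and
  expectations factorise.\<close>

lemma indep_times:
  fixes Z :: "'w \<Rightarrow> real" and g :: "real^'d \<Rightarrow> real"
  assumes Z: "Z \<in> borel_measurable G" "integrable P Z"
    and g[measurable]: "g \<in> borel_measurable borel" and ig: "integrable P (\<lambda>\<omega>. g (X \<omega>))"
  shows "integrable P (\<lambda>\<omega>. Z \<omega> * g (X \<omega>))"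
    "expectation (\<lambda>\<omega>. Z \<omega> * g (X \<omega>)) = expectation Z * expectation (\<lambda>\<omega>. g (X \<omega>))"
proof -
  have [measurable]: "Z \<in> borel_measurable P" using Z(1) by (rule measurable_G)
  have "indep_var borel Z borel (\<lambda>\<omega>. g (X \<omega>))"
    unfolding indep_var_eq
  proof (intro conjI)
    have GP: "space G = space P" using G by (auto simp: subalgebra_def)
    have 1: "sigma_sets (space P) {Z -` A \<inter> space P |A. A \<in> sets borel} \<subseteq> sets G"
    proof -
      have "{Z -` A \<inter> space P |A. A \<in> sets borel} \<subseteq> sets G"
        using measurable_sets[OF Z(1)] GP by auto
      from sets.sigma_sets_subset[OF this] GP show ?thesis by simp
    qed
    have 2: "sigma_sets (space P) {(\<lambda>\<omega>. g (X \<omega>)) -` A \<inter> space P |A. A \<in> sets borel}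
        \<subseteq> sets (vimage_algebra (space P) X borel)"
    proof -
      have "X \<in> measurable (vimage_algebra (space P) X borel) borel"
        by (rule measurable_vimage_algebra1) auto
      then have "(\<lambda>\<omega>. g (X \<omega>)) \<in> measurable (vimage_algebra (space P) X borel) borel"
        by measurable
      from measurable_sets[OF this]
      have "{(\<lambda>\<omega>. g (X \<omega>)) -` A \<inter> space P |A. A \<in> sets borel} \<subseteq> sets (vimage_algebra (space P) X borel)"
        by auto
      from sets.sigma_sets_subset[OF this] show ?thesis by simp
    qed
    show "indep_set (sigma_sets (space P) {Z -` A \<inter> space P |A. A \<in> sets borel})
        (sigma_sets (space P) {(\<lambda>\<omega>. g (X \<omega>)) -` A \<inter> space P |A. A \<in> sets borel})"
      using X_indep unfolding indep_sets2_eq using 1 2 by blast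
  qed measurable
  from indep_var_integrable[OF this Z(2) ig] indep_var_lebesgue_integral[OF this Z(2) ig]
  show "integrable P (\<lambda>\<omega>. Z \<omega> * g (X \<omega>))"
    "expectation (\<lambda>\<omega>. Z \<omega> * g (X \<omega>)) = expectation Z * expectation (\<lambda>\<omega>. g (X \<omega>))" .
qed

lemma integrable_component: "integrable P (\<lambda>\<omega>. X \<omega> $ i)"
  by (rule Bochner_Integration.integrable_bound[OF integrable_norm_power[of 1]])
    (auto simp: component_le_norm_cart)

lemma integrable_component_mult: "integrable P (\<lambda>\<omega>. X \<omega> $ i * X \<omega> $ j)"
  by (rule Bochner_Integration.integrable_bound[OF integrable_norm_power[of 2]])
    (auto simp: abs_mult power2_eq_square intro!: mult_mono component_le_norm_cart)

lemma bounded_G_integrable: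
  assumes "Z \<in> borel_measurable G" "\<And>\<omega>. \<bar>Z \<omega>\<bar> \<le> (K::real)"
  shows "integrable P Z"
  using assms by (intro integrable_const_bound[of _ K] measurable_G) auto

lemma linear_expectation:
  fixes Z :: "'w \<Rightarrow> real^'d"
  assumes Z: "\<And>i. (\<lambda>\<omega>. Z \<omega> $ i) \<in> borel_measurable G" "\<And>i. integrable P (\<lambda>\<omega>. Z \<omega> $ i)"
  shows "integrable P (\<lambda>\<omega>. Z \<omega> \<bullet> X \<omega>)" "expectation (\<lambda>\<omega>. Z \<omega> \<bullet> X \<omega>) = 0"
proof -
  have *: "integrable P (\<lambda>\<omega>. Z \<omega> $ i * X \<omega> $ i)" "expectation (\<lambda>\<omega>. Z \<omega> $ i * X \<omega> $ i) = 0" for i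
    using indep_times[OF Z(1) Z(2) _ integrable_component, of i i] component_mean by auto
  show "integrable P (\<lambda>\<omega>. Z \<omega> \<bullet> X \<omega>)" "expectation (\<lambda>\<omega>. Z \<omega> \<bullet> X \<omega>) = 0"
    unfolding inner_vec_def using * by (auto simp: integral_sum)
qed

text \<open>The covariance matrix of \<open>X\<close> is \<open>h\<close> times the identity, so
  only diagonal entries survive. This is the source of the Ito correction and of the trace in the
  theorem.\<close>

lemma quadratic_expectation:
  fixes Z :: "'w \<Rightarrow> real^'d^'d"
  assumes Z: "\<And>i j. (\<lambda>\<omega>. Z \<omega> $ i $ j) \<in> borel_measurable G" "\<And>i j. integrable P (\<lambda>\<omega>. Z \<omega> $ i $ j)"
  shows "integrable P (\<lambda>\<omega>. X \<omega> \<bullet> (Z \<omega> *v X \<omega>))"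
    "expectation (\<lambda>\<omega>. X \<omega> \<bullet> (Z \<omega> *v X \<omega>)) = h * expectation (\<lambda>\<omega>. trace (Z \<omega>))"
proof -
  have *: "integrable P (\<lambda>\<omega>. Z \<omega> $ i $ j * (X \<omega> $ i * X \<omega> $ j))"
    "expectation (\<lambda>\<omega>. Z \<omega> $ i $ j * (X \<omega> $ i * X \<omega> $ j)) = expectation (\<lambda>\<omega>. Z \<omega> $ i $ j) * (if i = j then h else 0)"
    for i j
    using indep_times[OF Z(1) Z(2) _ integrable_component_mult, of i j i j] component_cov[of i j] by auto
  have eq: "X \<omega> \<bullet> (Z \<omega> *v X \<omega>) = (\<Sum>i\<in>UNIV. \<Sum>j\<in>UNIV. Z \<omega> $ i $ j * (X \<omega> $ i * X \<omega> $ j))" for \<omega>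
    by (simp add: inner_vec_def matrix_vector_mult_def sum_distrib_left mult_ac)
  show "integrable P (\<lambda>\<omega>. X \<omega> \<bullet> (Z \<omega> *v X \<omega>))" unfolding eq using * by auto
  have "expectation (\<lambda>\<omega>. X \<omega> \<bullet> (Z \<omega> *v X \<omega>)) =
      (\<Sum>i\<in>UNIV. \<Sum>j\<in>UNIV. expectation (\<lambda>\<omega>. Z \<omega> $ i $ j) * (if i = j then h else 0))"
    unfolding eq by (simp add: Bochner_Integration.integral_sum Bochner_Integration.integrable_sum *)
  also have "\<dots> = h * expectation (\<lambda>\<omega>. trace (Z \<omega>))"
    using Z(2) by (simp add: trace_def integral_sum if_distrib sum_distrib_left mult.commute cong: if_cong)
  finally show "expectation (\<lambda>\<omega>. X \<omega> \<bullet> (Z \<omega> *v X \<omega>)) = h * expectation (\<lambda>\<omega>. trace (Z \<omega>))" .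
qed

end

section \<open>The effect of a single Gaussian kick\<close>

lemma Taylor_second_order:
  fixes f f1 f2 :: "real \<Rightarrow> real"
  assumes "\<And>x. DERIV f x :> f1 x" "\<And>x. DERIV f1 x :> f2 x" "\<And>x. \<bar>f2 x\<bar> \<le> K"
  shows "\<bar>f (x + w) - f x - f1 x * w\<bar> \<le> K * w\<^sup>2 / 2"
proof (cases "w = 0")
  case False
  define diff where "diff m = (if m = 0 then f else if m = 1 then f1 else f2)" for m :: nat
  have "\<exists>t. (if x + w < x then x + w < t \<and> t < x else x < t \<and> t < x + w) \<and>
    f (x + w) = (\<Sum>m<2. (diff m x / fact m) * (x + w - x) ^ m) + (diff 2 t / fact 2) * (x + w - x) ^ 2"
    by (rule Taylor[where a="min x (x + w)" and b="max x (x + w)"])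
      (use assms False in \<open>auto simp: diff_def less_Suc_eq numeral_2_eq_2\<close>)
  then obtain t where "f (x + w) = f x + f1 x * w + f2 t / 2 * w\<^sup>2"
    by (auto simp: diff_def numeral_2_eq_2)
  then have "\<bar>f (x + w) - f x - f1 x * w\<bar> = \<bar>f2 t\<bar> * w\<^sup>2 / 2" by (simp add: abs_mult)
  also have "\<dots> \<le> K * w\<^sup>2 / 2" using assms(3)[of t] by (intro divide_right_mono mult_right_mono) auto
  finally show ?thesis .
qed simp

lemma Taylor_third_order:
  fixes f f1 f2 f3 :: "real \<Rightarrow> real"
  assumes "\<And>x. DERIV f x :> f1 x" "\<And>x. DERIV f1 x :> f2 x" "\<And>x. DERIV f2 x :> f3 x"
    "\<And>x. \<bar>f3 x\<bar> \<le> K"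
  shows "\<bar>f (x + w) - f x - f1 x * w - f2 x * w\<^sup>2 / 2\<bar> \<le> K * \<bar>w\<bar> ^ 3 / 6"
proof (cases "w = 0")
  case False
  define diff where "diff m = (if m = 0 then f else if m = 1 then f1 else if m = 2 then f2 else f3)" for m :: nat
  have "\<exists>t. (if x + w < x then x + w < t \<and> t < x else x < t \<and> t < x + w) \<and>
    f (x + w) = (\<Sum>m<3. (diff m x / fact m) * (x + w - x) ^ m) + (diff 3 t / fact 3) * (x + w - x) ^ 3"
    by (rule Taylor[where a="min x (x + w)" and b="max x (x + w)"])
      (use assms False in \<open>auto simp: diff_def less_Suc_eq numeral_2_eq_2 numeral_3_eq_3\<close>)
  then obtain t where "f (x + w) = f x + f1 x * w + f2 x / 2 * w\<^sup>2 + f3 t / 6 * w ^ 3"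
    by (auto simp: diff_def numeral_2_eq_2 numeral_3_eq_3)
  then have "\<bar>f (x + w) - f x - f1 x * w - f2 x * w\<^sup>2 / 2\<bar> = \<bar>f3 t\<bar> * \<bar>w\<bar> ^ 3 / 6"
    by (simp add: abs_mult power_abs)
  also have "\<dots> \<le> K * \<bar>w\<bar> ^ 3 / 6" using assms(4)[of t] by (intro divide_right_mono mult_right_mono) auto
  finally show ?thesis .
qed simp

text \<open>The fourth power is dominated by the third below 1 and by the sixth above 1. Remainders
  can thus be measured by these two moments alone.\<close>

lemma cubic_quartic_le_cubic_sextic: "0 \<le> x \<Longrightarrow> 2 * x ^ 3 + x ^ 4 \<le> 4 * (x ^ 3 + x ^ 6)" for x :: real
proof -
  assume x: "0 \<le> x"
  have "0 \<le> x ^ 3 * (1 - x + x ^ 3)"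
  proof (rule mult_nonneg_nonneg)
    have "x \<le> 1 + x ^ 3"
    proof (cases "x \<le> 1")
      case False
      then show ?thesis using power_increasing[of 1 3 x] by simp
    qed (use x in \<open>auto intro: order_trans\<close>)
    then show "0 \<le> 1 - x + x ^ 3" by simp
  qed (use x in simp)
  moreover have "x ^ 3 * (1 - x + x ^ 3) = x ^ 3 - x ^ 4 + x ^ 6"
    by (simp add: algebra_simps eval_nat_numeral)
  moreover have "0 \<le> x ^ 3" "0 \<le> x ^ 6" using x by simp_all
  ultimately show ?thesis unfolding distrib_left by linarith
qed

lemma sum_cubed_le:
  fixes a b :: real
  assumes "0 \<le> a" "0 \<le> b"
  shows "(a + b) ^ 3 \<le> 8 * (a ^ 3 + b ^ 3)"
  using sum_power_le_card_power[of "UNIV :: bool set" "\<lambda>t. if t then a else b" 3] assms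
  by (simp add: UNIV_bool card_insert_if add.commute)

text \<open>For symmetric \<open>N\<close> and \<open>v = N p\<close>, the sum of
  \<open>linear_noise\<close> and \<open>quadratic_noise\<close> is the exact change of the kinetic
  energy \<open>p \<bullet> N p / 2\<close> when the momentum jumps by \<open>S x\<close>. The two
  orders in \<open>x\<close> are kept apart because the first is centred and the second has a mean
  of order \<open>h\<close>.\<close>

definition linear_noise :: "real^'d^'d \<Rightarrow> real^'d \<Rightarrow> real^'d \<Rightarrow> real" where
  "linear_noise S v x = v \<bullet> (S *v x)"

definition quadratic_noise :: "real^'d^'d \<Rightarrow> real^'d^'d \<Rightarrow> real^'d \<Rightarrow> real" where
  "quadratic_noise S N x = (S *v x) \<bullet> (N *v (S *v x)) / 2"

text \<open>The factor \<open>z\<close> is a stopping indicator; with \<open>z = 0\<close> the step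
  is not counted.\<close>

definition noise_kick ::
    "(real \<Rightarrow> real) \<Rightarrow> real^'d^'d \<Rightarrow> real^'d^'d \<Rightarrow> real \<Rightarrow> real \<Rightarrow> real^'d \<Rightarrow> real^'d \<Rightarrow> real" where
  "noise_kick f S N z H v x = z * (f (H + (linear_noise S v x + quadratic_noise S N x)) - f H)"

text \<open>The first-order part of \<open>noise_kick\<close>. It is centred given the past, so its
  sums over the grid form a martingale.\<close>

definition linear_kick ::
    "(real \<Rightarrow> real) \<Rightarrow> real^'d^'d \<Rightarrow> real \<Rightarrow> real \<Rightarrow> real^'d \<Rightarrow> real^'d \<Rightarrow> real" where
  "linear_kick f1 S z H v x = z * f1 H * linear_noise S v x"

context gaussian_increment
begin

text \<open>Measurability of \<open>z\<close>, \<open>H\<close> and \<open>v\<close> with respect to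
  \<open>G\<close> says that they are known before the increment. The bound \<open>L1\<close> is
  restricted to \<open>z \<omega> = 1\<close> because stopping controls the velocity only inside the
  ball.\<close>

context
  fixes S N :: "real^'d^'d" and z H :: "'w \<Rightarrow> real" and v :: "'w \<Rightarrow> real^'d"
    and f f1 f2 f3 :: "real \<Rightarrow> real" and K0 K1 K2 K3 L :: real
  assumes f1: "\<And>x. DERIV f x :> f1 x" and f2: "\<And>x. DERIV f1 x :> f2 x" and f3: "\<And>x. DERIV f2 x :> f3 x"
    and K0: "\<And>x. \<bar>f x\<bar> \<le> K0" and K1: "\<And>x. \<bar>f1 x\<bar> \<le> K1"
    and K2: "\<And>x. \<bar>f2 x\<bar> \<le> K2" and K3: "\<And>x. \<bar>f3 x\<bar> \<le> K3"
    and z: "z \<in> borel_measurable G" and H: "H \<in> borel_measurable G" and v: "v \<in> borel_measurable G"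
    and z01: "\<And>\<omega>. z \<omega> = 0 \<or> z \<omega> = 1"
    and L0: "0 \<le> L"
    and L1: "\<And>\<omega> x. z \<omega> = 1 \<Longrightarrow> \<bar>v \<omega> \<bullet> (S *v x)\<bar> \<le> L * norm x"
    and L2: "\<And>x. \<bar>(S *v x) \<bullet> (N *v (S *v x)) / 2\<bar> \<le> L * (norm x)\<^sup>2"
begin

abbreviation "noise_linear \<omega> \<equiv> linear_noise S (v \<omega>) (X \<omega>)"
abbreviation "noise_quadratic \<omega> \<equiv> quadratic_noise S N (X \<omega>)"
abbreviation "kick \<omega> \<equiv> noise_kick f S N (z \<omega>) (H \<omega>) (v \<omega>) (X \<omega>)"
abbreviation "kick_martingale \<omega> \<equiv> linear_kick f1 S (z \<omega>) (H \<omega>) (v \<omega>) (X \<omega>)"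

lemma K_nonneg: "0 \<le> K0" "0 \<le> K1" "0 \<le> K2" "0 \<le> K3"
  using K0[of 0] K1[of 0] K2[of 0] K3[of 0] by linarith+

lemma f_measurable[measurable]:
  "f \<in> borel_measurable borel" "f1 \<in> borel_measurable borel" "f2 \<in> borel_measurable borel"
  using f1 f2 f3 by (auto intro!: borel_measurable_continuous_onI DERIV_continuous_on
      intro: has_field_derivative_at_within)

lemma zHv_measurable[measurable]:
  "z \<in> borel_measurable P" "H \<in> borel_measurable P" "v \<in> borel_measurable P"
  using z H v by (auto intro: measurable_G)

lemma matrix_vector_measurable[measurable (raw)]:
  fixes A :: "real^'d^'d"
  shows "g \<in> borel_measurable M' \<Longrightarrow> (\<lambda>x. A *v g x) \<in> borel_measurable M'"
  by (rule borel_measurable_continuous_on[where f="\<lambda>x. A *v x"]) (auto intro: continuous_intros)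

lemma noise_measurable[measurable]:
  "noise_linear \<in> borel_measurable P" "noise_quadratic \<in> borel_measurable P"
  "kick \<in> borel_measurable P" "kick_martingale \<in> borel_measurable P"
  unfolding noise_kick_def linear_kick_def linear_noise_def quadratic_noise_def
  by measurable

lemma noise_bounds:
  "z \<omega> = 1 \<Longrightarrow> \<bar>noise_linear \<omega>\<bar> \<le> L * norm (X \<omega>)"
  "\<bar>noise_quadratic \<omega>\<bar> \<le> L * (norm (X \<omega>))\<^sup>2"
  using L1 L2 by (auto simp: linear_noise_def quadratic_noise_def)

lemma kick_bounded: "\<bar>kick \<omega>\<bar> \<le> 2 * K0"
proof -
  have "\<bar>kick \<omega>\<bar> \<le> \<bar>f (H \<omega> + (noise_linear \<omega> + noise_quadratic \<omega>)) - f (H \<omega>)\<bar>"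
    using z01[of \<omega>] by (auto simp: noise_kick_def)
  then show ?thesis using K0[of "H \<omega>"] K0[of "H \<omega> + (noise_linear \<omega> + noise_quadratic \<omega>)"] by linarith
qed

text \<open>With x the norm of the increment, the linear noise is of order x and the quadratic noise
  of order x^2. Exactly the three displayed terms of the Taylor polynomial have order at most two;
  the mixed part of the square and the cubic remainder are bounded by x^3 + x^6.\<close>

lemma kick_expansion:
  "\<bar>kick \<omega> - (z \<omega> * f1 (H \<omega>) * noise_linear \<omega> + z \<omega> * f1 (H \<omega>) * noise_quadratic \<omega>
      + z \<omega> * f2 (H \<omega>) / 2 * (noise_linear \<omega>)\<^sup>2)\<bar>
    \<le> (2 * K3 * L ^ 3 + 2 * K2 * L\<^sup>2) * (norm (X \<omega>) ^ 3 + norm (X \<omega>) ^ 6)"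
proof (cases "z \<omega> = 1")
  case True
  define a b x y where "a = noise_linear \<omega>" and "b = noise_quadratic \<omega>" and "x = norm (X \<omega>)" and "y = H \<omega>"
  have ab: "\<bar>a\<bar> \<le> L * x" "\<bar>b\<bar> \<le> L * x\<^sup>2" and x: "0 \<le> x"
    using noise_bounds True by (auto simp: a_def b_def x_def)
  have abs3: "\<bar>a + b\<bar> ^ 3 \<le> L ^ 3 * (8 * (x ^ 3 + x ^ 6))"
  proof -
    have "\<bar>a + b\<bar> ^ 3 \<le> (L * (x + x\<^sup>2)) ^ 3"
      using ab by (intro power_mono) (auto simp: algebra_simps)
    also have "\<dots> \<le> L ^ 3 * (8 * (x ^ 3 + (x\<^sup>2) ^ 3))"
      unfolding power_mult_distrib using sum_cubed_le[of x "x\<^sup>2"] L0 x by (intro mult_left_mono) auto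
    finally show ?thesis by (simp flip: power_mult)
  qed
  have sq: "\<bar>(a + b)\<^sup>2 - a\<^sup>2\<bar> \<le> L\<^sup>2 * (4 * (x ^ 3 + x ^ 6))"
  proof -
    have "\<bar>(a + b)\<^sup>2 - a\<^sup>2\<bar> = \<bar>b\<bar> * \<bar>2 * a + b\<bar>"
      by (simp add: power2_eq_square algebra_simps flip: abs_mult)
    also have "\<dots> \<le> (L * x\<^sup>2) * (2 * (L * x) + L * x\<^sup>2)"
      using ab L0 by (intro mult_mono) auto
    also have "\<dots> = L\<^sup>2 * (2 * x ^ 3 + x ^ 4)"
      by (simp add: power2_eq_square power3_eq_cube power4_eq_xxxx algebra_simps)
    also have "\<dots> \<le> L\<^sup>2 * (4 * (x ^ 3 + x ^ 6))"
      using cubic_quartic_le_cubic_sextic[OF x] by (intro mult_left_mono) auto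
    finally show ?thesis .
  qed
  have "f (y + (a + b)) - f y - (f1 y * a + f1 y * b + f2 y / 2 * a\<^sup>2)
      = (f (y + (a + b)) - f y - f1 y * (a + b) - f2 y * (a + b)\<^sup>2 / 2) + f2 y / 2 * ((a + b)\<^sup>2 - a\<^sup>2)"
    by (simp add: algebra_simps)
  also have "\<bar>\<dots>\<bar> \<le> K3 * \<bar>a + b\<bar> ^ 3 / 6 + K2 / 2 * \<bar>(a + b)\<^sup>2 - a\<^sup>2\<bar>"
    using Taylor_third_order[OF f1 f2 f3 K3, of y "a + b"] K2[of y]
    by (intro order_trans[OF abs_triangle_ineq] add_mono) (auto simp: abs_mult intro!: mult_right_mono)
  also have "\<dots> \<le> K3 * (L ^ 3 * (8 * (x ^ 3 + x ^ 6))) / 6 + K2 / 2 * (L\<^sup>2 * (4 * (x ^ 3 + x ^ 6)))"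
    using abs3 sq K_nonneg by (intro add_mono divide_right_mono mult_left_mono) auto
  also have "\<dots> \<le> (2 * K3 * L ^ 3 + 2 * K2 * L\<^sup>2) * (x ^ 3 + x ^ 6)"
  proof -
    have "0 \<le> K3 * L ^ 3 * (x ^ 3 + x ^ 6)" using K_nonneg L0 x by simp
    then show ?thesis by (simp add: algebra_simps)
  qed
  finally show ?thesis using True by (simp add: noise_kick_def a_def b_def x_def y_def)
next
  case False
  with z01[of \<omega>] have "z \<omega> = 0" by auto
  then show ?thesis using K_nonneg L0 by (simp add: noise_kick_def)
qed

text \<open>Without its martingale part the kick is of second order in the increment, hence of mean
  square order h^2. By Cauchy-Schwarz, 1 / h such remainders then have a sum that is bounded in mean
  square.\<close>

lemma kick_remainder_bound:
  "\<bar>kick \<omega> - kick_martingale \<omega>\<bar> \<le> (K1 * L + K2 * L\<^sup>2) * (norm (X \<omega>) ^ 2 + norm (X \<omega>) ^ 4)"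
proof (cases "z \<omega> = 1")
  case True
  define a b x y where "a = noise_linear \<omega>" and "b = noise_quadratic \<omega>" and "x = norm (X \<omega>)" and "y = H \<omega>"
  have ab: "\<bar>a\<bar> \<le> L * x" "\<bar>b\<bar> \<le> L * x\<^sup>2" and x: "0 \<le> x"
    using noise_bounds True by (auto simp: a_def b_def x_def)
  have sq: "(a + b)\<^sup>2 \<le> 2 * (L\<^sup>2 * (x ^ 2 + x ^ 4))"
  proof -
    have "(a + b)\<^sup>2 \<le> 2 * a\<^sup>2 + 2 * b\<^sup>2" using sum_squares_bound[of a b] by (simp add: power2_sum)
    also have "\<dots> \<le> 2 * (L * x)\<^sup>2 + 2 * (L * x\<^sup>2)\<^sup>2"
      using ab power_mono[OF ab(1), of 2] power_mono[OF ab(2), of 2] by (simp only: power2_abs) auto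
    also have "\<dots> = 2 * (L\<^sup>2 * (x ^ 2 + x ^ 4))" by (simp add: power_mult_distrib algebra_simps flip: power_mult)
    finally show ?thesis .
  qed
  have "f (y + (a + b)) - f y - f1 y * a = (f (y + (a + b)) - f y - f1 y * (a + b)) + f1 y * b"
    by (simp add: algebra_simps)
  also have "\<bar>\<dots>\<bar> \<le> K2 * (a + b)\<^sup>2 / 2 + K1 * \<bar>b\<bar>"
    using Taylor_second_order[OF f1 f2 K2, of y "a + b"] K1[of y]
    by (intro order_trans[OF abs_triangle_ineq] add_mono) (auto simp: abs_mult intro!: mult_right_mono)
  also have "\<dots> \<le> K2 * (2 * (L\<^sup>2 * (x ^ 2 + x ^ 4))) / 2 + K1 * (L * (x ^ 2 + x ^ 4))"
  proof (intro add_mono divide_right_mono mult_left_mono sq)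
    have "L * x ^ 2 \<le> L * (x ^ 2 + x ^ 4)" using L0 by (intro mult_left_mono) auto
    with ab show "\<bar>b\<bar> \<le> L * (x ^ 2 + x ^ 4)" by linarith
  qed (use K_nonneg in auto)
  also have "\<dots> = (K1 * L + K2 * L\<^sup>2) * (x ^ 2 + x ^ 4)" by (simp add: algebra_simps)
  finally show ?thesis using True by (simp add: noise_kick_def linear_kick_def a_def b_def x_def y_def)
next
  case False
  with z01[of \<omega>] have "z \<omega> = 0" by auto
  then show ?thesis using K_nonneg L0 by (simp add: noise_kick_def linear_kick_def)
qed

lemma noise_linear_eq: "noise_linear \<omega> = (transpose S *v v \<omega>) \<bullet> X \<omega>"
  by (simp add: linear_noise_def dot_lmul_matrix)

lemma G_measurable_coeffs:
  "(\<lambda>\<omega>. z \<omega> * f1 (H \<omega>)) \<in> borel_measurable G" "(\<lambda>\<omega>. z \<omega> * f2 (H \<omega>)) \<in> borel_measurable G"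
  "(\<lambda>\<omega>. (transpose S *v v \<omega>) $ i) \<in> borel_measurable G"
proof -
  note [measurable] = z H v
  show "(\<lambda>\<omega>. z \<omega> * f1 (H \<omega>)) \<in> borel_measurable G" "(\<lambda>\<omega>. z \<omega> * f2 (H \<omega>)) \<in> borel_measurable G"
    by measurable
  show "(\<lambda>\<omega>. (transpose S *v v \<omega>) $ i) \<in> borel_measurable G"
    by (rule borel_measurable_continuous_on[where f="\<lambda>x. (transpose S *v x) $ i", OF _ v])
      (intro continuous_intros matrix_vector_mult_linear_continuous_on)
qed

lemma coeff_bounds:
  "\<bar>z \<omega> * f1 (H \<omega>)\<bar> \<le> K1" "\<bar>z \<omega> * f2 (H \<omega>)\<bar> \<le> K2"
  "z \<omega> = 1 \<Longrightarrow> \<bar>(transpose S *v v \<omega>) $ i\<bar> \<le> L"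
proof -
  show "\<bar>z \<omega> * f1 (H \<omega>)\<bar> \<le> K1" "\<bar>z \<omega> * f2 (H \<omega>)\<bar> \<le> K2"
    using z01[of \<omega>] K1[of "H \<omega>"] K2[of "H \<omega>"] K_nonneg by auto
  assume "z \<omega> = 1"
  from L1[OF this, of "axis i 1"] show "\<bar>(transpose S *v v \<omega>) $ i\<bar> \<le> L"
    by (simp add: inner_axis flip: dot_lmul_matrix)
qed

text \<open>The product is \<open>Z \<bullet> X\<close> with \<open>Z\<close> known before the step.
  \<open>Y = 1\<close> shows that the term is centred; taking for \<open>Y\<close> the sum of the
  earlier terms gives orthogonality of martingale increments.\<close>

lemma kick_martingale_orthogonal:
  assumes Y: "Y \<in> borel_measurable G" "integrable P Y"
  shows "integrable P (\<lambda>\<omega>. Y \<omega> * kick_martingale \<omega>)" "expectation (\<lambda>\<omega>. Y \<omega> * kick_martingale \<omega>) = 0"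
proof -
  define Z where "Z \<omega> = (Y \<omega> * (z \<omega> * f1 (H \<omega>))) *\<^sub>R (transpose S *v v \<omega>)" for \<omega>
  have eq: "Y \<omega> * kick_martingale \<omega> = Z \<omega> \<bullet> X \<omega>" for \<omega>
    by (simp only: Z_def linear_kick_def noise_linear_eq inner_scaleR_left mult.assoc)
  have m: "(\<lambda>\<omega>. Z \<omega> $ i) \<in> borel_measurable G" for i
    unfolding Z_def using G_measurable_coeffs Y(1) by (simp only: vector_scaleR_component) measurable
  have "integrable P (\<lambda>\<omega>. Z \<omega> $ i)" for i
  proof (rule Bochner_Integration.integrable_bound)
    show "integrable P (\<lambda>\<omega>. (K1 * L) * Y \<omega>)" using Y by auto
    show "(\<lambda>\<omega>. Z \<omega> $ i) \<in> borel_measurable P" using m by (rule measurable_G)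
    show "AE \<omega> in P. norm (Z \<omega> $ i) \<le> norm (K1 * L * Y \<omega>)"
    proof (intro AE_I2)
      fix \<omega>
      have "\<bar>z \<omega> * f1 (H \<omega>)\<bar> * \<bar>(transpose S *v v \<omega>) $ i\<bar> \<le> K1 * L"
      proof (cases "z \<omega> = 0")
        case False
        with z01 have "z \<omega> = 1" by blast
        then show ?thesis using coeff_bounds(1)[of \<omega>] coeff_bounds(3)[of \<omega> i] K_nonneg by (intro mult_mono) auto
      qed (use K_nonneg L0 in simp)
      then have "\<bar>Y \<omega>\<bar> * (\<bar>z \<omega> * f1 (H \<omega>)\<bar> * \<bar>(transpose S *v v \<omega>) $ i\<bar>) \<le> \<bar>Y \<omega>\<bar> * (K1 * L)"
        by (intro mult_left_mono) auto
      then show "norm (Z \<omega> $ i) \<le> norm (K1 * L * Y \<omega>)"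
        using K_nonneg L0 by (simp only: Z_def vector_scaleR_component real_norm_def abs_mult real_scaleR_def abs_of_nonneg mult_ac)
    qed
  qed
  from linear_expectation[OF m this]
  show "integrable P (\<lambda>\<omega>. Y \<omega> * kick_martingale \<omega>)" "expectation (\<lambda>\<omega>. Y \<omega> * kick_martingale \<omega>) = 0"
    by (simp_all only: eq)
qed

lemma kick_martingale_bound: "\<bar>kick_martingale \<omega>\<bar> \<le> K1 * L * norm (X \<omega>)"
proof (cases "z \<omega> = 0")
  case False
  with z01 have "z \<omega> = 1" by blast
  then show ?thesis
    using noise_bounds(1)[of \<omega>] coeff_bounds(1)[of \<omega>] K_nonneg
    unfolding linear_kick_def abs_mult[of _ "noise_linear \<omega>"] mult.assoc[of K1]
    by (intro mult_mono) auto
qed (use K_nonneg L0 in \<open>simp add: linear_kick_def\<close>)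

lemma kick_martingale_square:
  "integrable P (\<lambda>\<omega>. (kick_martingale \<omega>)\<^sup>2)"
  "expectation (\<lambda>\<omega>. (kick_martingale \<omega>)\<^sup>2) \<le> (K1 * L)\<^sup>2 * gauss_moment CARD('d) 1 * h"
proof -
  have le: "(kick_martingale \<omega>)\<^sup>2 \<le> (K1 * L)\<^sup>2 * norm (X \<omega>) ^ (2 * 1)" for \<omega>
    using power_mono[OF kick_martingale_bound[of \<omega>], of 2] by (simp add: power_mult_distrib)
  have int: "integrable P (\<lambda>\<omega>. (K1 * L)\<^sup>2 * norm (X \<omega>) ^ (2 * 1))"
    by (intro integrable_mult_right norm_even_moment)
  show 1: "integrable P (\<lambda>\<omega>. (kick_martingale \<omega>)\<^sup>2)"
    by (rule Bochner_Integration.integrable_bound[OF int]) (use le in auto)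
  have "expectation (\<lambda>\<omega>. (kick_martingale \<omega>)\<^sup>2) \<le> expectation (\<lambda>\<omega>. (K1 * L)\<^sup>2 * norm (X \<omega>) ^ (2 * 1))"
    by (rule integral_mono[OF 1 int le])
  also have "\<dots> \<le> (K1 * L)\<^sup>2 * (gauss_moment CARD('d) 1 * h ^ 1)"
    unfolding integral_mult_right_zero by (intro mult_left_mono norm_even_moment) simp
  finally show "expectation (\<lambda>\<omega>. (kick_martingale \<omega>)\<^sup>2) \<le> (K1 * L)\<^sup>2 * gauss_moment CARD('d) 1 * h"
    by simp
qed

lemma kick_remainder_square:
  assumes "h \<le> 1"
  shows "integrable P (\<lambda>\<omega>. (kick \<omega> - kick_martingale \<omega>)\<^sup>2)"
    "expectation (\<lambda>\<omega>. (kick \<omega> - kick_martingale \<omega>)\<^sup>2) \<le>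
      2 * (K1 * L + K2 * L\<^sup>2)\<^sup>2 * (gauss_moment CARD('d) 2 + gauss_moment CARD('d) 4) * h\<^sup>2"
proof -
  let ?C = "2 * (K1 * L + K2 * L\<^sup>2)\<^sup>2"
  let ?g = "\<lambda>\<omega>. ?C * (norm (X \<omega>) ^ (2 * 2) + norm (X \<omega>) ^ (2 * 4))"
  have le: "(kick \<omega> - kick_martingale \<omega>)\<^sup>2 \<le> ?g \<omega>" for \<omega>
  proof -
    define x where "x = norm (X \<omega>)"
    have "(kick \<omega> - kick_martingale \<omega>)\<^sup>2 \<le> ((K1 * L + K2 * L\<^sup>2) * (x ^ 2 + x ^ 4))\<^sup>2"
      using power_mono[OF kick_remainder_bound[of \<omega>], of 2] by (simp add: x_def)
    also have "\<dots> = (K1 * L + K2 * L\<^sup>2)\<^sup>2 * (x ^ 2 + x ^ 4)\<^sup>2" by (rule power_mult_distrib)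
    also have "\<dots> \<le> (K1 * L + K2 * L\<^sup>2)\<^sup>2 * (2 * (x ^ (2 * 2) + x ^ (2 * 4)))"
    proof (rule mult_left_mono)
      have "(x ^ 2 + x ^ 4)\<^sup>2 \<le> 2 * (x ^ 2)\<^sup>2 + 2 * (x ^ 4)\<^sup>2"
        using sum_squares_bound[of "x ^ 2" "x ^ 4"] by (simp add: power2_sum)
      then show "(x ^ 2 + x ^ 4)\<^sup>2 \<le> 2 * (x ^ (2 * 2) + x ^ (2 * 4))" by (simp flip: power_mult)
    qed simp
    finally show ?thesis by (simp only: x_def mult_ac)
  qed
  have int: "integrable P ?g"
    by (intro integrable_mult_right Bochner_Integration.integrable_add norm_even_moment)
  show 1: "integrable P (\<lambda>\<omega>. (kick \<omega> - kick_martingale \<omega>)\<^sup>2)"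
    by (rule Bochner_Integration.integrable_bound[OF int]) (use le in \<open>auto intro: order_trans[OF _ abs_ge_self]\<close>)
  have "expectation (\<lambda>\<omega>. (kick \<omega> - kick_martingale \<omega>)\<^sup>2) \<le> expectation ?g"
    by (rule integral_mono[OF 1 int le])
  also have "\<dots> = ?C * (expectation (\<lambda>\<omega>. norm (X \<omega>) ^ (2 * 2)) + expectation (\<lambda>\<omega>. norm (X \<omega>) ^ (2 * 4)))"
    unfolding integral_mult_right_zero by (subst Bochner_Integration.integral_add) (intro norm_even_moment refl)+
  also have "\<dots> \<le> ?C * (gauss_moment CARD('d) 2 * h ^ 2 + gauss_moment CARD('d) 4 * h ^ 4)"
    by (intro mult_left_mono add_mono norm_even_moment) simp
  also have "\<dots> \<le> ?C * (gauss_moment CARD('d) 2 * h ^ 2 + gauss_moment CARD('d) 4 * h ^ 2)"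
    using h assms by (intro mult_left_mono add_left_mono power_decreasing) (auto simp: gauss_moment_def)
  finally show "expectation (\<lambda>\<omega>. (kick \<omega> - kick_martingale \<omega>)\<^sup>2) \<le>
      2 * (K1 * L + K2 * L\<^sup>2)\<^sup>2 * (gauss_moment CARD('d) 2 + gauss_moment CARD('d) 4) * h\<^sup>2"
    by (simp add: algebra_simps)
qed

lemma integrable_kick: "integrable P kick"
  by (rule integrable_const_bound[of _ "2 * K0"]) (simp_all add: kick_bounded AE_I2)

text \<open>The factor of \<open>h\<close> is the second-order part of the generator applied to
  \<open>f\<close> of the energy. The error is of order h^(3/2), so over 1 / h steps it adds up to
  order \<open>sqrt h\<close> only.\<close>

lemma kick_mean:
  assumes "h \<le> 1"
  shows "\<bar>expectation kick - h * expectation (\<lambda>\<omega>. z \<omega> * (f1 (H \<omega>) * (trace (transpose S ** N ** S) / 2)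
      + f2 (H \<omega>) * ((norm (transpose S *v v \<omega>))\<^sup>2 / 2)))\<bar>
    \<le> (2 * K3 * L ^ 3 + 2 * K2 * L\<^sup>2)
      * (gauss_moment CARD('d) 1 + gauss_moment CARD('d) 2 + gauss_moment CARD('d) 3) * (h * sqrt h)"
proof -
  let ?C = "2 * K3 * L ^ 3 + 2 * K2 * L\<^sup>2"
  define u where "u \<omega> = transpose S *v v \<omega>" for \<omega>
  define Q where "Q = transpose S ** N ** S"
  define A1 where "A1 \<omega> = z \<omega> * f1 (H \<omega>) * noise_linear \<omega>" for \<omega>
  define A2 where "A2 \<omega> = z \<omega> * f1 (H \<omega>) * noise_quadratic \<omega>" for \<omega>
  define A3 where "A3 \<omega> = z \<omega> * f2 (H \<omega>) / 2 * (noise_linear \<omega>)\<^sup>2" for \<omega>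
  \<comment> \<open>Both second-order terms of the expansion are quadratic forms in \<open>X\<close>
    with coefficients known before the step. \<open>Z3\<close> is a multiple of the rank-one matrix
    of products of the entries of \<open>u\<close>, whose trace is the squared norm of
    \<open>u\<close>.\<close>
  define Z2 where "Z2 \<omega> = (z \<omega> * f1 (H \<omega>) / 2) *\<^sub>R Q" for \<omega>
  define Z3 where "Z3 \<omega> = (z \<omega> * f2 (H \<omega>) / 2) *\<^sub>R (\<chi> i j. u \<omega> $ i * u \<omega> $ j)" for \<omega>
  have A1: "integrable P A1" "expectation A1 = 0"
  proof -
    have eq: "A1 = (\<lambda>\<omega>. 1 * kick_martingale \<omega>)"
      by (simp add: fun_eq_iff A1_def linear_kick_def)
    have one: "(\<lambda>_. 1::real) \<in> borel_measurable G" "integrable P (\<lambda>_. 1::real)" by auto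
    show "integrable P A1" "expectation A1 = 0"
      unfolding eq by (rule kick_martingale_orthogonal[OF one])+
  qed
  have A2_eq: "A2 \<omega> = X \<omega> \<bullet> (Z2 \<omega> *v X \<omega>)" for \<omega>
  proof -
    have "Q *v x = transpose S *v (N *v (S *v x))" for x
      unfolding Q_def by (simp only: matrix_vector_mul_assoc matrix_mul_assoc)
    then have "(S *v x) \<bullet> (N *v (S *v x)) = x \<bullet> (Q *v x)" for x
      by (metis dot_lmul_matrix inner_commute transpose_matrix_vector)
    then show ?thesis
      by (simp add: A2_def Z2_def quadratic_noise_def scaleR_matrix_vector_assoc[symmetric])
  qed
  have A3_eq: "A3 \<omega> = X \<omega> \<bullet> (Z3 \<omega> *v X \<omega>)" for \<omega>
    unfolding A3_def noise_linear_eq u_def[symmetric] Z3_def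
    by (simp add: scaleR_matrix_vector_assoc[symmetric] inner_vec_def matrix_vector_mult_def
        power2_eq_square sum_product sum_distrib_left mult_ac)
  have Z2: "(\<lambda>\<omega>. Z2 \<omega> $ i $ j) \<in> borel_measurable G" "integrable P (\<lambda>\<omega>. Z2 \<omega> $ i $ j)" for i j
  proof -
    show m: "(\<lambda>\<omega>. Z2 \<omega> $ i $ j) \<in> borel_measurable G"
      unfolding Z2_def vector_scaleR_component real_scaleR_def
      by (intro G_measurable_coeffs borel_measurable_times borel_measurable_divide borel_measurable_const)
    show "integrable P (\<lambda>\<omega>. Z2 \<omega> $ i $ j)"
      by (rule bounded_G_integrable[OF m, of "K1 / 2 * \<bar>Q $ i $ j\<bar>"])
        (use coeff_bounds(1) in \<open>auto simp: Z2_def abs_mult intro!: mult_right_mono\<close>)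
  qed
  have Z3: "(\<lambda>\<omega>. Z3 \<omega> $ i $ j) \<in> borel_measurable G" "integrable P (\<lambda>\<omega>. Z3 \<omega> $ i $ j)" for i j
  proof -
    have eq: "Z3 \<omega> $ i $ j = z \<omega> * f2 (H \<omega>) / 2 * (u \<omega> $ i * u \<omega> $ j)" for \<omega>
      by (simp add: Z3_def)
    show m: "(\<lambda>\<omega>. Z3 \<omega> $ i $ j) \<in> borel_measurable G"
      unfolding eq u_def
      by (intro G_measurable_coeffs borel_measurable_times borel_measurable_divide borel_measurable_const)
    have "\<bar>Z3 \<omega> $ i $ j\<bar> \<le> K2 / 2 * (L * L)" for \<omega>
    proof (cases "z \<omega> = 0")
      case False
      with z01 have "z \<omega> = 1" by blast
      then have "\<bar>z \<omega> * f2 (H \<omega>) / 2\<bar> * (\<bar>u \<omega> $ i\<bar> * \<bar>u \<omega> $ j\<bar>) \<le> K2 / 2 * (L * L)"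
        using coeff_bounds(2)[of \<omega>] coeff_bounds(3)[of \<omega>] K_nonneg L0 unfolding u_def
        by (intro mult_mono) auto
      then show ?thesis unfolding eq abs_mult .
    qed (use K_nonneg L0 in \<open>simp add: eq\<close>)
    then show "integrable P (\<lambda>\<omega>. Z3 \<omega> $ i $ j)" by (rule bounded_G_integrable[OF m])
  qed
  have A2: "integrable P A2" "expectation A2 = h * expectation (\<lambda>\<omega>. trace (Z2 \<omega>))"
    using quadratic_expectation[OF Z2] by (simp_all only: A2_eq[abs_def])
  have A3: "integrable P A3" "expectation A3 = h * expectation (\<lambda>\<omega>. trace (Z3 \<omega>))"
    using quadratic_expectation[OF Z3] by (simp_all only: A3_eq[abs_def])
  have t: "z \<omega> * (f1 (H \<omega>) * (trace Q / 2) + f2 (H \<omega>) * ((norm (u \<omega>))\<^sup>2 / 2)) = trace (Z2 \<omega>) + trace (Z3 \<omega>)" for \<omega>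
    by (simp add: Z2_def Z3_def trace_def power2_norm_eq_inner inner_vec_def sum_distrib_left sum_divide_distrib algebra_simps)
  have it: "integrable P (\<lambda>\<omega>. trace (Z2 \<omega>))" "integrable P (\<lambda>\<omega>. trace (Z3 \<omega>))"
    unfolding trace_def using Z2 Z3 by auto
  have "expectation kick - h * expectation (\<lambda>\<omega>. z \<omega> * (f1 (H \<omega>) * (trace Q / 2) + f2 (H \<omega>) * ((norm (u \<omega>))\<^sup>2 / 2)))
      = expectation (\<lambda>\<omega>. kick \<omega> - (A1 \<omega> + A2 \<omega> + A3 \<omega>))"
    unfolding t using A1 A2 A3 it integrable_kick by (simp add: distrib_left)
  also have "\<bar>\<dots>\<bar> \<le> expectation (\<lambda>\<omega>. \<bar>kick \<omega> - (A1 \<omega> + A2 \<omega> + A3 \<omega>)\<bar>)"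
    by (rule integral_abs_bound)
  also have "\<dots> \<le> expectation (\<lambda>\<omega>. ?C * (norm (X \<omega>) ^ 3 + norm (X \<omega>) ^ (2 * 3)))"
  proof (rule integral_mono)
    show "integrable P (\<lambda>\<omega>. \<bar>kick \<omega> - (A1 \<omega> + A2 \<omega> + A3 \<omega>)\<bar>)"
      by (intro integrable_abs Bochner_Integration.integrable_diff Bochner_Integration.integrable_add
          integrable_kick A1 A2 A3)
    show "integrable P (\<lambda>\<omega>. ?C * (norm (X \<omega>) ^ 3 + norm (X \<omega>) ^ (2 * 3)))"
      by (intro integrable_mult_right Bochner_Integration.integrable_add integrable_norm_power)
    show "\<bar>kick \<omega> - (A1 \<omega> + A2 \<omega> + A3 \<omega>)\<bar> \<le> ?C * (norm (X \<omega>) ^ 3 + norm (X \<omega>) ^ (2 * 3))" for \<omega>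
      using kick_expansion[of \<omega>] by (simp add: A1_def A2_def A3_def)
  qed
  also have "\<dots> = ?C * (expectation (\<lambda>\<omega>. norm (X \<omega>) ^ 3) + expectation (\<lambda>\<omega>. norm (X \<omega>) ^ (2 * 3)))"
    unfolding integral_mult_right_zero by (subst Bochner_Integration.integral_add) (intro integrable_norm_power refl)+
  also have "\<dots> \<le> ?C * ((gauss_moment CARD('d) 1 + gauss_moment CARD('d) 2) * (h * sqrt h) + gauss_moment CARD('d) 3 * h ^ 3)"
    using K_nonneg L0 by (intro mult_left_mono add_mono norm_even_moment norm_cubic_moment) auto
  also have "\<dots> \<le> ?C * ((gauss_moment CARD('d) 1 + gauss_moment CARD('d) 2) * (h * sqrt h) + gauss_moment CARD('d) 3 * (h * sqrt h))"
  proof (intro mult_left_mono add_left_mono)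
    have "h ^ 2 \<le> sqrt h"
    proof (rule real_le_rsqrt)
      show "(h ^ 2)\<^sup>2 \<le> h" using h assms power_decreasing[of 1 4 h] by (simp flip: power_mult)
    qed
    then show "h ^ 3 \<le> h * sqrt h" using h by (simp add: power3_eq_cube power2_eq_square mult.assoc)
  qed (use K_nonneg L0 in \<open>auto simp: gauss_moment_def\<close>)
  finally show ?thesis by (simp add: Q_def u_def algebra_simps)
qed

end

end

section \<open>Summation over the time grid\<close>

text \<open>Bounded second moments give uniform integrability. Concretely |y| \<le> min |y| K + y^2
  / K: the first part is handled by dominated convergence, the second is small in mean for large
  K.\<close>

lemma (in prob_space) expectation_tendsto_zero_of_L2_bounded:
  fixes Y :: "nat \<Rightarrow> 'a \<Rightarrow> real"
  assumes Y[measurable]: "\<And>n. Y n \<in> borel_measurable M" and lim: "AE \<omega> in M. (\<lambda>n. Y n \<omega>) \<longlonglongrightarrow> 0"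
    and int: "\<And>n. integrable M (\<lambda>\<omega>. (Y n \<omega>)\<^sup>2)" and bound: "\<And>n. expectation (\<lambda>\<omega>. (Y n \<omega>)\<^sup>2) \<le> C"
  shows "(\<lambda>n. expectation (Y n)) \<longlonglongrightarrow> 0"
proof (rule LIMSEQ_I)
  fix e :: real assume e: "0 < e"
  \<comment> \<open>Chosen so that the tail \<open>\<bar>C\<bar> / K\<close> is at most
    \<open>e / 2\<close>; the summand 1 keeps \<open>K\<close> positive when \<open>C\<close>
    vanishes.\<close>
  define K where "K = 2 * (\<bar>C\<bar> + 1) / e"
  have K: "K > 0" using e by (auto simp: K_def intro!: divide_pos_pos)
  have iY: "integrable M (Y n)" for n
    by (rule square_integrable_imp_integrable) (use int in auto)
  have imin: "integrable M (\<lambda>\<omega>. min \<bar>Y n \<omega>\<bar> K)" for n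
    by (rule integrable_const_bound[of _ K]) (use K in auto)
  have "(\<lambda>n. expectation (\<lambda>\<omega>. min \<bar>Y n \<omega>\<bar> K)) \<longlonglongrightarrow> expectation (\<lambda>\<omega>. 0)"
  proof (rule integral_dominated_convergence[where w="\<lambda>_. K"])
    show "AE \<omega> in M. (\<lambda>n. min \<bar>Y n \<omega>\<bar> K) \<longlonglongrightarrow> 0"
      using lim
    proof eventually_elim
      case (elim \<omega>)
      from tendsto_min[OF tendsto_rabs_zero[OF elim] tendsto_const[of K]] K
      show ?case by simp
    qed
  qed (use K in auto)
  then have "eventually (\<lambda>n. expectation (\<lambda>\<omega>. min \<bar>Y n \<omega>\<bar> K) < e / 2) sequentially"
    using order_tendstoD(2)[of _ 0 sequentially "e / 2"] e by simp
  then obtain n0 where n0: "\<And>n. n \<ge> n0 \<Longrightarrow> expectation (\<lambda>\<omega>. min \<bar>Y n \<omega>\<bar> K) < e / 2"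
    by (auto simp: eventually_sequentially)
  have "norm (expectation (Y n) - 0) < e" if "n \<ge> n0" for n
  proof -
    have le: "\<bar>y\<bar> \<le> min \<bar>y\<bar> K + y\<^sup>2 / K" for y :: real
    proof (cases "\<bar>y\<bar> \<le> K")
      case False
      then have "\<bar>y\<bar> * K \<le> \<bar>y\<bar> * \<bar>y\<bar>" by (intro mult_left_mono) auto
      then have "\<bar>y\<bar> \<le> y\<^sup>2 / K" using K by (simp add: pos_le_divide_eq power2_eq_square abs_mult_self_eq)
      then show ?thesis using K by auto
    qed (use K in auto)
    have "\<bar>expectation (Y n)\<bar> \<le> expectation (\<lambda>\<omega>. \<bar>Y n \<omega>\<bar>)" by (rule integral_abs_bound)
    also have "\<dots> \<le> expectation (\<lambda>\<omega>. min \<bar>Y n \<omega>\<bar> K + (Y n \<omega>)\<^sup>2 / K)"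
      using le by (intro integral_mono integrable_abs iY Bochner_Integration.integrable_add imin integrable_divide int)
    also have "\<dots> = expectation (\<lambda>\<omega>. min \<bar>Y n \<omega>\<bar> K) + expectation (\<lambda>\<omega>. (Y n \<omega>)\<^sup>2) / K"
      by (subst Bochner_Integration.integral_add) (auto intro: imin int)
    also have "\<dots> < e / 2 + \<bar>C\<bar> / K"
      using n0[OF that] bound[of n] K by (intro add_less_le_mono divide_right_mono) auto
    also have "\<dots> \<le> e / 2 + e / 2"
      using e by (intro add_left_mono) (simp add: K_def field_simps)
    finally show ?thesis by simp
  qed
  then show "\<exists>n0. \<forall>n\<ge>n0. norm (expectation (Y n) - 0) < e" by blast
qed

text \<open>The indicators are a run of ones followed by zeros, so the sum telescopes up to the
  stopping index \<open>m\<close>. The clause \<open>z m = 0\<close> carries the induction: once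
  stopped, later steps add nothing.\<close>

lemma stopped_telescope:
  fixes c :: "nat \<Rightarrow> real" and z :: "nat \<Rightarrow> real"
  assumes "\<And>k. z k = 0 \<or> z k = 1" "\<And>k. z k = 0 \<Longrightarrow> z (Suc k) = 0"
  shows "\<exists>m\<le>n. (\<Sum>k<n. z k * (c (Suc k) - c k)) = c m - c 0 \<and> (\<forall>k<m. z k = 1) \<and> (m < n \<longrightarrow> z m = 0)"
proof (induction n)
  case (Suc n)
  then obtain m where m: "m \<le> n" "(\<Sum>k<n. z k * (c (Suc k) - c k)) = c m - c 0"
    "\<forall>k<m. z k = 1" "m < n \<longrightarrow> z m = 0" by blast
  have 0: "z m = 0 \<Longrightarrow> z k = 0" if "m \<le> k" for k
    using that by (induction k rule: dec_induct) (use assms(2) in auto)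
  show ?case
  proof (cases "m = n \<and> z n = 1")
    case True
    then show ?thesis using m by (intro exI[of _ "Suc n"]) (auto simp: less_Suc_eq)
  next
    case False
    then have "z m = 0" using m assms(1)[of n] by auto
    then show ?thesis using m 0[of n] by (intro exI[of _ m]) auto
  qed
qed auto

text \<open>\<open>N\<close> and \<open>S\<close> stand for \<open>M\<^sup>-\<^sup>1\<close> and \<open>sqrt 2 \<Sigma>\<close>, hence the factors \<open>1 / 2\<close> below.\<close>

locale stationary_langevin = prob_space P
  for P :: "'w measure" +
  fixes F :: "real \<Rightarrow> 'w measure" and W q p :: "real \<Rightarrow> 'w \<Rightarrow> real^'d"
    and V :: "real^'d \<Rightarrow> real" and V' :: "real^'d \<Rightarrow> real^'d"
    and N S :: "real^'d^'d" and \<gamma> :: real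
    and \<pi> :: "((real^'d) \<times> (real^'d)) measure"
    and f f1 f2 f3 :: "real \<Rightarrow> real" and K0 K1 K2 K3 :: real
  assumes filtration: "filtration (space P) F" and subalgebra: "\<And>t. subalgebra P (F t)"
    and W_adapted: "\<And>t. 0 \<le> t \<Longrightarrow> W t \<in> borel_measurable (F t)"
    and q_adapted: "\<And>t. 0 \<le> t \<Longrightarrow> q t \<in> borel_measurable (F t)"
    and p_adapted: "\<And>t. 0 \<le> t \<Longrightarrow> p t \<in> borel_measurable (F t)"
    and increments: "\<And>s t. 0 \<le> s \<Longrightarrow> s < t \<Longrightarrow> gaussian_increment P (F s) (\<lambda>\<omega>. W t \<omega> - W s \<omega>) (t - s)"
    and paths: "AE \<omega> in P. continuous_on {0..} (\<lambda>t. q t \<omega>) \<and> continuous_on {0..} (\<lambda>t. p t \<omega>)"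
    and equations: "AE \<omega> in P. \<forall>t\<ge>0.
        ((\<lambda>s. N *v p s \<omega>) has_integral (q t \<omega> - q 0 \<omega>)) {0..t} \<and>
        ((\<lambda>s. - \<gamma> *\<^sub>R (N *v p s \<omega>) - V' (q s \<omega>)) has_integral
           (p t \<omega> - p 0 \<omega> - (S *v W t \<omega> - S *v W 0 \<omega>))) {0..t}"
    and stationary: "\<And>t. 0 \<le> t \<Longrightarrow> distr P borel (\<lambda>\<omega>. (q t \<omega>, p t \<omega>)) = \<pi>"
    and N_sym: "transpose N = N"
    and V: "\<And>x. GDERIV V x :> V' x" and V': "continuous_on UNIV V'"
    and f1: "\<And>x. DERIV f x :> f1 x" and f2: "\<And>x. DERIV f1 x :> f2 x" and f3: "\<And>x. DERIV f2 x :> f3 x"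
    and K0: "\<And>x. \<bar>f x\<bar> \<le> K0" and K1: "\<And>x. \<bar>f1 x\<bar> \<le> K1"
    and K2: "\<And>x. \<bar>f2 x\<bar> \<le> K2" and K3: "\<And>x. \<bar>f3 x\<bar> \<le> K3"
begin

definition "energy x = snd x \<bullet> (N *v snd x) / 2 + V (fst x)"

definition "dissipation x = f1 (energy x) * (\<gamma> * (norm (N *v snd x))\<^sup>2)"

text \<open>The Ito correction. \<open>injection - dissipation\<close> is the generator of the
  dynamics applied to \<open>f\<close> of the energy; the terms with \<open>V'\<close> have
  cancelled.\<close>

definition "injection x = f1 (energy x) * (trace (transpose S ** N ** S) / 2)
    + f2 (energy x) * ((norm (transpose S *v (N *v snd x)))\<^sup>2 / 2)"

definition "state t \<omega> = (q t \<omega>, p t \<omega>)"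

text \<open>Division by zero yields zero, so \<open>n = 0\<close> simply gives the initial
  state.\<close>

definition "grid_state n k \<omega> = state (real k / real n) \<omega>"

text \<open>The index \<open>k\<close> itself is tested, so the indicator is known at the start of
  the step that it multiplies. The path during that step, and its end point, may leave the
  ball.\<close>

definition stay :: "real \<Rightarrow> nat \<Rightarrow> nat \<Rightarrow> 'w \<Rightarrow> real" where
  "stay R n k \<omega> = (if \<forall>j\<le>k. norm (grid_state n j \<omega>) \<le> R then 1 else 0)"

definition "dW n k \<omega> = W (real (Suc k) / real n) \<omega> - W (real k / real n) \<omega>"

abbreviation "kick R n k \<omega> \<equiv>
  noise_kick f S N (stay R n k \<omega>) (energy (grid_state n k \<omega>)) (N *v snd (grid_state n k \<omega>)) (dW n k \<omega>)"

abbreviation "lin_kick R n k \<omega> \<equiv>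
  linear_kick f1 S (stay R n k \<omega>) (energy (grid_state n k \<omega>)) (N *v snd (grid_state n k \<omega>)) (dW n k \<omega>)"

lemma K_nonneg: "0 \<le> K0" "0 \<le> K1" "0 \<le> K2" "0 \<le> K3"
  using K0[of 0] K1[of 0] K2[of 0] K3[of 0] by linarith+

lemma V_continuous: "continuous_on UNIV V"
  using V unfolding gderiv_def by (meson continuous_at_imp_continuous_on has_derivative_continuous)

lemma f_measurable[measurable]:
  "f \<in> borel_measurable borel" "f1 \<in> borel_measurable borel" "f2 \<in> borel_measurable borel"
  using f1 f2 f3 by (auto intro!: borel_measurable_continuous_onI DERIV_continuous_on
      intro: has_field_derivative_at_within)

lemma energy_measurable[measurable]: "energy \<in> borel_measurable borel"
proof (rule borel_measurable_continuous_onI)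
  have "continuous_on UNIV (\<lambda>x::(real^'d) \<times> (real^'d). V (fst x))"
    by (rule continuous_on_compose2[OF V_continuous]) (auto intro: continuous_intros)
  then show "continuous_on UNIV energy"
    unfolding energy_def[abs_def]
    by (intro continuous_intros bounded_linear.continuous_on[OF matrix_vector_mul_bounded_linear]) auto
qed

lemma velocity_measurable[measurable]:
  "(\<lambda>x::(real^'d) \<times> (real^'d). N *v snd x) \<in> borel_measurable borel"
  "(\<lambda>x::(real^'d) \<times> (real^'d). norm (transpose S *v (N *v snd x))) \<in> borel_measurable borel"
  by (intro borel_measurable_continuous_onI continuous_intros
      bounded_linear.continuous_on[OF matrix_vector_mul_bounded_linear])+

lemma dissipation_measurable[measurable]: "dissipation \<in> borel_measurable borel"
  unfolding dissipation_def[abs_def] by measurable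

lemma injection_measurable[measurable]: "injection \<in> borel_measurable borel"
  unfolding injection_def[abs_def] by measurable

lemma F_mono: "s \<le> t \<Longrightarrow> g \<in> borel_measurable (F s) \<Longrightarrow> g \<in> borel_measurable (F t)"
proof -
  assume st: "s \<le> t" and g: "g \<in> borel_measurable (F s)"
  have "subalgebra (F t) (F s)"
    using filtration.sets_F_mono[OF filtration st] filtration.space_F[OF filtration]
    by (auto simp: subalgebra_def)
  then show ?thesis using g by (rule measurable_from_subalg)
qed

lemma F_P: "g \<in> borel_measurable (F t) \<Longrightarrow> g \<in> borel_measurable P"
  by (rule measurable_from_subalg[OF subalgebra])

lemma state_adapted: "0 \<le> t \<Longrightarrow> state t \<in> borel_measurable (F t)"
  unfolding state_def[abs_def] using q_adapted p_adapted by (intro borel_measurable_Pair) auto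

lemma grid_state_adapted: "j \<le> k \<Longrightarrow> grid_state n j \<in> borel_measurable (F (real k / real n))"
  unfolding grid_state_def[abs_def]
  by (rule F_mono[of "real j / real n"]) (auto intro!: divide_right_mono state_adapted)

lemma grid_state_measurable[measurable]: "grid_state n j \<in> borel_measurable P"
  using grid_state_adapted[of j j n] by (intro F_P) auto

lemma state_measurable: "0 \<le> t \<Longrightarrow> state t \<in> borel_measurable P"
  using state_adapted by (intro F_P) auto

lemma stay_adapted: "stay R n k \<in> borel_measurable (F (real k / real n))"
proof -
  have "(\<lambda>\<omega>. norm (grid_state n j \<omega>)) \<in> borel_measurable (F (real k / real n))" if "j \<le> k" for j
    by (rule measurable_compose[OF grid_state_adapted[OF that] borel_measurable_norm])
  then have "Measurable.pred (F (real k / real n)) (\<lambda>\<omega>. norm (grid_state n j \<omega>) \<le> R)" if "j \<le> k" for j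
    using that by measurable
  then have "Measurable.pred (F (real k / real n)) (\<lambda>\<omega>. \<forall>j\<in>{..k}. norm (grid_state n j \<omega>) \<le> R)"
    by (intro pred_intros_finite) auto
  then have "(\<lambda>\<omega>. if \<forall>j\<in>{..k}. norm (grid_state n j \<omega>) \<le> R then 1 else 0 :: real)
      \<in> borel_measurable (F (real k / real n))"
    by (intro measurable_If borel_measurable_const) (simp only: pred_def)
  then show ?thesis by (simp only: stay_def[abs_def] atMost_iff Ball_def)
qed

lemma stay_measurable[measurable]: "stay R n k \<in> borel_measurable P"
  using stay_adapted by (rule F_P)

lemma stay_cases: "stay R n k \<omega> = 0 \<or> stay R n k \<omega> = 1"
  by (auto simp: stay_def)

lemma stay_Suc: "stay R n k \<omega> = 0 \<Longrightarrow> stay R n (Suc k) \<omega> = 0"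
  by (auto simp: stay_def split: if_splits) (meson le_Suc_eq)

lemma stay_norm: "stay R n k \<omega> = 1 \<Longrightarrow> norm (grid_state n k \<omega>) \<le> R"
  by (auto simp: stay_def split: if_splits)

lemma energy_adapted: "(\<lambda>\<omega>. energy (grid_state n k \<omega>)) \<in> borel_measurable (F (real k / real n))"
  using grid_state_adapted[of k k n] by measurable

lemma velocity_adapted: "(\<lambda>\<omega>. N *v snd (grid_state n k \<omega>)) \<in> borel_measurable (F (real k / real n))"
  using measurable_compose[OF grid_state_adapted[of k k n] velocity_measurable(1)] by simp

lemma dW_increment:
  assumes "n > 0"
  shows "gaussian_increment P (F (real k / real n)) (dW n k) (1 / real n)"
proof -
  have "real (Suc k) / real n - real k / real n = 1 / real n" by (simp add: diff_divide_distrib[symmetric])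
  moreover have "real k / real n < real (Suc k) / real n" using assms by (intro divide_strict_right_mono) auto
  ultimately show ?thesis
    using increments[of "real k / real n" "real (Suc k) / real n"] by (simp add: dW_def[abs_def])
qed

lemma noise_bound_exists:
  obtains L where "0 \<le> L"
    "\<And>v x. norm v \<le> R \<Longrightarrow> \<bar>(N *v v) \<bullet> (S *v x)\<bar> \<le> L * norm x"
    "\<And>x. \<bar>(S *v x) \<bullet> (N *v (S *v x)) / 2\<bar> \<le> L * (norm x)\<^sup>2"
    "\<And>v. norm v \<le> R \<Longrightarrow> norm (N *v v) \<le> L"
proof -
  obtain a where a: "a > 0" "\<And>x. norm (N *v x) \<le> norm x * a"
    using bounded_linear.pos_bounded[OF matrix_vector_mul_bounded_linear[of N]] by blast
  obtain b where b: "b > 0" "\<And>x. norm (S *v x) \<le> norm x * b"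
    using bounded_linear.pos_bounded[OF matrix_vector_mul_bounded_linear[of S]] by blast
  define L where "L = \<bar>R\<bar> * a * b + b * b * a + \<bar>R\<bar> * a"
  have nn: "0 \<le> \<bar>R\<bar> * a * b" "0 \<le> b * b * a" "0 \<le> \<bar>R\<bar> * a" using a b by auto
  show thesis
  proof (rule that[of L])
    show "0 \<le> L" using nn by (simp add: L_def)
    show Nv: "norm (N *v v) \<le> L" if "norm v \<le> R" for v
    proof -
      have "norm (N *v v) \<le> \<bar>R\<bar> * a"
        using a(1) that by (intro order_trans[OF a(2)] mult_right_mono) auto
      then show ?thesis using nn by (simp add: L_def)
    qed
    show "\<bar>(N *v v) \<bullet> (S *v x)\<bar> \<le> L * norm x" if "norm v \<le> R" for v x
    proof -
      have "\<bar>(N *v v) \<bullet> (S *v x)\<bar> \<le> norm (N *v v) * norm (S *v x)" by (rule Cauchy_Schwarz_ineq2)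
      also have "\<dots> \<le> (\<bar>R\<bar> * a) * (norm x * b)"
        using a(1) that by (intro mult_mono b order_trans[OF a(2)] mult_right_mono) auto
      also have "\<dots> = (\<bar>R\<bar> * a * b) * norm x" by simp
      also have "\<dots> \<le> L * norm x" using nn by (intro mult_right_mono) (auto simp: L_def)
      finally show ?thesis .
    qed
    show "\<bar>(S *v x) \<bullet> (N *v (S *v x)) / 2\<bar> \<le> L * (norm x)\<^sup>2" for x
    proof -
      have "\<bar>(S *v x) \<bullet> (N *v (S *v x)) / 2\<bar> \<le> \<bar>(S *v x) \<bullet> (N *v (S *v x))\<bar>" by simp
      also have "\<dots> \<le> norm (S *v x) * norm (N *v (S *v x))" by (rule Cauchy_Schwarz_ineq2)
      also have "\<dots> \<le> (norm x * b) * ((norm x * b) * a)"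
        using a(1) b(1) by (intro mult_mono b order_trans[OF a(2)] mult_right_mono) auto
      also have "\<dots> = (b * b * a) * (norm x)\<^sup>2" by (simp add: power2_eq_square)
      also have "\<dots> \<le> L * (norm x)\<^sup>2" using nn by (intro mult_right_mono) (auto simp: L_def)
      finally show ?thesis .
    qed
  qed
qed

section \<open>Second moments of the stopped kick sums\<close>

context
  fixes R L :: real
  assumes L0: "0 \<le> L"
    and L1: "\<And>v x. norm v \<le> R \<Longrightarrow> \<bar>(N *v v) \<bullet> (S *v x)\<bar> \<le> L * norm x"
    and L2: "\<And>x. \<bar>(S *v x) \<bullet> (N *v (S *v x)) / 2\<bar> \<le> L * (norm x)\<^sup>2"
    and L3: "\<And>v. norm v \<le> R \<Longrightarrow> norm (N *v v) \<le> L"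
begin

lemma stay_linear_bound:
  "stay R n k \<omega> = 1 \<Longrightarrow> \<bar>(N *v snd (grid_state n k \<omega>)) \<bullet> (S *v x)\<bar> \<le> L * norm x"
  using norm_snd_le[of "snd (grid_state n k \<omega>)" "fst (grid_state n k \<omega>)"] stay_norm[of R n k \<omega>]
  by (intro L1) auto

text \<open>Listed in the order of the assumptions of the single-step context, so that every
  one-step result can be instantiated with \<open>OF\<close>.\<close>

lemmas increment_rules =
  f1 f2 f3 K0 K1 K2 K3 stay_adapted[of R] energy_adapted velocity_adapted stay_cases L0 stay_linear_bound L2

lemma stay_dissipation_bound: "\<bar>stay R n k \<omega> * dissipation (grid_state n k \<omega>)\<bar> \<le> K1 * (\<bar>\<gamma>\<bar> * L\<^sup>2)"
proof (cases "stay R n k \<omega> = 1")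
  case True
  have "norm (snd (grid_state n k \<omega>)) \<le> R"
    using norm_snd_le[of "snd (grid_state n k \<omega>)" "fst (grid_state n k \<omega>)"] stay_norm[OF True] by auto
  then have "(norm (N *v snd (grid_state n k \<omega>)))\<^sup>2 \<le> L\<^sup>2" by (intro power_mono L3) auto
  then show ?thesis
    unfolding True dissipation_def mult_1_left abs_mult using K1 K_nonneg
    by (intro mult_mono) auto
qed (use stay_cases[of R n k \<omega>] K_nonneg L0 in auto)

lemma stay_injection_bound:
  "\<bar>stay R n k \<omega> * injection (grid_state n k \<omega>)\<bar>
    \<le> K1 * \<bar>trace (transpose S ** N ** S) / 2\<bar> + K2 * (L\<^sup>2 / 2)"
proof (cases "stay R n k \<omega> = 1")
  case True
  define u where "u = N *v snd (grid_state n k \<omega>)"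
  define y where "y = transpose S *v u"
  \<comment> \<open>Duality: testing the bound on \<open>u \<bullet> (S *v y)\<close> with
    \<open>y\<close> equal to the transpose of \<open>S\<close> applied to \<open>u\<close> gives
    \<open>norm y \<le> L\<close>.\<close>
  have "(norm y)\<^sup>2 = u \<bullet> (S *v y)"
    by (simp add: power2_norm_eq_inner y_def dot_lmul_matrix)
  also have "\<dots> \<le> L * norm y"
    using stay_linear_bound[OF True, of y] by (simp add: u_def)
  finally have "norm y \<le> L" using L0 by (cases "norm y = 0") (auto simp: power2_eq_square)
  then have "(norm y)\<^sup>2 \<le> L\<^sup>2" by (intro power_mono) auto
  then show ?thesis
    unfolding True injection_def mult_1_left u_def[symmetric] y_def[symmetric] using K1 K2 K_nonneg
    by (intro order_trans[OF abs_triangle_ineq] add_mono) (auto simp: abs_mult intro!: mult_mono)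
qed (use stay_cases[of R n k \<omega>] K_nonneg L0 in auto)

lemma integrable_stay_dissipation: "integrable P (\<lambda>\<omega>. stay R n k \<omega> * dissipation (grid_state n k \<omega>))"
  by (rule integrable_const_bound[OF AE_I2[OF stay_dissipation_bound[folded real_norm_def]]]) measurable

lemma integrable_stay_injection: "integrable P (\<lambda>\<omega>. stay R n k \<omega> * injection (grid_state n k \<omega>))"
  by (rule integrable_const_bound[OF AE_I2[OF stay_injection_bound[folded real_norm_def]]]) measurable

lemma dW_adapted: "n > 0 \<Longrightarrow> dW n k \<in> borel_measurable (F (real (Suc k) / real n))"
  unfolding dW_def[abs_def]
  by (intro borel_measurable_diff W_adapted F_mono[OF _ W_adapted]) (auto intro!: divide_right_mono)

lemma lin_kick_adapted:
  assumes "n > 0"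
  shows "lin_kick R n k \<in> borel_measurable (F (real (Suc k) / real n))"
proof -
  have le: "real k / real n \<le> real (Suc k) / real n" by (intro divide_right_mono) auto
  note m = F_mono[OF le stay_adapted[of R]] measurable_compose[OF F_mono[OF le energy_adapted] f_measurable(2)]
    F_mono[OF le velocity_adapted]
  have "(\<lambda>\<omega>. S *v dW n k \<omega>) \<in> borel_measurable (F (real (Suc k) / real n))"
    by (rule measurable_compose[OF dW_adapted[OF assms]])
      (auto intro!: borel_measurable_continuous_onI bounded_linear.continuous_on[OF matrix_vector_mul_bounded_linear] continuous_on_id)
  with m show ?thesis
    unfolding linear_kick_def linear_noise_def by (intro borel_measurable_times borel_measurable_inner)
qed

text \<open>Cross terms vanish by orthogonality, so the mean squares, each of order
  \<open>1 / n\<close>, simply add. Adaptedness of the partial sum is part of the induction since it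
  is what makes the next cross term vanish.\<close>

lemma lin_kick_sum_square:
  assumes n: "n > 0"
  defines "c \<equiv> (K1 * L)\<^sup>2 * gauss_moment CARD('d) 1"
  shows "(\<lambda>\<omega>. \<Sum>k<m. lin_kick R n k \<omega>) \<in> borel_measurable (F (real m / real n)) \<and>
    integrable P (\<lambda>\<omega>. (\<Sum>k<m. lin_kick R n k \<omega>)\<^sup>2) \<and>
    expectation (\<lambda>\<omega>. (\<Sum>k<m. lin_kick R n k \<omega>)\<^sup>2) \<le> real m * (c * (1 / real n))"
proof (induction m)
  case (Suc m)
  define T where "T \<omega> = (\<Sum>k<m. lin_kick R n k \<omega>)" for \<omega>
  have T: "T \<in> borel_measurable (F (real m / real n))" "integrable P (\<lambda>\<omega>. (T \<omega>)\<^sup>2)"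
    "expectation (\<lambda>\<omega>. (T \<omega>)\<^sup>2) \<le> real m * (c * (1 / real n))"
    using Suc.IH by (auto simp: T_def[abs_def])
  have iT: "integrable P T"
    using square_integrable_imp_integrable[OF F_P[OF T(1)] T(2)] .
  note cross = gaussian_increment.kick_martingale_orthogonal[OF dW_increment[OF n, of m] increment_rules T(1) iT]
  note sq = gaussian_increment.kick_martingale_square[OF dW_increment[OF n, of m] increment_rules]
  have eq: "(\<Sum>k<Suc m. lin_kick R n k \<omega>)\<^sup>2 = (T \<omega>)\<^sup>2 + 2 * (T \<omega> * lin_kick R n m \<omega>) + (lin_kick R n m \<omega>)\<^sup>2" for \<omega>
    by (simp add: T_def power2_sum)
  have int: "integrable P (\<lambda>\<omega>. (\<Sum>k<Suc m. lin_kick R n k \<omega>)\<^sup>2)"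
    unfolding eq by (intro Bochner_Integration.integrable_add integrable_mult_right T(2) cross sq)
  have "expectation (\<lambda>\<omega>. (\<Sum>k<Suc m. lin_kick R n k \<omega>)\<^sup>2)
      = expectation (\<lambda>\<omega>. (T \<omega>)\<^sup>2) + expectation (\<lambda>\<omega>. (lin_kick R n m \<omega>)\<^sup>2)"
    unfolding eq using T(2) cross sq(1) by simp
  also have "\<dots> \<le> real m * (c * (1 / real n)) + c * (1 / real n)"
    unfolding c_def by (intro add_mono T(3)[unfolded c_def] sq(2))
  also have "\<dots> = real (Suc m) * (c * (1 / real n))" by (simp add: distrib_right add_divide_distrib)
  finally have bound: "expectation (\<lambda>\<omega>. (\<Sum>k<Suc m. lin_kick R n k \<omega>)\<^sup>2) \<le> real (Suc m) * (c * (1 / real n))" .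
  have "(\<lambda>\<omega>. \<Sum>k<Suc m. lin_kick R n k \<omega>) \<in> borel_measurable (F (real (Suc m) / real n))"
  proof -
    have "real m / real n \<le> real (Suc m) / real n" by (intro divide_right_mono) auto
    from borel_measurable_add[OF F_mono[OF this T(1)] lin_kick_adapted[OF n]]
    show ?thesis by (simp add: T_def)
  qed
  with int bound show ?case by blast
qed simp

text \<open>The kicks are martingale increments plus remainders. The remainders are summed by
  Cauchy-Schwarz: a factor \<open>n\<close> times \<open>n\<close> terms of order 1 / n^2. The
  resulting bound is independent of \<open>n\<close>, as uniform integrability requires.\<close>

lemma kick_sum_square:
  assumes n: "n > 0"
  shows "integrable P (\<lambda>\<omega>. (\<Sum>k<n. kick R n k \<omega>)\<^sup>2)"
    "expectation (\<lambda>\<omega>. (\<Sum>k<n. kick R n k \<omega>)\<^sup>2) \<le> 2 * ((K1 * L)\<^sup>2 * gauss_moment CARD('d) 1)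
      + 2 * (2 * (K1 * L + K2 * L\<^sup>2)\<^sup>2 * (gauss_moment CARD('d) 2 + gauss_moment CARD('d) 4))"
proof -
  let ?c = "(K1 * L)\<^sup>2 * gauss_moment CARD('d) 1"
  let ?c' = "2 * (K1 * L + K2 * L\<^sup>2)\<^sup>2 * (gauss_moment CARD('d) 2 + gauss_moment CARD('d) 4)"
  have h: "1 / real n \<le> 1" using n by simp
  note rem = gaussian_increment.kick_remainder_square[OF dW_increment[OF n] increment_rules h]
  note lin = lin_kick_sum_square[OF n, of n]
  let ?g = "\<lambda>\<omega>. 2 * (\<Sum>k<n. lin_kick R n k \<omega>)\<^sup>2 + 2 * (real n * (\<Sum>k<n. (kick R n k \<omega> - lin_kick R n k \<omega>)\<^sup>2))"
  have le: "(\<Sum>k<n. kick R n k \<omega>)\<^sup>2 \<le> ?g \<omega>" for \<omega>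
  proof -
    define a where "a = (\<Sum>k<n. lin_kick R n k \<omega>)"
    define b where "b = (\<Sum>k<n. kick R n k \<omega> - lin_kick R n k \<omega>)"
    have "(\<Sum>k<n. kick R n k \<omega>)\<^sup>2 = (a + b)\<^sup>2" by (simp add: a_def b_def sum_subtractf)
    also have "\<dots> \<le> 2 * a\<^sup>2 + 2 * b\<^sup>2" using sum_squares_bound[of a b] by (simp add: power2_sum)
    also have "b\<^sup>2 \<le> real n * (\<Sum>k<n. (kick R n k \<omega> - lin_kick R n k \<omega>)\<^sup>2)"
      using sum_squared_le_sum_of_squares[of "\<lambda>k. kick R n k \<omega> - lin_kick R n k \<omega>" "{..<n}"]
      by (auto simp: b_def mult.commute)
    finally show ?thesis by (simp add: a_def)
  qed
  have ig: "integrable P ?g"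
    using lin rem(1) by (intro Bochner_Integration.integrable_add integrable_mult_right Bochner_Integration.integrable_sum) auto
  have mk: "kick R n k \<in> borel_measurable P" for k
    using gaussian_increment.integrable_kick[OF dW_increment[OF n] increment_rules, of k] by auto
  show int: "integrable P (\<lambda>\<omega>. (\<Sum>k<n. kick R n k \<omega>)\<^sup>2)"
    by (rule Bochner_Integration.integrable_bound[OF ig])
      (use le mk in \<open>auto intro: order_trans[OF _ abs_ge_self]\<close>)
  have "expectation (\<lambda>\<omega>. (\<Sum>k<n. kick R n k \<omega>)\<^sup>2) \<le> expectation ?g"
    by (rule integral_mono[OF int ig le])
  also have "\<dots> = 2 * expectation (\<lambda>\<omega>. (\<Sum>k<n. lin_kick R n k \<omega>)\<^sup>2)
      + 2 * (real n * (\<Sum>k<n. expectation (\<lambda>\<omega>. (kick R n k \<omega> - lin_kick R n k \<omega>)\<^sup>2)))"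
    using lin rem(1) by (simp add: Bochner_Integration.integral_sum)
  also have "\<dots> \<le> 2 * (real n * (?c * (1 / real n))) + 2 * (real n * (\<Sum>k<n. ?c' * (1 / real n)\<^sup>2))"
    using lin rem(2) by (intro add_mono mult_left_mono sum_mono) auto
  also have "\<dots> = 2 * ?c + 2 * ?c'" using n by (simp add: power2_eq_square)
  finally show "expectation (\<lambda>\<omega>. (\<Sum>k<n. kick R n k \<omega>)\<^sup>2) \<le> 2 * ?c + 2 * ?c'" .
qed

end

section \<open>Pathwise limit of the drift sums\<close>

definition "energy_gain R n \<omega> =
  (\<Sum>k<n. stay R n k \<omega> * (f (energy (grid_state n (Suc k) \<omega>)) - f (energy (grid_state n k \<omega>))))"

lemma energy_gain_bound: "\<bar>energy_gain R n \<omega>\<bar> \<le> 2 * K0"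
proof -
  obtain m where "energy_gain R n \<omega> = f (energy (grid_state n m \<omega>)) - f (energy (grid_state n 0 \<omega>))"
    using stopped_telescope[of "\<lambda>k. stay R n k \<omega>" n "\<lambda>k. f (energy (grid_state n k \<omega>))", OF stay_cases stay_Suc]
    by (auto simp: energy_gain_def)
  then show ?thesis
    using K0[of "energy (grid_state n m \<omega>)"] K0[of "energy (grid_state n 0 \<omega>)"] by linarith
qed

lemma energy_gain_measurable[measurable]: "energy_gain R n \<in> borel_measurable P"
  unfolding energy_gain_def[abs_def] by measurable

text \<open>For a fixed path every step has an error of at most \<open>e / 2\<close> times
  \<open>1 / n\<close> as soon as \<open>1 / n\<close> is below a threshold \<open>d\<close> that
  depends on the path; there are \<open>n\<close> steps. \<open>Suc n\<close> excludes the grid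
  without steps.\<close>

lemma drift_defect_tendsto:
  "AE \<omega> in P. (\<lambda>n. energy_gain R (Suc n) \<omega> - (\<Sum>k<Suc n. kick R (Suc n) k \<omega>)
      + (1 / real (Suc n)) * (\<Sum>k<Suc n. stay R (Suc n) k \<omega> * dissipation (grid_state (Suc n) k \<omega>))) \<longlonglongrightarrow> 0"
  using paths equations
proof eventually_elim
  case (elim \<omega>)
  show ?case
  proof (rule LIMSEQ_I)
    fix e :: real assume e: "0 < e"
    have sym: "x \<bullet> (N *v y) = (N *v x) \<bullet> y" for x y
      using N_sym dot_lmul_matrix[of x N y] by (metis transpose_matrix_vector)
    have "\<exists>d>0. \<forall>s t. 0 \<le> s \<and> s \<le> t \<and> t \<le> 1 \<and> t - s < d \<longrightarrow>
      \<bar>f (energy (state t \<omega>)) - f (energy (state s \<omega>) +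
          ((N *v p s \<omega>) \<bullet> (S *v W t \<omega> - S *v W s \<omega>)
            + (S *v W t \<omega> - S *v W s \<omega>) \<bullet> (N *v (S *v W t \<omega> - S *v W s \<omega>)) / 2))
        + (t - s) * (f1 (energy (state s \<omega>)) * (\<gamma> * (norm (N *v p s \<omega>))\<^sup>2))\<bar> \<le> (e / 2) * (t - s)"
      unfolding energy_def state_def fst_conv snd_conv
      by (rule langevin_observable_increment[where N="\<lambda>x. N *v x" and B="\<lambda>t. S *v W t \<omega>" and q="\<lambda>t. q t \<omega>" and p="\<lambda>t. p t \<omega>",
            OF matrix_vector_mul_bounded_linear sym V V' _ _ _ _ f1 f2 K1 K2])
        (use elim e in auto)
    then obtain d where d: "d > 0" "\<And>s t. 0 \<le> s \<Longrightarrow> s \<le> t \<Longrightarrow> t \<le> 1 \<Longrightarrow> t - s < d \<Longrightarrow>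
      \<bar>f (energy (state t \<omega>)) - f (energy (state s \<omega>) +
          ((N *v p s \<omega>) \<bullet> (S *v W t \<omega> - S *v W s \<omega>)
            + (S *v W t \<omega> - S *v W s \<omega>) \<bullet> (N *v (S *v W t \<omega> - S *v W s \<omega>)) / 2))
        + (t - s) * (f1 (energy (state s \<omega>)) * (\<gamma> * (norm (N *v p s \<omega>))\<^sup>2))\<bar> \<le> (e / 2) * (t - s)"
      by blast
    obtain n0 where n0: "1 / real (Suc n0) < d"
      using reals_Archimedean[OF d(1)] by (auto simp: inverse_eq_divide)
    show "\<exists>n0. \<forall>n\<ge>n0. norm (energy_gain R (Suc n) \<omega> - (\<Sum>k<Suc n. kick R (Suc n) k \<omega>)
      + (1 / real (Suc n)) * (\<Sum>k<Suc n. stay R (Suc n) k \<omega> * dissipation (grid_state (Suc n) k \<omega>)) - 0) < e"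
    proof (intro exI[of _ n0] allI impI)
      fix n' assume n': "n0 \<le> n'"
      define n where "n = Suc n'"
      have n: "n > 0" "1 / real n < d"
        using n0 n' frac_le[of 1 1 "real (Suc n0)" "real n"] by (auto simp: n_def)
      \<comment> \<open>The defect of one step without stopping. The stopped sum multiplies it by 0
        or 1, which cannot increase its modulus.\<close>
      define D where "D k = f (energy (grid_state n (Suc k) \<omega>))
          - f (energy (grid_state n k \<omega>) + (linear_noise S (N *v snd (grid_state n k \<omega>)) (dW n k \<omega>)
              + quadratic_noise S N (dW n k \<omega>)))
          + (1 / real n) * dissipation (grid_state n k \<omega>)" for k
      have D: "\<bar>D k\<bar> \<le> (e / 2) * (1 / real n)" if "k < n" for k
      proof -
        have diff: "real (Suc k) / real n - real k / real n = 1 / real n"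
          by (simp add: diff_divide_distrib[symmetric])
        have "real k / real n \<le> real (Suc k) / real n" "real (Suc k) / real n \<le> 1"
          using that n by (auto intro!: divide_right_mono simp: divide_le_eq)
        from d(2)[OF _ this, unfolded diff, OF _ n(2)] show ?thesis
          by (simp add: D_def grid_state_def linear_noise_def quadratic_noise_def dissipation_def dW_def
              matrix_vector_mult_diff_distrib[symmetric] state_def)
      qed
      have eq: "energy_gain R n \<omega> - (\<Sum>k<n. kick R n k \<omega>)
          + (1 / real n) * (\<Sum>k<n. stay R n k \<omega> * dissipation (grid_state n k \<omega>)) = (\<Sum>k<n. stay R n k \<omega> * D k)"
        unfolding energy_gain_def sum_distrib_left sum_subtractf[symmetric] sum.distrib[symmetric]
        by (intro sum.cong refl) (simp add: D_def noise_kick_def algebra_simps)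
      have "\<bar>\<Sum>k<n. stay R n k \<omega> * D k\<bar> \<le> (\<Sum>k<n. \<bar>stay R n k \<omega> * D k\<bar>)" by (rule sum_abs)
      also have "\<dots> \<le> (\<Sum>k<n. (e / 2) * (1 / real n))"
      proof (rule sum_mono)
        fix k assume "k \<in> {..<n}"
        then show "\<bar>stay R n k \<omega> * D k\<bar> \<le> (e / 2) * (1 / real n)"
          using D[of k] stay_cases[of R n k \<omega>] e by auto
      qed
      also have "\<dots> = e / 2" using n by simp
      finally show "norm (energy_gain R (Suc n') \<omega> - (\<Sum>k<Suc n'. kick R (Suc n') k \<omega>)
        + (1 / real (Suc n')) * (\<Sum>k<Suc n'. stay R (Suc n') k \<omega> * dissipation (grid_state (Suc n') k \<omega>)) - 0) < e"
        using e unfolding n_def[symmetric] eq by simp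
    qed
  qed
qed

end

section \<open>The mean drift under the invariant law\<close>

text \<open>Fatou's lemma. It serves twice: for truncations of the drift, and for the limit
  \<epsilon> to 0.\<close>

lemma integrable_limit_of_bounded_integrals:
  fixes u :: "nat \<Rightarrow> 'a \<Rightarrow> real"
  assumes u: "\<And>n. integrable M (u n)" and nonneg: "\<And>n x. 0 \<le> u n x"
    and bound: "\<And>n. (\<integral>x. u n x \<partial>M) \<le> C"
    and lim: "\<And>x. (\<lambda>n. u n x) \<longlonglongrightarrow> v x"
  shows "integrable M v" "(\<integral>x. v x \<partial>M) \<le> C"
proof -
  have v0: "0 \<le> v x" for x
    by (rule LIMSEQ_le_const[OF lim]) (use nonneg in auto)
  have [measurable]: "v \<in> borel_measurable M"
    using borel_measurable_integrable[OF u] lim by (rule borel_measurable_LIMSEQ_real[rotated])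
  have C: "0 \<le> C" using order_trans[OF Bochner_Integration.integral_nonneg[of M "u 0"] bound[of 0]] nonneg by blast
  have "(\<integral>\<^sup>+x. ennreal (v x) \<partial>M) = (\<integral>\<^sup>+x. liminf (\<lambda>n. ennreal (u n x)) \<partial>M)"
    by (intro nn_integral_cong lim_imp_Liminf[symmetric] tendsto_ennrealI lim) simp
  also have "\<dots> \<le> liminf (\<lambda>n. \<integral>\<^sup>+x. ennreal (u n x) \<partial>M)"
    using u by (intro nn_integral_liminf) auto
  also have "\<dots> \<le> liminf (\<lambda>n. ennreal C)"
    using u bound nonneg by (intro Liminf_mono always_eventually allI) (simp add: nn_integral_eq_integral ennreal_leI)
  also have "\<dots> = ennreal C" by (simp add: Liminf_const)
  finally have le: "(\<integral>\<^sup>+x. ennreal (v x) \<partial>M) \<le> ennreal C" .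
  show int: "integrable M v"
    using le v0 by (intro integrableI_nonneg) (auto simp: top.extremum_strict intro: le_less_trans)
  show "(\<integral>x. v x \<partial>M) \<le> C"
    using le v0 C int by (subst (asm) nn_integral_eq_integral) auto
qed

context stationary_langevin
begin

text \<open>The path stays in the ball at all rational times of [0, 1]. These are countably many
  conditions, so the set is an event, and on it no grid ever stops.\<close>

definition "confined R = {\<omega> \<in> space P. \<forall>n. \<forall>k. norm (grid_state n k \<omega>) \<le> R \<or> k > n}"

lemma confined_events[measurable]: "confined R \<in> events"
  unfolding confined_def by measurable

lemma stay_confined: "\<omega> \<in> confined R \<Longrightarrow> k \<le> n \<Longrightarrow> stay R n k \<omega> = 1"
  unfolding confined_def stay_def by (auto simp: not_less) (metis le_trans not_less)

text \<open>A continuous path is bounded on [0, 1], so the increasing events exhaust the space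
  almost surely.\<close>

lemma prob_confined: "(\<lambda>m. prob (confined (real m))) \<longlonglongrightarrow> 1"
proof -
  have "(\<lambda>m. prob (confined (real m))) \<longlonglongrightarrow> prob (\<Union>m. confined (real m))"
  proof (rule finite_Lim_measure_incseq)
    show "incseq (\<lambda>m. confined (real m))"
      by (rule incseq_SucI) (force simp: confined_def)
  qed auto
  also have "prob (\<Union>m. confined (real m)) = 1"
  proof (subst prob_eq_1)
    show "AE \<omega> in P. \<omega> \<in> (\<Union>m. confined (real m))"
      using paths AE_space
    proof eventually_elim
      case (elim \<omega>)
      have "continuous_on {0..1} (\<lambda>t. state t \<omega>)"
        using elim(1) unfolding state_def by (intro continuous_on_Pair) (auto elim: continuous_on_subset)
      from continuous_on_norm_bound[OF this]
      obtain K where K: "\<And>t. t \<in> {0..1} \<Longrightarrow> norm (state t \<omega>) \<le> K" by metis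
      obtain m where m: "K \<le> real m" using real_arch_simple by blast
      have "norm (grid_state n k \<omega>) \<le> real m" if "k \<le> n" for n k
        unfolding grid_state_def using that
        by (intro order_trans[OF K m]) (auto simp: divide_le_eq)
      then have "\<omega> \<in> confined (real m)"
        using elim(2) by (auto simp: confined_def not_less)
      then show ?case by blast
    qed
  qed auto
  finally show ?thesis .
qed

lemma grid_state_distr:
  assumes "g \<in> borel_measurable borel"
  shows "expectation (\<lambda>\<omega>. g (grid_state n k \<omega>)) = (\<integral>x. g x \<partial>\<pi>)"
    "integrable P (\<lambda>\<omega>. g (grid_state n k \<omega>)) \<longleftrightarrow> integrable \<pi> (g :: _ \<Rightarrow> real)"
proof -
  have eq: "\<pi> = distr P borel (grid_state n k)"
    using stationary[of "real k / real n"] by (simp add: grid_state_def[abs_def] state_def)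
  show "expectation (\<lambda>\<omega>. g (grid_state n k \<omega>)) = (\<integral>x. g x \<partial>\<pi>)"
    "integrable P (\<lambda>\<omega>. g (grid_state n k \<omega>)) \<longleftrightarrow> integrable \<pi> g"
    unfolding eq using assms by (auto simp: integral_distr integrable_distr_eq)
qed

lemma sets_pi: "sets \<pi> = sets borel"
  using stationary[of 0] by auto

lemma prob_space_pi: "prob_space \<pi>"
  unfolding stationary[of 0, symmetric, simplified]
  by (rule prob_space_distr) (use state_measurable[of 0] in \<open>simp add: state_def[abs_def]\<close>)

lemma integrable_not_confined: "integrable P (\<lambda>\<omega>. indicator (space P - confined R) \<omega> :: real)"
  by (rule integrable_const_bound[of _ 1]) (auto intro!: AE_I2 simp: indicator_def)

lemma expectation_not_stay:
  assumes "k \<le> n"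
  shows "expectation (\<lambda>\<omega>. 1 - stay R n k \<omega>) \<le> 1 - prob (confined R)"
    "integrable P (\<lambda>\<omega>. 1 - stay R n k \<omega>)"
proof -
  show int: "integrable P (\<lambda>\<omega>. 1 - stay R n k \<omega>)"
    by (rule integrable_const_bound[of _ 1]) (auto intro!: AE_I2 simp: stay_def)
  have "expectation (\<lambda>\<omega>. 1 - stay R n k \<omega>) \<le> expectation (indicator (space P - confined R))"
  proof (rule integral_mono[OF int integrable_not_confined])
    fix \<omega> assume "\<omega> \<in> space P"
    then show "1 - stay R n k \<omega> \<le> indicator (space P - confined R) \<omega>"
      using stay_confined[OF _ assms, of \<omega> R] stay_cases[of R n k \<omega>] by (auto simp: indicator_def)
  qed
  also have "\<dots> = 1 - prob (confined R)" by (simp add: prob_compl)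
  finally show "expectation (\<lambda>\<omega>. 1 - stay R n k \<omega>) \<le> 1 - prob (confined R)" .
qed

text \<open>Without stopping the sum telescopes to a difference of two variables with the same law,
  so its mean is 0. Stopping changes the sum only outside \<open>confined R\<close>, where both
  versions are bounded by \<open>2 * K0\<close>.\<close>

lemma expectation_energy_gain:
  assumes "n > 0"
  shows "\<bar>expectation (energy_gain R n)\<bar> \<le> 4 * K0 * (1 - prob (confined R))"
proof -
  let ?f = "\<lambda>k \<omega>. f (energy (grid_state n k \<omega>))"
  let ?Y = "\<lambda>\<omega>. energy_gain R n \<omega> - (?f n \<omega> - ?f 0 \<omega>)"
  have i: "integrable P (?f k)" for k
    by (rule integrable_const_bound[of _ K0]) (auto simp: K0)
  have ig: "integrable P (energy_gain R n)"
    by (rule integrable_const_bound[of _ "2 * K0"]) (auto simp: energy_gain_bound)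
  have "expectation (?f n) = expectation (?f 0)"
    using grid_state_distr(1)[of "\<lambda>x. f (energy x)" n n] grid_state_distr(1)[of "\<lambda>x. f (energy x)" n 0] by simp
  then have eq: "expectation (energy_gain R n) = expectation ?Y" using i ig by simp
  have "\<bar>expectation ?Y\<bar> \<le> expectation (\<lambda>\<omega>. \<bar>?Y \<omega>\<bar>)" by (rule integral_abs_bound)
  also have "\<dots> \<le> expectation (\<lambda>\<omega>. 4 * K0 * indicator (space P - confined R) \<omega>)"
  proof (rule integral_mono)
    show "integrable P (\<lambda>\<omega>. \<bar>?Y \<omega>\<bar>)"
      by (intro integrable_abs Bochner_Integration.integrable_diff i ig)
    show "integrable P (\<lambda>\<omega>. 4 * K0 * indicator (space P - confined R) \<omega>)"
      by (intro integrable_mult_right integrable_not_confined)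
    fix \<omega> assume \<omega>: "\<omega> \<in> space P"
    show "\<bar>?Y \<omega>\<bar> \<le> 4 * K0 * indicator (space P - confined R) \<omega>"
    proof (cases "\<omega> \<in> confined R")
      case True
      have "energy_gain R n \<omega> = (\<Sum>k<n. ?f (Suc k) \<omega> - ?f k \<omega>)"
        unfolding energy_gain_def by (intro sum.cong refl) (simp add: stay_confined[OF True])
      then show ?thesis using True by (simp add: sum_lessThan_telescope[of "\<lambda>k. ?f k \<omega>"])
    next
      case False
      then show ?thesis
        using \<omega> energy_gain_bound[of R n \<omega>] K0[of "energy (grid_state n n \<omega>)"] K0[of "energy (grid_state n 0 \<omega>)"]
        by simp
    qed
  qed
  also have "\<dots> = 4 * K0 * (1 - prob (confined R))"
    by (simp add: prob_compl)
  finally show ?thesis unfolding eq .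
qed

lemma integrable_stay_drift:
  "integrable P (\<lambda>\<omega>. stay R n k \<omega> * (dissipation (grid_state n k \<omega>) - injection (grid_state n k \<omega>)))"
proof -
  obtain L where L: "0 \<le> L"
    "\<And>v x. norm v \<le> R \<Longrightarrow> \<bar>(N *v v) \<bullet> (S *v x)\<bar> \<le> L * norm x"
    "\<And>x. \<bar>(S *v x) \<bullet> (N *v (S *v x)) / 2\<bar> \<le> L * (norm x)\<^sup>2"
    "\<And>v. norm v \<le> R \<Longrightarrow> norm (N *v v) \<le> L"
    using noise_bound_exists by metis
  show ?thesis
    using Bochner_Integration.integrable_diff[OF integrable_stay_dissipation[OF L] integrable_stay_injection[OF L]]
    by (simp add: right_diff_distrib)
qed

text \<open>The defect \<open>Y\<close> tends to 0 almost surely and is bounded in mean square, so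
  its mean tends to 0. The mean gain is small by stationarity, and the mean kicks equal the averaged
  injection up to order \<open>sqrt (1 / n)\<close>. Comparing the three leaves dissipation against
  injection.\<close>

lemma discrete_balance:
  assumes e: "0 < e"
  shows "\<exists>n>0. \<bar>(1 / real n) * (\<Sum>k<n. expectation (\<lambda>\<omega>. stay R n k \<omega> *
      (dissipation (grid_state n k \<omega>) - injection (grid_state n k \<omega>))))\<bar> \<le> 4 * K0 * (1 - prob (confined R)) + e"
proof -
  obtain L where L: "0 \<le> L"
    "\<And>v x. norm v \<le> R \<Longrightarrow> \<bar>(N *v v) \<bullet> (S *v x)\<bar> \<le> L * norm x"
    "\<And>x. \<bar>(S *v x) \<bullet> (N *v (S *v x)) / 2\<bar> \<le> L * (norm x)\<^sup>2"
    "\<And>v. norm v \<le> R \<Longrightarrow> norm (N *v v) \<le> L"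
    using noise_bound_exists by metis
  note rules = increment_rules[OF L]
  note i_diss = integrable_stay_dissipation[OF L]
  note i_inj = integrable_stay_injection[OF L]
  define T where "T n \<omega> = (\<Sum>k<n. kick R n k \<omega>)" for n \<omega>
  define D where "D n \<omega> = (1 / real n) * (\<Sum>k<n. stay R n k \<omega> * dissipation (grid_state n k \<omega>))" for n \<omega>
  define Y where "Y n \<omega> = energy_gain R n \<omega> - T n \<omega> + D n \<omega>" for n \<omega>
  define CT where "CT = 2 * ((K1 * L)\<^sup>2 * gauss_moment CARD('d) 1)
      + 2 * (2 * (K1 * L + K2 * L\<^sup>2)\<^sup>2 * (gauss_moment CARD('d) 2 + gauss_moment CARD('d) 4))"
  define CD where "CD = K1 * (\<bar>\<gamma>\<bar> * L\<^sup>2)"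
  \<comment> \<open>Each 3 comes from bounding the square of a sum of three terms by three times the
    sum of their squares.\<close>
  define C where "C = 3 * (2 * K0)\<^sup>2 + 3 * CT + 3 * CD\<^sup>2"
  have i_kick: "integrable P (kick R n k)" if "n > 0" for n k
    using gaussian_increment.integrable_kick[OF dW_increment[OF that] rules] .
  have i_T: "integrable P (T n)" if "n > 0" for n
    unfolding T_def[abs_def] using i_kick[OF that] by auto
  have i_D: "integrable P (D n)" for n
    unfolding D_def[abs_def] using i_diss by auto
  have i_E: "integrable P (energy_gain R n)" for n
    by (rule integrable_const_bound[of _ "2 * K0"]) (auto simp: energy_gain_bound)
  have D_bound: "\<bar>D n \<omega>\<bar> \<le> CD" if "n > 0" for n \<omega>
  proof -
    have "\<bar>\<Sum>k<n. stay R n k \<omega> * dissipation (grid_state n k \<omega>)\<bar> \<le> (\<Sum>k<n. CD)"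
      unfolding CD_def by (intro order_trans[OF sum_abs] sum_mono stay_dissipation_bound[OF L])
    then show ?thesis using that by (simp add: D_def abs_mult field_simps)
  qed
  have T2: "integrable P (\<lambda>\<omega>. (T n \<omega>)\<^sup>2)" "expectation (\<lambda>\<omega>. (T n \<omega>)\<^sup>2) \<le> CT" if "n > 0" for n
    unfolding T_def CT_def using kick_sum_square[OF L that] by auto
  have i_Y: "integrable P (Y n)" if "n > 0" for n
    unfolding Y_def[abs_def] by (intro Bochner_Integration.integrable_add Bochner_Integration.integrable_diff i_E i_T i_D that)
  have Y2_le: "(Y n \<omega>)\<^sup>2 \<le> 3 * (2 * K0)\<^sup>2 + 3 * (T n \<omega>)\<^sup>2 + 3 * CD\<^sup>2" if "n > 0" for n \<omega>
  proof -
    have three: "(a - b + c)\<^sup>2 \<le> 3 * a\<^sup>2 + 3 * b\<^sup>2 + 3 * c\<^sup>2" for a b c :: real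
    proof -
      have "0 \<le> (a + b)\<^sup>2 + (a - c)\<^sup>2 + (b + c)\<^sup>2" by simp
      then show ?thesis by (simp add: power2_eq_square algebra_simps)
    qed
    have "(energy_gain R n \<omega>)\<^sup>2 \<le> (2 * K0)\<^sup>2" "(D n \<omega>)\<^sup>2 \<le> CD\<^sup>2"
      using power_mono[OF energy_gain_bound[of R n \<omega>], of 2] power_mono[OF D_bound[OF that, of \<omega>], of 2] by auto
    with three[of "energy_gain R n \<omega>" "T n \<omega>" "D n \<omega>"] show ?thesis unfolding Y_def by linarith
  qed
  have Y2: "integrable P (\<lambda>\<omega>. (Y n \<omega>)\<^sup>2)" "expectation (\<lambda>\<omega>. (Y n \<omega>)\<^sup>2) \<le> C" if "n > 0" for n
  proof -
    have ig: "integrable P (\<lambda>\<omega>. 3 * (2 * K0)\<^sup>2 + 3 * (T n \<omega>)\<^sup>2 + 3 * CD\<^sup>2)"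
      using T2(1)[OF that] by auto
    show 1: "integrable P (\<lambda>\<omega>. (Y n \<omega>)\<^sup>2)"
    proof (rule Bochner_Integration.integrable_bound[OF ig])
      show "(\<lambda>\<omega>. (Y n \<omega>)\<^sup>2) \<in> borel_measurable P"
        using borel_measurable_integrable[OF i_Y[OF that]] by measurable
      show "AE \<omega> in P. norm ((Y n \<omega>)\<^sup>2) \<le> norm (3 * (2 * K0)\<^sup>2 + 3 * (T n \<omega>)\<^sup>2 + 3 * CD\<^sup>2)"
        using Y2_le[OF that] by (auto intro!: AE_I2 order_trans[OF _ abs_ge_self])
    qed
    have "expectation (\<lambda>\<omega>. (Y n \<omega>)\<^sup>2) \<le> expectation (\<lambda>\<omega>. 3 * (2 * K0)\<^sup>2 + 3 * (T n \<omega>)\<^sup>2 + 3 * CD\<^sup>2)"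
      by (rule integral_mono[OF 1 ig Y2_le[OF that]])
    also have "\<dots> = 3 * (2 * K0)\<^sup>2 + 3 * expectation (\<lambda>\<omega>. (T n \<omega>)\<^sup>2) + 3 * CD\<^sup>2"
      using T2(1)[OF that] by (simp add: prob_space)
    also have "\<dots> \<le> C" using T2(2)[OF that] by (simp add: C_def)
    finally show "expectation (\<lambda>\<omega>. (Y n \<omega>)\<^sup>2) \<le> C" .
  qed
  have "(\<lambda>n. expectation (Y (Suc n))) \<longlonglongrightarrow> 0"
  proof (rule expectation_tendsto_zero_of_L2_bounded)
    show "Y (Suc n) \<in> borel_measurable P" for n using i_Y[of "Suc n"] by auto
    show "AE \<omega> in P. (\<lambda>n. Y (Suc n) \<omega>) \<longlonglongrightarrow> 0"
      unfolding Y_def T_def D_def by (rule drift_defect_tendsto)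
    show "integrable P (\<lambda>\<omega>. (Y (Suc n) \<omega>)\<^sup>2)" "expectation (\<lambda>\<omega>. (Y (Suc n) \<omega>)\<^sup>2) \<le> C" for n
      using Y2[of "Suc n"] by auto
  qed
  then have ev1: "eventually (\<lambda>n. \<bar>expectation (Y (Suc n))\<bar> < e / 2) sequentially"
    using e by (auto simp: tendsto_iff dist_real_def dest: spec[of _ "e / 2"])
  define c where "c = (2 * K3 * L ^ 3 + 2 * K2 * L\<^sup>2)
      * (gauss_moment CARD('d) 1 + gauss_moment CARD('d) 2 + gauss_moment CARD('d) 3)"
  have "(\<lambda>n. c * sqrt (1 / real (Suc n))) \<longlonglongrightarrow> c * sqrt 0"
    by (intro tendsto_intros LIMSEQ_inverse_real_of_nat[unfolded inverse_eq_divide])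
  then have ev2: "eventually (\<lambda>n. c * sqrt (1 / real (Suc n)) < e / 2) sequentially"
    using e by (intro order_tendstoD) auto
  from eventually_conj[OF ev1 ev2] obtain n' where
    n': "\<bar>expectation (Y (Suc n'))\<bar> < e / 2" "c * sqrt (1 / real (Suc n')) < e / 2"
    by (auto simp: eventually_sequentially)
  define n where "n = Suc n'"
  have n: "n > 0" "\<bar>expectation (Y n)\<bar> < e / 2" "c * sqrt (1 / real n) < e / 2"
    using n' by (auto simp: n_def)
  have h: "1 / real n \<le> 1" using n by simp
  let ?d = "\<lambda>k. expectation (\<lambda>\<omega>. stay R n k \<omega> * dissipation (grid_state n k \<omega>))"
  let ?i = "\<lambda>k. expectation (\<lambda>\<omega>. stay R n k \<omega> * injection (grid_state n k \<omega>))"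
  let ?b = "\<lambda>k. expectation (\<lambda>\<omega>. stay R n k \<omega> * (dissipation (grid_state n k \<omega>) - injection (grid_state n k \<omega>)))"
  have b: "?b k = ?d k - ?i k" for k
    using i_diss i_inj by (simp add: right_diff_distrib)
  have EY: "expectation (Y n) = expectation (energy_gain R n) - (\<Sum>k<n. expectation (kick R n k)) + (1 / real n) * (\<Sum>k<n. ?d k)"
  proof -
    have "expectation (Y n) = expectation (energy_gain R n) - expectation (T n) + expectation (D n)"
      unfolding Y_def[abs_def] using i_E i_T[OF n(1)] i_D by simp
    also have "expectation (T n) = (\<Sum>k<n. expectation (kick R n k))"
      unfolding T_def[abs_def] using i_kick[OF n(1)] by (simp add: Bochner_Integration.integral_sum)
    also have "expectation (D n) = (1 / real n) * (\<Sum>k<n. ?d k)"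
      unfolding D_def[abs_def] using i_diss by (simp add: Bochner_Integration.integral_sum)
    finally show ?thesis .
  qed
  have km: "\<bar>expectation (kick R n k) - 1 / real n * ?i k\<bar> \<le> c * (1 / real n * sqrt (1 / real n))" for k
    using gaussian_increment.kick_mean[OF dW_increment[OF n(1), of k] rules h]
    unfolding injection_def c_def .
  have "\<bar>(\<Sum>k<n. expectation (kick R n k)) - (1 / real n) * (\<Sum>k<n. ?i k)\<bar>
      = \<bar>\<Sum>k<n. expectation (kick R n k) - 1 / real n * ?i k\<bar>"
    by (simp add: sum_subtractf sum_distrib_left)
  also have "\<dots> \<le> (\<Sum>k<n. c * (1 / real n * sqrt (1 / real n)))"
    by (intro order_trans[OF sum_abs] sum_mono km)
  also have "\<dots> = c * sqrt (1 / real n)" using n(1) by simp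
  finally have sum_km: "\<bar>(\<Sum>k<n. expectation (kick R n k)) - (1 / real n) * (\<Sum>k<n. ?i k)\<bar> \<le> c * sqrt (1 / real n)" .
  have "(1 / real n) * (\<Sum>k<n. ?b k) = (1 / real n) * (\<Sum>k<n. ?d k) - (1 / real n) * (\<Sum>k<n. ?i k)"
    unfolding b sum_subtractf by (rule right_diff_distrib)
  then have "\<bar>(1 / real n) * (\<Sum>k<n. ?b k)\<bar> \<le> 4 * K0 * (1 - prob (confined R)) + e"
    using EY sum_km n expectation_energy_gain[OF n(1), of R] by linarith
  then show ?thesis using n(1) by blast
qed

text \<open>The argument has two passes. The lower bound makes truncations from above bounded; their
  means are at most 0 in the limit of large radius, and Fatou yields integrability. Only then can
  the tails be controlled, which gives the exact value of the mean.\<close>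

lemma invariant_mean_drift:
  assumes lower: "\<And>x. - K \<le> dissipation x - injection x"
  shows "integrable \<pi> (\<lambda>x. dissipation x - injection x)" "(\<integral>x. dissipation x - injection x \<partial>\<pi>) = 0"
proof -
  interpret pi: prob_space \<pi> by (rule prob_space_pi)
  define \<psi> where "\<psi> x = dissipation x - injection x" for x
  define \<delta> where "\<delta> R = 1 - prob (confined R)" for R
  note [measurable_cong] = sets_pi
  have \<psi>m[measurable]: "\<psi> \<in> borel_measurable borel" unfolding \<psi>_def[abs_def] by measurable
  have \<delta>0: "0 \<le> \<delta> R" for R by (simp add: \<delta>_def)
  have \<delta>_lim: "(\<lambda>m. \<delta> (real m)) \<longlonglongrightarrow> 0"
    unfolding \<delta>_def using tendsto_diff[OF tendsto_const[of 1] prob_confined] by simp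
  define K' where "K' = \<bar>K\<bar>"
  have K': "0 \<le> K'" "- K' \<le> \<psi> x" for x using lower[of x] by (auto simp: K'_def \<psi>_def)
  have i_stay: "integrable P (\<lambda>\<omega>. stay R n k \<omega> * \<psi> (grid_state n k \<omega>))" for R n k
    unfolding \<psi>_def by (rule integrable_stay_drift)
  have average: "\<exists>n>0. \<bar>(1 / real n) * (\<Sum>k<n. expectation (\<lambda>\<omega>. stay R n k \<omega> * \<psi> (grid_state n k \<omega>)))\<bar>
      \<le> 4 * K0 * \<delta> R + e" if "0 < e" for R e
    unfolding \<psi>_def \<delta>_def using discrete_balance[OF that] .
  have i_min: "integrable \<pi> (\<lambda>x. min (\<psi> x) (real m))" for m
  proof (rule pi.integrable_const_bound[of _ "K' + real m"])
    show "AE x in \<pi>. norm (min (\<psi> x) (real m)) \<le> K' + real m"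
    proof (rule AE_I2)
      show "norm (min (\<psi> x) (real m)) \<le> K' + real m" for x
        using K'(1) K'(2)[of x] by (auto simp: min_def abs_le_iff)
    qed
  qed measurable
  have min_le: "(\<integral>x. min (\<psi> x) (real m) \<partial>\<pi>) \<le> 0" for m
  proof -
    define g where "g x = min (\<psi> x) (real m)" for x
    define B where "B = K' + real m"
    have g: "\<bar>g x\<bar> \<le> B" "g x \<le> \<psi> x" for x
      using K'(1) K'(2)[of x] by (auto simp: g_def B_def min_def)
    have [measurable]: "g \<in> borel_measurable borel" unfolding g_def[abs_def] by measurable
    have B: "0 \<le> B" using K' by (simp add: B_def)
    have i_g: "integrable P (\<lambda>\<omega>. g (grid_state n k \<omega>))" for n k
      by (rule integrable_const_bound[of _ B]) (auto simp: g)
    \<comment> \<open>While the path has not been stopped, \<open>g\<close> lies below the drift;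
      once stopped, \<open>g \<le> B\<close> is paid for by the probability of having been
      stopped.\<close>
    have step: "(\<integral>x. g x \<partial>\<pi>) - B * \<delta> R \<le> expectation (\<lambda>\<omega>. stay R n k \<omega> * \<psi> (grid_state n k \<omega>))"
      if "k \<le> n" for R n k
    proof -
      have "(\<integral>x. g x \<partial>\<pi>) - B * \<delta> R
          \<le> expectation (\<lambda>\<omega>. g (grid_state n k \<omega>)) - B * expectation (\<lambda>\<omega>. 1 - stay R n k \<omega>)"
        using grid_state_distr(1)[of g n k] mult_left_mono[OF expectation_not_stay(1)[OF that, of R] B]
        by (simp add: \<delta>_def)
      also have "\<dots> = expectation (\<lambda>\<omega>. g (grid_state n k \<omega>) - B * (1 - stay R n k \<omega>))"
        using i_g expectation_not_stay(2)[OF that, of R]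
        by (subst Bochner_Integration.integral_diff) auto
      also have "\<dots> \<le> expectation (\<lambda>\<omega>. stay R n k \<omega> * \<psi> (grid_state n k \<omega>))"
      proof (rule integral_mono[OF _ i_stay])
        show "integrable P (\<lambda>\<omega>. g (grid_state n k \<omega>) - B * (1 - stay R n k \<omega>))"
          by (intro Bochner_Integration.integrable_diff integrable_mult_right i_g expectation_not_stay(2) that)
        fix \<omega>
        show "g (grid_state n k \<omega>) - B * (1 - stay R n k \<omega>) \<le> stay R n k \<omega> * \<psi> (grid_state n k \<omega>)"
          using stay_cases[of R n k \<omega>] g[of "grid_state n k \<omega>"] by auto
      qed
      finally show ?thesis .
    qed
    have le: "(\<integral>x. g x \<partial>\<pi>) \<le> (B + 4 * K0) * \<delta> R + e" if e: "0 < e" for R e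
    proof -
      obtain n where n: "n > 0" "\<bar>(1 / real n) * (\<Sum>k<n. expectation (\<lambda>\<omega>. stay R n k \<omega> * \<psi> (grid_state n k \<omega>)))\<bar>
          \<le> 4 * K0 * \<delta> R + e"
        using average[OF e] by blast
      have "(\<integral>x. g x \<partial>\<pi>) - B * \<delta> R = (1 / real n) * (\<Sum>k<n. (\<integral>x. g x \<partial>\<pi>) - B * \<delta> R)"
        using n(1) by simp
      also have "\<dots> \<le> (1 / real n) * (\<Sum>k<n. expectation (\<lambda>\<omega>. stay R n k \<omega> * \<psi> (grid_state n k \<omega>)))"
        by (intro mult_left_mono sum_mono step) auto
      finally show ?thesis using n(2) unfolding distrib_right by linarith
    qed
    \<comment> \<open>\<open>B\<close> depends on the truncation level but not on the radius, so the
      radius can tend to infinity first.\<close>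
    have "(\<integral>x. g x \<partial>\<pi>) \<le> e" if "0 < e" for e
    proof -
      have "(\<lambda>j. (B + 4 * K0) * \<delta> (real j) + e) \<longlonglongrightarrow> (B + 4 * K0) * 0 + e"
        by (intro tendsto_intros \<delta>_lim)
      then show ?thesis
        using LIMSEQ_le_const[of _ _ "\<integral>x. g x \<partial>\<pi>"] le[OF that] by fastforce
    qed
    then show ?thesis unfolding g_def by (rule field_le_epsilon) simp
  qed
  have "integrable \<pi> (\<lambda>x. \<psi> x + K')"
  proof (rule integrable_limit_of_bounded_integrals(1))
    show "integrable \<pi> (\<lambda>x. min (\<psi> x) (real m) + K')" for m using i_min by auto
    show "(\<integral>x. min (\<psi> x) (real m) + K' \<partial>\<pi>) \<le> K'" for m
      using i_min min_le[of m] by (simp add: pi.prob_space)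
    show "0 \<le> min (\<psi> x) (real m) + K'" for m x
      using K'(1) K'(2)[of x] by (auto simp: min_def)
    show "(\<lambda>m. min (\<psi> x) (real m) + K') \<longlonglongrightarrow> \<psi> x + K'" for x
    proof (rule tendsto_eventually)
      obtain m0 where "\<psi> x \<le> real m0" using real_arch_simple by blast
      then have "min (\<psi> x) (real m) + K' = \<psi> x + K'" if "m0 \<le> m" for m
        using that by (simp add: min_absorb1 order_trans[of _ "real m0"])
      then show "\<forall>\<^sub>F m in sequentially. min (\<psi> x) (real m) + K' = \<psi> x + K'"
        by (rule eventually_sequentiallyI)
    qed
  qed
  then have "integrable \<pi> (\<lambda>x. (\<psi> x + K') - K')" by (intro Bochner_Integration.integrable_diff) auto
  then have i_\<psi>: "integrable \<pi> \<psi>" by simp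
  have i_grid: "integrable P (\<lambda>\<omega>. \<psi> (grid_state n k \<omega>))" for n k
    using i_\<psi> grid_state_distr(2)[OF \<psi>m] by blast
  \<comment> \<open>The tail beyond level \<open>m\<close>. Since |y| \<le> m + max (|y| - m) 0, the
    stopped part costs at most \<open>m\<close> times its probability plus \<open>\<tau> m\<close>.
    The radius tends to infinity for fixed \<open>m\<close>, then \<open>m\<close> does.\<close>
  define \<tau> where "\<tau> m = (\<integral>x. max (\<bar>\<psi> x\<bar> - real m) 0 \<partial>\<pi>)" for m
  have i_max: "integrable \<pi> (\<lambda>x. max (\<bar>\<psi> x\<bar> - real m) 0)" for m
    using i_\<psi> by (intro integrable_max) auto
  have \<tau>_lim: "\<tau> \<longlonglongrightarrow> 0"
  proof -
    have "(\<lambda>m. \<integral>x. max (\<bar>\<psi> x\<bar> - real m) 0 \<partial>\<pi>) \<longlonglongrightarrow> (\<integral>x. 0 \<partial>\<pi>)"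
    proof (rule integral_dominated_convergence[where w="\<lambda>x. \<bar>\<psi> x\<bar>"])
      show "AE x in \<pi>. (\<lambda>m. max (\<bar>\<psi> x\<bar> - real m) 0) \<longlonglongrightarrow> 0"
      proof (intro AE_I2 tendsto_eventually)
        fix x
        obtain m0 where "\<bar>\<psi> x\<bar> \<le> real m0" using real_arch_simple by blast
        then have "max (\<bar>\<psi> x\<bar> - real m) 0 = 0" if "m0 \<le> m" for m
          using that by (simp add: max_absorb2 order_trans[of _ "real m0"])
        then show "\<forall>\<^sub>F m in sequentially. max (\<bar>\<psi> x\<bar> - real m) 0 = 0"
          by (rule eventually_sequentiallyI)
      qed
    qed (use i_\<psi> in \<open>auto intro!: AE_I2\<close>)
    then show ?thesis by (simp add: \<tau>_def[abs_def])
  qed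
  have "\<bar>\<integral>x. \<psi> x \<partial>\<pi>\<bar> \<le> (real m + 4 * K0) * \<delta> R + \<tau> m + e" if e: "0 < e" for R e m
  proof -
    have step: "\<bar>(\<integral>x. \<psi> x \<partial>\<pi>) - expectation (\<lambda>\<omega>. stay R n k \<omega> * \<psi> (grid_state n k \<omega>))\<bar> \<le> real m * \<delta> R + \<tau> m"
      if "k \<le> n" for n k
    proof -
      have "(\<integral>x. \<psi> x \<partial>\<pi>) - expectation (\<lambda>\<omega>. stay R n k \<omega> * \<psi> (grid_state n k \<omega>))
          = expectation (\<lambda>\<omega>. \<psi> (grid_state n k \<omega>) - stay R n k \<omega> * \<psi> (grid_state n k \<omega>))"
        using i_grid i_stay grid_state_distr(1)[OF \<psi>m, of n k] by simp
      also have "\<bar>\<dots>\<bar> \<le> expectation (\<lambda>\<omega>. \<bar>\<psi> (grid_state n k \<omega>) - stay R n k \<omega> * \<psi> (grid_state n k \<omega>)\<bar>)"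
        by (rule integral_abs_bound)
      also have "\<dots> \<le> expectation (\<lambda>\<omega>. real m * (1 - stay R n k \<omega>) + max (\<bar>\<psi> (grid_state n k \<omega>)\<bar> - real m) 0)"
      proof (rule integral_mono)
        show "integrable P (\<lambda>\<omega>. \<bar>\<psi> (grid_state n k \<omega>) - stay R n k \<omega> * \<psi> (grid_state n k \<omega>)\<bar>)"
          by (intro integrable_abs Bochner_Integration.integrable_diff i_grid i_stay)
        show "integrable P (\<lambda>\<omega>. real m * (1 - stay R n k \<omega>) + max (\<bar>\<psi> (grid_state n k \<omega>)\<bar> - real m) 0)"
          by (intro Bochner_Integration.integrable_add integrable_mult_right expectation_not_stay(2) that
              integrable_max Bochner_Integration.integrable_diff integrable_abs i_grid) auto
        fix \<omega>
        show "\<bar>\<psi> (grid_state n k \<omega>) - stay R n k \<omega> * \<psi> (grid_state n k \<omega>)\<bar>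
            \<le> real m * (1 - stay R n k \<omega>) + max (\<bar>\<psi> (grid_state n k \<omega>)\<bar> - real m) 0"
          using stay_cases[of R n k \<omega>] by (auto simp: max_def)
      qed
      also have "\<dots> = real m * expectation (\<lambda>\<omega>. 1 - stay R n k \<omega>)
          + expectation (\<lambda>\<omega>. max (\<bar>\<psi> (grid_state n k \<omega>)\<bar> - real m) 0)"
      proof -
        have "integrable P (\<lambda>\<omega>. max (\<bar>\<psi> (grid_state n k \<omega>)\<bar> - real m) 0)"
          using i_max grid_state_distr(2)[of "\<lambda>x. max (\<bar>\<psi> x\<bar> - real m) 0" n k] by simp
        then show ?thesis
          using expectation_not_stay(2)[OF that, of R]
          by (subst Bochner_Integration.integral_add) (auto intro!: integrable_mult_right)
      qed
      also have "\<dots> \<le> real m * \<delta> R + \<tau> m"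
        using mult_left_mono[OF expectation_not_stay(1)[OF that, of R], of "real m"]
          grid_state_distr(1)[of "\<lambda>x. max (\<bar>\<psi> x\<bar> - real m) 0" n k]
        by (simp add: \<delta>_def \<tau>_def)
      finally show ?thesis .
    qed
    obtain n where n: "n > 0" "\<bar>(1 / real n) * (\<Sum>k<n. expectation (\<lambda>\<omega>. stay R n k \<omega> * \<psi> (grid_state n k \<omega>)))\<bar>
        \<le> 4 * K0 * \<delta> R + e"
      using average[OF e] by blast
    let ?E = "\<lambda>k. expectation (\<lambda>\<omega>. stay R n k \<omega> * \<psi> (grid_state n k \<omega>))"
    have "(\<integral>x. \<psi> x \<partial>\<pi>) - (1 / real n) * (\<Sum>k<n. ?E k) = (1 / real n) * (\<Sum>k<n. (\<integral>x. \<psi> x \<partial>\<pi>) - ?E k)"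
      using n(1) by (simp add: sum_subtractf diff_divide_distrib)
    also have "\<bar>\<dots>\<bar> \<le> (1 / real n) * (\<Sum>k<n. real m * \<delta> R + \<tau> m)"
      unfolding abs_mult by (intro mult_mono order_trans[OF sum_abs] sum_mono step) auto
    also have "\<dots> = real m * \<delta> R + \<tau> m" using n(1) by simp
    finally show ?thesis using n(2) unfolding distrib_right by linarith
  qed
  then have le1: "\<bar>\<integral>x. \<psi> x \<partial>\<pi>\<bar> \<le> (real m + 4 * K0) * \<delta> R + \<tau> m" for R m
    by (rule field_le_epsilon) simp
  have le2: "\<bar>\<integral>x. \<psi> x \<partial>\<pi>\<bar> \<le> \<tau> m" for m
  proof -
    have "(\<lambda>j. (real m + 4 * K0) * \<delta> (real j) + \<tau> m) \<longlonglongrightarrow> (real m + 4 * K0) * 0 + \<tau> m"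
      by (intro tendsto_intros \<delta>_lim)
    then show ?thesis
      using LIMSEQ_le_const[of _ _ "\<bar>\<integral>x. \<psi> x \<partial>\<pi>\<bar>"] le1[of m] by fastforce
  qed
  have "\<bar>\<integral>x. \<psi> x \<partial>\<pi>\<bar> \<le> 0"
    using LIMSEQ_le_const[OF \<tau>_lim, of "\<bar>\<integral>x. \<psi> x \<partial>\<pi>\<bar>"] le2 by blast
  with i_\<psi> show "integrable \<pi> (\<lambda>x. dissipation x - injection x)" "(\<integral>x. dissipation x - injection x \<partial>\<pi>) = 0"
    by (simp_all add: \<psi>_def[abs_def])
qed

end

section \<open>The dissipation identity\<close>

text \<open>Positive definiteness makes the kernel trivial, hence \<open>M\<close> invertible. The
  transpose of its inverse is a left inverse of the symmetric \<open>M\<close>, and inverses are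
  unique.\<close>

lemma symmetric_positive_definite_inverse:
  fixes M :: "real^'d^'d"
  assumes "symmetric_positive_definite M"
  shows "transpose (matrix_inv M) = matrix_inv M"
proof -
  have sym: "transpose M = M" and pos: "\<And>x. x \<noteq> 0 \<Longrightarrow> x \<bullet> (M *v x) > 0"
    using assms by (auto simp: symmetric_positive_definite_def)
  have "x = 0" if "M *v x = 0" for x
    using pos[of x] that by (cases "x = 0") auto
  then have "invertible M"
    unfolding invertible_left_inverse matrix_left_invertible_ker by blast
  then have inv: "M ** matrix_inv M = mat 1" "matrix_inv M ** M = mat 1"
    unfolding invertible_def matrix_inv_def by (metis (mono_tags, lifting) someI_ex)+
  have "transpose (matrix_inv M) ** M = mat 1"
    using inv(1) sym by (metis matrix_transpose_mul transpose_mat)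
  then have "transpose (matrix_inv M) = transpose (matrix_inv M) ** (M ** matrix_inv M)"
    using inv by simp
  also have "\<dots> = matrix_inv M"
    using \<open>transpose (matrix_inv M) ** M = mat 1\<close> by (simp add: matrix_mul_assoc)
  finally show ?thesis .
qed

text \<open>In finite dimension a linear functional is the inner product with the vector of its
  values on the basis, so a gradient exists and the description in \<open>gradient\<close> denotes
  it.\<close>

lemma differentiable_GDERIV_gradient:
  fixes V :: "real^'d \<Rightarrow> real"
  assumes "V differentiable at x"
  shows "GDERIV V x :> gradient V x"
proof -
  obtain D where D: "(V has_derivative D) (at x)"
    using assms unfolding differentiable_def by blast
  interpret D: linear D using D by (rule has_derivative_linear)
  define g where "g = (\<Sum>b\<in>Basis. D b *\<^sub>R b)"
  have "D h = h \<bullet> g" for h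
  proof -
    have "D h = D (\<Sum>b\<in>Basis. (h \<bullet> b) *\<^sub>R b)" by (simp add: euclidean_representation)
    also have "\<dots> = h \<bullet> g" by (simp add: D.sum D.scaleR g_def inner_sum_right mult.commute)
    finally show ?thesis .
  qed
  then have "D = (\<lambda>h. h \<bullet> g)" by (rule ext)
  with D have "GDERIV V x :> g" unfolding gderiv_def by simp
  with gradient_eq show ?thesis by metis
qed

lemma twice_continuously_differentiable_gradient:
  assumes "twice_continuously_differentiable V"
  shows "GDERIV V x :> gradient V x" "continuous_on UNIV (gradient V)"
  using assms unfolding twice_continuously_differentiable_def
  by (auto intro: differentiable_GDERIV_gradient differentiable_imp_continuous_on
      simp: differentiable_on_def differentiable_at_withinI)

section \<open>The bounded observable and its derivatives\<close>

lemma scaled_arctan_derivatives: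
  fixes \<epsilon> :: real
  assumes "\<epsilon> > 0"
  shows "((\<lambda>x. arctan (\<epsilon> * x) / \<epsilon>) has_field_derivative 1 / (1 + (\<epsilon> * x)\<^sup>2)) (at x)"
    "((\<lambda>x. 1 / (1 + (\<epsilon> * x)\<^sup>2)) has_field_derivative - 2 * \<epsilon> * (\<epsilon> * x) / (1 + (\<epsilon> * x)\<^sup>2)\<^sup>2) (at x)"
    "((\<lambda>x. - 2 * \<epsilon> * (\<epsilon> * x) / (1 + (\<epsilon> * x)\<^sup>2)\<^sup>2) has_field_derivative
        \<epsilon>\<^sup>2 * (6 * (\<epsilon> * x)\<^sup>2 - 2) / (1 + (\<epsilon> * x)\<^sup>2) ^ 3) (at x)"
proof -
  have pos: "1 + (\<epsilon> * x)\<^sup>2 > 0" by (simp add: add_pos_nonneg)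
  show "((\<lambda>x. arctan (\<epsilon> * x) / \<epsilon>) has_field_derivative 1 / (1 + (\<epsilon> * x)\<^sup>2)) (at x)"
  proof -
    have "((\<lambda>x. arctan (\<epsilon> * x) / \<epsilon>) has_field_derivative (inverse (1 + (\<epsilon> * x)\<^sup>2) * \<epsilon>) / \<epsilon>) (at x)"
      by (auto intro!: derivative_eq_intros)
    then show ?thesis using assms by (simp add: inverse_eq_divide)
  qed
  show "((\<lambda>x. 1 / (1 + (\<epsilon> * x)\<^sup>2)) has_field_derivative - 2 * \<epsilon> * (\<epsilon> * x) / (1 + (\<epsilon> * x)\<^sup>2)\<^sup>2) (at x)"
    using pos by (auto intro!: derivative_eq_intros simp: power2_eq_square)
  define y where "y = 1 + (\<epsilon> * x)\<^sup>2"
  have y: "y > 0" "(\<epsilon> * x)\<^sup>2 = y - 1" using pos by (simp_all add: y_def)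
  have "((\<lambda>x. - 2 * \<epsilon> * (\<epsilon> * x) / (1 + (\<epsilon> * x)\<^sup>2)\<^sup>2) has_field_derivative
      (- 2 * \<epsilon> * \<epsilon> * y\<^sup>2 - (- 2 * \<epsilon> * (\<epsilon> * x)) * (2 * y * (2 * (\<epsilon> * x) * \<epsilon>))) / (y\<^sup>2 * y\<^sup>2)) (at x)"
  proof -
    have num: "((\<lambda>x. - 2 * \<epsilon> * (\<epsilon> * x)) has_field_derivative - 2 * \<epsilon> * \<epsilon>) (at x)"
      by (auto intro!: derivative_eq_intros)
    have den: "((\<lambda>x. (1 + (\<epsilon> * x)\<^sup>2)\<^sup>2) has_field_derivative 2 * y * (2 * (\<epsilon> * x) * \<epsilon>)) (at x)"
      by (auto intro!: derivative_eq_intros simp: y_def)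
    show ?thesis
      using DERIV_divide[OF num den] y(1) by (simp add: y_def)
  qed
  \<comment> \<open>Arranged so that one factor \<open>y\<close> cancels: with y = 1 + (\<epsilon>
    x)^2 the bracket 8 (\<epsilon> x)^2 - 2 y becomes 6 (\<epsilon> x)^2 - 2.\<close>
  also have "(- 2 * \<epsilon> * \<epsilon> * y\<^sup>2 - (- 2 * \<epsilon> * (\<epsilon> * x)) * (2 * y * (2 * (\<epsilon> * x) * \<epsilon>))) / (y\<^sup>2 * y\<^sup>2)
      = (\<epsilon>\<^sup>2 * y * (8 * (\<epsilon> * x)\<^sup>2 - 2 * y)) / (y * y ^ 3)"
    by (simp add: power2_eq_square power3_eq_cube algebra_simps)
  also have "\<dots> = \<epsilon>\<^sup>2 * (6 * (\<epsilon> * x)\<^sup>2 - 2) / y ^ 3"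
    using y(1) unfolding y(2) by simp
  finally show "((\<lambda>x. - 2 * \<epsilon> * (\<epsilon> * x) / (1 + (\<epsilon> * x)\<^sup>2)\<^sup>2) has_field_derivative
        \<epsilon>\<^sup>2 * (6 * (\<epsilon> * x)\<^sup>2 - 2) / (1 + (\<epsilon> * x)\<^sup>2) ^ 3) (at x)"
    by (simp add: y_def)
qed

text \<open>The third bound is the crucial one: it is relative to the first derivative rather than a
  constant, and follows from 2 |z| \<le> 1 + z^2.\<close>

lemma scaled_arctan_bounds:
  fixes \<epsilon> :: real
  assumes "\<epsilon> > 0"
  shows "\<bar>arctan (\<epsilon> * x) / \<epsilon>\<bar> \<le> 2 / \<epsilon>"
    "\<bar>1 / (1 + (\<epsilon> * x)\<^sup>2)\<bar> \<le> 1"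
    "\<bar>- 2 * \<epsilon> * (\<epsilon> * x) / (1 + (\<epsilon> * x)\<^sup>2)\<^sup>2\<bar> \<le> \<epsilon> * (1 / (1 + (\<epsilon> * x)\<^sup>2))"
    "\<bar>\<epsilon>\<^sup>2 * (6 * (\<epsilon> * x)\<^sup>2 - 2) / (1 + (\<epsilon> * x)\<^sup>2) ^ 3\<bar> \<le> 6 * \<epsilon>\<^sup>2"
proof -
  define z where "z = \<epsilon> * x"
  have z: "1 \<le> 1 + z\<^sup>2" by simp
  have "\<bar>arctan z\<bar> \<le> 2" using arctan_bounded[of z] pi_half_less_two by linarith
  then show "\<bar>arctan (\<epsilon> * x) / \<epsilon>\<bar> \<le> 2 / \<epsilon>"
    using assms by (simp add: z_def abs_divide divide_right_mono)
  show "\<bar>1 / (1 + (\<epsilon> * x)\<^sup>2)\<bar> \<le> 1"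
  proof -
    have "0 < 1 + z\<^sup>2" using z by linarith
    then show ?thesis unfolding z_def[symmetric] by (simp add: divide_le_eq_1)
  qed
  have "\<bar>2 * z\<bar> \<le> 1 + z\<^sup>2"
    using sum_squares_bound[of 1 "\<bar>z\<bar>"] by simp
  then have "\<bar>2 * z\<bar> / (1 + z\<^sup>2)\<^sup>2 \<le> (1 + z\<^sup>2) / (1 + z\<^sup>2)\<^sup>2" by (intro divide_right_mono) auto
  also have "\<dots> = 1 / (1 + z\<^sup>2)" using z by (simp add: power2_eq_square)
  finally have "\<epsilon> * (\<bar>2 * z\<bar> / (1 + z\<^sup>2)\<^sup>2) \<le> \<epsilon> * (1 / (1 + z\<^sup>2))" using assms by (intro mult_left_mono) auto
  then show "\<bar>- 2 * \<epsilon> * (\<epsilon> * x) / (1 + (\<epsilon> * x)\<^sup>2)\<^sup>2\<bar> \<le> \<epsilon> * (1 / (1 + (\<epsilon> * x)\<^sup>2))"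
    using assms unfolding z_def[symmetric] by (simp add: abs_mult mult_ac)
  have "\<bar>6 * z\<^sup>2 - 2\<bar> \<le> 6 * (1 + z\<^sup>2)" using zero_le_power2[of z] by (simp add: abs_le_iff)
  also have "\<dots> \<le> 6 * (1 + z\<^sup>2) ^ 3" using z power_increasing[of 1 3 "1 + z\<^sup>2"] by simp
  finally have "\<bar>6 * z\<^sup>2 - 2\<bar> \<le> 6 * (1 + z\<^sup>2) ^ 3" .
  then have "\<bar>6 * z\<^sup>2 - 2\<bar> / (1 + z\<^sup>2) ^ 3 \<le> 6" 
  proof -
    have "0 < (1 + z\<^sup>2) ^ 3" using z by (intro zero_less_power) linarith
    with \<open>\<bar>6 * z\<^sup>2 - 2\<bar> \<le> 6 * (1 + z\<^sup>2) ^ 3\<close> show ?thesis by (simp only: pos_divide_le_eq)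
  qed
  then have "\<epsilon>\<^sup>2 * (\<bar>6 * z\<^sup>2 - 2\<bar> / (1 + z\<^sup>2) ^ 3) \<le> \<epsilon>\<^sup>2 * 6" by (intro mult_left_mono) auto
  then show "\<bar>\<epsilon>\<^sup>2 * (6 * (\<epsilon> * x)\<^sup>2 - 2) / (1 + (\<epsilon> * x)\<^sup>2) ^ 3\<bar> \<le> 6 * \<epsilon>\<^sup>2"
    using z unfolding z_def[symmetric] by (simp add: abs_mult mult_ac)
qed

text \<open>The limit \<epsilon> to 0, detached from the dynamics. \<open>A\<close> stands for the
  squared velocity, \<open>D\<close> for half the squared norm of the transposed \<open>S\<close>
  applied to it, \<open>a\<close> for half the trace. Since \<open>D\<close> is at most a multiple
  of \<open>A\<close>, for small \<epsilon> the balance is bounded below, so its hypothesis can be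
  discharged.\<close>

lemma (in prob_space) dissipation_identity_limit:
  fixes A D H :: "'a \<Rightarrow> real" and \<gamma> a c :: real
  assumes [measurable]: "A \<in> borel_measurable M" "H \<in> borel_measurable M"
    and A0: "\<And>x. 0 \<le> A x" and D: "\<And>x. 0 \<le> D x" "\<And>x. D x \<le> c * A x"
    and \<gamma>: "0 < \<gamma>"
    and balance: "\<And>\<epsilon> K. 0 < \<epsilon> \<Longrightarrow>
      (\<And>x. - K \<le> 1 / (1 + (\<epsilon> * H x)\<^sup>2) * (\<gamma> * A x)
          - (1 / (1 + (\<epsilon> * H x)\<^sup>2) * a + - 2 * \<epsilon> * (\<epsilon> * H x) / (1 + (\<epsilon> * H x)\<^sup>2)\<^sup>2 * D x)) \<Longrightarrow>
      integrable M (\<lambda>x. 1 / (1 + (\<epsilon> * H x)\<^sup>2) * (\<gamma> * A x)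
          - (1 / (1 + (\<epsilon> * H x)\<^sup>2) * a + - 2 * \<epsilon> * (\<epsilon> * H x) / (1 + (\<epsilon> * H x)\<^sup>2)\<^sup>2 * D x)) \<and>
      expectation (\<lambda>x. 1 / (1 + (\<epsilon> * H x)\<^sup>2) * (\<gamma> * A x)
          - (1 / (1 + (\<epsilon> * H x)\<^sup>2) * a + - 2 * \<epsilon> * (\<epsilon> * H x) / (1 + (\<epsilon> * H x)\<^sup>2)\<^sup>2 * D x)) = 0"
  shows "integrable M A" "a = \<gamma> * expectation A"
proof -
  define c' where "c' = \<bar>c\<bar> + 1"
  have c': "c' > 0" "c \<le> c'" by (simp_all add: c'_def)
  \<comment> \<open>The prefactor makes \<epsilon> c' at most \<gamma> / 2 for every
    \<open>m\<close>, so the second-derivative term uses up at most half of the friction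
    term.\<close>
  define \<epsilon> where "\<epsilon> m = \<gamma> / (2 * c') * (1 / real (Suc m))" for m
  define \<phi> where "\<phi> m x = 1 / (1 + (\<epsilon> m * H x)\<^sup>2)" for m x
  define \<phi>' where "\<phi>' m x = - 2 * \<epsilon> m * (\<epsilon> m * H x) / (1 + (\<epsilon> m * H x)\<^sup>2)\<^sup>2" for m x
  define \<psi> where "\<psi> m x = \<phi> m x * (\<gamma> * A x) - (\<phi> m x * a + \<phi>' m x * D x)" for m x
  have \<epsilon>: "0 < \<epsilon> m" "\<epsilon> m \<le> \<gamma> / (2 * c')" for m
    using \<gamma> c' by (auto simp: \<epsilon>_def mult_le_cancel_left1 divide_le_eq not_less)
  have \<epsilon>_lim: "\<epsilon> \<longlonglongrightarrow> 0"
    unfolding \<epsilon>_def[abs_def]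
    using tendsto_mult[OF tendsto_const[of "\<gamma> / (2 * c')"] LIMSEQ_inverse_real_of_nat[unfolded inverse_eq_divide]] by simp
  have \<phi>: "0 \<le> \<phi> m x" "\<phi> m x \<le> 1" for m x
    using scaled_arctan_bounds(2)[OF \<epsilon>(1), of m "H x"] by (auto simp: \<phi>_def)
  have \<phi>'D: "\<bar>\<phi>' m x * D x\<bar> \<le> \<phi> m x * (\<gamma> / 2 * A x)" for m x
  proof -
    have "\<bar>\<phi>' m x * D x\<bar> \<le> (\<epsilon> m * \<phi> m x) * (c' * A x)"
      unfolding abs_mult
    proof (rule mult_mono)
      show "\<bar>\<phi>' m x\<bar> \<le> \<epsilon> m * \<phi> m x"
        using scaled_arctan_bounds(3)[OF \<epsilon>(1), of m "H x"] unfolding \<phi>_def \<phi>'_def .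
      show "\<bar>D x\<bar> \<le> c' * A x"
        using D[of x] mult_right_mono[OF c'(2) A0[of x]] by simp
    qed (use \<epsilon>(1)[of m] \<phi>(1)[of m x] in auto)
    also have "\<dots> = \<phi> m x * ((\<epsilon> m * c') * A x)" by simp
    also have "\<dots> \<le> \<phi> m x * (\<gamma> / 2 * A x)"
    proof (intro mult_left_mono mult_right_mono A0 \<phi>)
      have "\<epsilon> m * c' \<le> \<gamma> / (2 * c') * c'" using \<epsilon>(2)[of m] c' by (intro mult_right_mono) auto
      then show "\<epsilon> m * c' \<le> \<gamma> / 2" using c' by simp
    qed
    finally show ?thesis .
  qed
  have \<phi>a: "\<bar>\<phi> m x * a\<bar> \<le> \<bar>a\<bar>" for m x
    using \<phi>[of m x] by (simp add: abs_mult mult_left_le_one_le)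
  have lower: "\<phi> m x * (\<gamma> / 2 * A x) - \<bar>a\<bar> \<le> \<psi> m x" for m x
  proof -
    have "\<phi> m x * (\<gamma> * A x) = 2 * (\<phi> m x * (\<gamma> / 2 * A x))" by simp
    then show ?thesis using \<phi>'D[of m x] \<phi>a[of m x] unfolding \<psi>_def by linarith
  qed
  have nonneg: "0 \<le> \<phi> m x * (\<gamma> / 2 * A x)" for m x
    using \<phi>(1)[of m x] A0[of x] \<gamma> by simp
  have \<psi>: "integrable M (\<psi> m)" "expectation (\<psi> m) = 0" for m
  proof -
    have "- \<bar>a\<bar> \<le> \<psi> m x" for x using lower[of m x] nonneg[of m x] by linarith
    from balance[OF \<epsilon>(1)[of m], of "\<bar>a\<bar>", folded \<phi>_def \<phi>'_def, folded \<psi>_def, OF this]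
    show "integrable M (\<psi> m)" "expectation (\<psi> m) = 0" by auto
  qed
  have [measurable]: "\<phi> m \<in> borel_measurable M" for m unfolding \<phi>_def[abs_def] by measurable
  have i_\<phi>A: "integrable M (\<lambda>x. \<phi> m x * (\<gamma> / 2 * A x))" for m
  proof (rule Bochner_Integration.integrable_bound)
    show "integrable M (\<lambda>x. \<psi> m x + \<bar>a\<bar>)" using \<psi>(1) by auto
    show "AE x in M. norm (\<phi> m x * (\<gamma> / 2 * A x)) \<le> norm (\<psi> m x + \<bar>a\<bar>)"
    proof (rule AE_I2)
      show "norm (\<phi> m x * (\<gamma> / 2 * A x)) \<le> norm (\<psi> m x + \<bar>a\<bar>)" for x
        using lower[of m x] nonneg[of m x] by (simp only: real_norm_def)
    qed
  qed measurable
  have e_\<phi>A: "expectation (\<lambda>x. \<phi> m x * (\<gamma> / 2 * A x)) \<le> \<bar>a\<bar>" for m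
  proof -
    have "expectation (\<lambda>x. \<phi> m x * (\<gamma> / 2 * A x)) \<le> expectation (\<lambda>x. \<psi> m x + \<bar>a\<bar>)"
    proof (rule integral_mono[OF i_\<phi>A])
      show "integrable M (\<lambda>x. \<psi> m x + \<bar>a\<bar>)" using \<psi>(1) by auto
      show "\<phi> m x * (\<gamma> / 2 * A x) \<le> \<psi> m x + \<bar>a\<bar>" for x using lower[of m x] by linarith
    qed
    also have "\<dots> = \<bar>a\<bar>" using \<psi> by (simp add: prob_space)
    finally show ?thesis .
  qed
  have \<phi>_lim: "(\<lambda>m. \<phi> m x) \<longlonglongrightarrow> 1" for x
  proof -
    have "(\<lambda>m. 1 / (1 + (\<epsilon> m * H x)\<^sup>2)) \<longlonglongrightarrow> 1 / (1 + (0 * H x)\<^sup>2)"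
      by (intro tendsto_intros \<epsilon>_lim) simp
    then show ?thesis by (simp add: \<phi>_def)
  qed
  have \<phi>'_lim: "(\<lambda>m. \<phi>' m x) \<longlonglongrightarrow> 0" for x
  proof -
    have "(\<lambda>m. - 2 * \<epsilon> m * (\<epsilon> m * H x) / (1 + (\<epsilon> m * H x)\<^sup>2)\<^sup>2) \<longlonglongrightarrow> - 2 * 0 * (0 * H x) / (1 + (0 * H x)\<^sup>2)\<^sup>2"
      by (intro tendsto_intros \<epsilon>_lim) simp
    then show ?thesis by (simp add: \<phi>'_def)
  qed
  have "integrable M (\<lambda>x. \<gamma> / 2 * A x)"
  proof (rule integrable_limit_of_bounded_integrals(1)[OF i_\<phi>A nonneg e_\<phi>A])
    show "(\<lambda>m. \<phi> m x * (\<gamma> / 2 * A x)) \<longlonglongrightarrow> \<gamma> / 2 * A x" for x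
      using tendsto_mult[OF \<phi>_lim[of x] tendsto_const[of "\<gamma> / 2 * A x"]] by simp
  qed
  then have "integrable M (\<lambda>x. 2 / \<gamma> * (\<gamma> / 2 * A x))" by (rule integrable_mult_right)
  then show i_A: "integrable M A" using \<gamma> by simp
  \<comment> \<open>Integrability of \<open>A\<close>, just obtained from Fatou, now provides the
    dominating function; every term of this sequence is 0.\<close>
  have "(\<lambda>m. expectation (\<psi> m)) \<longlonglongrightarrow> expectation (\<lambda>x. \<gamma> * A x - a)"
  proof (rule integral_dominated_convergence[where w="\<lambda>x. 2 * (\<gamma> * A x) + \<bar>a\<bar>"])
    show "AE x in M. (\<lambda>m. \<psi> m x) \<longlonglongrightarrow> \<gamma> * A x - a"
    proof (rule AE_I2)
      fix x
      have "(\<lambda>m. \<psi> m x) \<longlonglongrightarrow> 1 * (\<gamma> * A x) - (1 * a + 0 * D x)"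
        unfolding \<psi>_def by (intro tendsto_intros \<phi>_lim \<phi>'_lim)
      then show "(\<lambda>m. \<psi> m x) \<longlonglongrightarrow> \<gamma> * A x - a" by simp
    qed
    show "AE x in M. norm (\<psi> m x) \<le> 2 * (\<gamma> * A x) + \<bar>a\<bar>" for m
    proof (rule AE_I2)
      fix x
      have "0 \<le> \<gamma> * A x" using \<gamma> A0 by simp
      then have "0 \<le> \<phi> m x * (\<gamma> * A x)" "\<phi> m x * (\<gamma> * A x) \<le> \<gamma> * A x"
        using \<phi>[of m x] by (auto intro: mult_left_le_one_le)
      moreover have "\<phi> m x * (\<gamma> / 2 * A x) = (\<phi> m x * (\<gamma> * A x)) / 2" by simp
      ultimately show "norm (\<psi> m x) \<le> 2 * (\<gamma> * A x) + \<bar>a\<bar>"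
        using \<phi>'D[of m x] \<phi>a[of m x] \<open>0 \<le> \<gamma> * A x\<close> unfolding \<psi>_def real_norm_def by linarith
    qed
    show "\<psi> m \<in> borel_measurable M" for m using \<psi>(1)[of m] by auto
    show "integrable M (\<lambda>x. 2 * (\<gamma> * A x) + \<bar>a\<bar>)" using i_A by auto
  qed measurable
  then have "expectation (\<lambda>x. \<gamma> * A x - a) = 0"
    using LIMSEQ_unique[OF _ tendsto_const[of 0]] by (simp add: \<psi>(2))
  then show "a = \<gamma> * expectation A" using i_A by (simp add: prob_space)
qed

text \<open>Integrability belongs to the conclusion because the Bochner integral of a non-integrable
  function is 0 by convention; the identity alone would not say that the expectation exists.\<close>

theorem theorem3p1:
  fixes V :: "real^'d \<Rightarrow> real"
    and M \<Sigma> :: "real^'d^'d"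
    and \<gamma> :: real
    and \<pi> :: "((real^'d) \<times> (real^'d)) measure"
  assumes "twice_continuously_differentiable V"
    and "symmetric_positive_definite M"
    and "\<gamma> > 0"
    and "langevin_invariant_distribution TYPE('w) V M \<gamma> \<Sigma> \<pi>"
  shows "integrable \<pi> (\<lambda>(q, p). p \<bullet> ((matrix_inv M ** matrix_inv M) *v p)) \<and>
    trace ((\<Sigma> ** transpose \<Sigma>) ** matrix_inv M) =
      \<gamma> * (LINT (q, p)|\<pi>. p \<bullet> ((matrix_inv M ** matrix_inv M) *v p))"
proof -
  note V = twice_continuously_differentiable_gradient[OF assms(1)]
  define N where "N = matrix_inv M"
  define S where "S = sqrt 2 *\<^sub>R \<Sigma>"
  have N_sym: "transpose N = N"
    unfolding N_def using assms(2) by (rule symmetric_positive_definite_inverse)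
  have S: "S *v x = sqrt 2 *\<^sub>R (\<Sigma> *v x)" for x
    by (simp add: S_def scaleR_matrix_vector_assoc)
  from assms(4) have \<pi>: "prob_space \<pi>" "sets \<pi> = sets borel"
    unfolding langevin_invariant_distribution_def by auto
  from assms(4) obtain P :: "'w measure" and F W q p where
    P: "prob_space P" and filt: "filtration (space P) F" and sub: "\<forall>t. subalgebra P (F t)"
    and wiener: "wiener_process P F W" and sol: "langevin_solution V M \<gamma> \<Sigma> P F W q p"
    and stat: "\<forall>t\<ge>0. distr P borel (\<lambda>\<omega>. (q t \<omega>, p t \<omega>)) = \<pi>"
    unfolding langevin_invariant_distribution_def by blast
  interpret P: prob_space P by fact
  define H where "H x = snd x \<bullet> (N *v snd x) / 2 + V (fst x)" for x
  define A where "A x = (norm (N *v snd x))\<^sup>2" for x :: "(real^'d) \<times> (real^'d)"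
  define D where "D x = (norm (transpose S *v (N *v snd x)))\<^sup>2 / 2" for x :: "(real^'d) \<times> (real^'d)"
  define a where "a = trace (transpose S ** N ** S) / 2"
  \<comment> \<open>The last four arguments bound the observable and its first three derivatives;
    \<open>\<epsilon>\<close> bounds the second because the first is at most 1.\<close>
  have stationary: "stationary_langevin P F W q p V (gradient V) N S \<gamma> \<pi>
      (\<lambda>x. arctan (\<epsilon> * x) / \<epsilon>) (\<lambda>x. 1 / (1 + (\<epsilon> * x)\<^sup>2)) (\<lambda>x. - 2 * \<epsilon> * (\<epsilon> * x) / (1 + (\<epsilon> * x)\<^sup>2)\<^sup>2)
      (\<lambda>x. \<epsilon>\<^sup>2 * (6 * (\<epsilon> * x)\<^sup>2 - 2) / (1 + (\<epsilon> * x)\<^sup>2) ^ 3) (2 / \<epsilon>) 1 \<epsilon> (6 * \<epsilon>\<^sup>2)"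
    if \<epsilon>: "0 < \<epsilon>" for \<epsilon> :: real
  proof (intro stationary_langevin.intro stationary_langevin_axioms.intro)
    show "gaussian_increment P (F s) (\<lambda>\<omega>. W t \<omega> - W s \<omega>) (t - s)" if "0 \<le> s" "s < t" for s t
      using wiener that sub P
      by (intro gaussian_increment.intro gaussian_increment_axioms.intro) (auto simp: wiener_process_def)
    show "AE \<omega> in P. \<forall>t\<ge>0.
        ((\<lambda>s. N *v p s \<omega>) has_integral (q t \<omega> - q 0 \<omega>)) {0..t} \<and>
        ((\<lambda>s. - \<gamma> *\<^sub>R (N *v p s \<omega>) - gradient V (q s \<omega>)) has_integral
           (p t \<omega> - p 0 \<omega> - (S *v W t \<omega> - S *v W 0 \<omega>))) {0..t}"
      using sol unfolding langevin_solution_def N_def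
      by (simp add: S matrix_vector_mult_diff_distrib scaleR_diff_right)
    show "\<bar>- 2 * \<epsilon> * (\<epsilon> * x) / (1 + (\<epsilon> * x)\<^sup>2)\<^sup>2\<bar> \<le> \<epsilon>" for x
      using scaled_arctan_bounds(3)[OF \<epsilon>, of x] mult_left_mono[OF order_trans[OF abs_ge_self scaled_arctan_bounds(2)[OF \<epsilon>, of x]], of \<epsilon>] \<epsilon>
      by linarith
  qed (use P filt sub wiener sol stat N_sym V scaled_arctan_derivatives[OF \<epsilon>] scaled_arctan_bounds[OF \<epsilon>]
      in \<open>auto simp: wiener_process_def langevin_solution_def\<close>)
  \<comment> \<open>The energy does not depend on \<epsilon>, so its measurability can be read off
    the instance with \<epsilon> = 1.\<close>
  have energy_measurable: "H \<in> borel_measurable borel"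
    using stationary_langevin.energy_measurable[OF stationary[OF zero_less_one]]
    unfolding H_def[abs_def] stationary_langevin.energy_def[OF stationary[OF zero_less_one], abs_def] by simp
  have A_measurable: "A \<in> borel_measurable borel"
    unfolding A_def[abs_def] using stationary_langevin.velocity_measurable(1)[OF stationary[OF zero_less_one]] by measurable
  obtain k where k: "\<And>x. norm (transpose S *v x) \<le> norm x * k"
    using bounded_linear.pos_bounded[OF matrix_vector_mul_bounded_linear[of "transpose S"]] by blast
  interpret \<pi>: prob_space \<pi> by fact
  have A: "A \<in> borel_measurable \<pi>" "H \<in> borel_measurable \<pi>" "0 \<le> A x" for x
    using energy_measurable A_measurable \<pi>(2) by (auto simp: A_def cong: measurable_cong_sets)
  have D: "0 \<le> D x" "D x \<le> k\<^sup>2 / 2 * A x" for x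
    using power_mono[OF k[of "N *v snd x"], of 2] by (auto simp: D_def A_def power_mult_distrib mult.commute)
  have balance: "integrable \<pi> (\<lambda>x. 1 / (1 + (\<epsilon> * H x)\<^sup>2) * (\<gamma> * A x)
          - (1 / (1 + (\<epsilon> * H x)\<^sup>2) * a + - 2 * \<epsilon> * (\<epsilon> * H x) / (1 + (\<epsilon> * H x)\<^sup>2)\<^sup>2 * D x)) \<and>
      \<pi>.expectation (\<lambda>x. 1 / (1 + (\<epsilon> * H x)\<^sup>2) * (\<gamma> * A x)
          - (1 / (1 + (\<epsilon> * H x)\<^sup>2) * a + - 2 * \<epsilon> * (\<epsilon> * H x) / (1 + (\<epsilon> * H x)\<^sup>2)\<^sup>2 * D x)) = 0"
    if \<epsilon>: "0 < \<epsilon>" and le: "\<And>x. - K \<le> 1 / (1 + (\<epsilon> * H x)\<^sup>2) * (\<gamma> * A x)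
          - (1 / (1 + (\<epsilon> * H x)\<^sup>2) * a + - 2 * \<epsilon> * (\<epsilon> * H x) / (1 + (\<epsilon> * H x)\<^sup>2)\<^sup>2 * D x)" for \<epsilon> K
  proof -
    note L = stationary[OF \<epsilon>]
    note drift = stationary_langevin.invariant_mean_drift[OF L, of K]
    show "integrable \<pi> (\<lambda>x. 1 / (1 + (\<epsilon> * H x)\<^sup>2) * (\<gamma> * A x)
          - (1 / (1 + (\<epsilon> * H x)\<^sup>2) * a + - 2 * \<epsilon> * (\<epsilon> * H x) / (1 + (\<epsilon> * H x)\<^sup>2)\<^sup>2 * D x)) \<and>
      \<pi>.expectation (\<lambda>x. 1 / (1 + (\<epsilon> * H x)\<^sup>2) * (\<gamma> * A x)
          - (1 / (1 + (\<epsilon> * H x)\<^sup>2) * a + - 2 * \<epsilon> * (\<epsilon> * H x) / (1 + (\<epsilon> * H x)\<^sup>2)\<^sup>2 * D x)) = 0"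
      using drift le unfolding stationary_langevin.dissipation_def[OF L] stationary_langevin.injection_def[OF L]
        stationary_langevin.energy_def[OF L] H_def A_def D_def a_def
      by blast
  qed
  note limit = \<pi>.dissipation_identity_limit[where a=a, OF A D assms(3)]
  have result: "integrable \<pi> A" "a = \<gamma> * \<pi>.expectation A"
  proof -
    show "integrable \<pi> A" by (rule limit(1), rule balance)
    show "a = \<gamma> * \<pi>.expectation A" by (rule limit(2), rule balance)
  qed
  have A_eq: "A = (\<lambda>(q, p). p \<bullet> ((N ** N) *v p))"
  proof
    fix x :: "(real^'d) \<times> (real^'d)"
    \<comment> \<open>Symmetry of \<open>N\<close> turns the squared norm of the velocity into the
      quadratic form of the squared inverse mass matrix.\<close>
    have "(N *v y) \<bullet> (N *v y) = y \<bullet> ((N ** N) *v y)" for y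
      by (metis N_sym dot_lmul_matrix matrix_vector_mul_assoc transpose_matrix_vector)
    then show "A x = (case x of (q, p) \<Rightarrow> p \<bullet> ((N ** N) *v p))"
      by (simp add: A_def power2_norm_eq_inner split_beta)
  qed
  \<comment> \<open>The two factors \<open>sqrt 2\<close> in \<open>S\<close> cancel the one half in
    \<open>a\<close>; cyclicity of the trace then brings the product into the required
    order.\<close>
  have "a = trace (transpose \<Sigma> ** N ** \<Sigma>)"
  proof -
    have sqrt2: "sqrt 2 * (sqrt 2 * x) = 2 * x" for x by (simp add: mult.assoc[symmetric])
    have "transpose S ** N ** S = 2 *\<^sub>R (transpose \<Sigma> ** N ** \<Sigma>)"
      by (simp add: S_def vec_eq_iff matrix_matrix_mult_def transpose_def sum_distrib_left sum_distrib_right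
          mult_ac sqrt2)
    then show ?thesis by (simp add: a_def trace_def sum_distrib_left[symmetric])
  qed
  also have "\<dots> = trace ((\<Sigma> ** transpose \<Sigma>) ** N)"
    by (metis matrix_mul_assoc trace_mul_sym)
  finally show ?thesis
    using result unfolding A_eq N_def by simp
qed

end
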